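(* Let $H$ be the minimal Schrödinger operator in $L^2(\mathbb R^3,\mathbb C^n)$ with point interactions at the distinct points $x_1,\dots,x_m$, and let $\Pi=\{\mathcal H,\Gamma_0,\Gamma_1\}$ be the boundary triplet for $H^*$ described in the context. Then: (i) the Weyl function $M(\cdot)$ corresponding to $\Pi$ has the form $$M(z)=\bigoplus_{s=1}^nM_s(z),\qquad M_s(z)=\Bigl(\frac{i\sqrt z}{4\pi}\delta_{jk}+\widetilde G_{\sqrt z}(x_j-x_k)\Bigr)_{j,k=1}^m,\quad z\in\mathbb C_+,$$ where $\widetilde G_{\sqrt z}(x)=\dfrac{e^{i\sqrt z|x|}}{4\pi|x|}$ for $x\ne0$, $\widetilde G_{\sqrt z}(0)=0$, and $\delta_{jk}$ is the Kronecker symbol; (ii) the corresponding $\gamma$-field is $$\gamma(z)\overline\xi=\sum_{j=1}^m\xi_j\frac{e^{i\sqrt zr_j}}{4\pi r_j},\qquad \overline\xi=\{\xi_j\}_{j=1}^m,\ \xi_j\in\mathbb C^n,\quad z\in\mathbb C_+.$$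
   Context: Here $m,n\in\mathbb N$, $r_j=|x-x_j|$, $H=-\Delta\otimes I_n$ with $\operatorname{dom}(H)=\{f\in W_2^2(\mathbb R^3,\mathbb C^n): f(x_j)=0,\ j=1,\dots,m\}$. Every $f\in\operatorname{dom}(H^* )$ is uniquely $f=\sum_{j=1}^m(\xi_{0j}e^{-r_j}/r_j+\xi_{1j}e^{-r_j})+f_H$ with $\xi_{0j},\xi_{1j}\in\mathbb C^n$, $f_H\in\operatorname{dom}(H)$. The boundary triplet is $\mathcal H=\oplus_{j=1}^m\mathbb C^n$, $\Gamma_0f=4\pi\{\lim_{x\to x_j}f(x)|x-x_j|\}_{j=1}^m=4\pi\{\xi_{0j}\}_{j=1}^m$, $\Gamma_1f=\{\lim_{x\to x_j}(f(x)-\xi_{0j}/|x-x_j|)\}_{j=1}^m$. With $H_0=H^*\upharpoonright\ker\Gamma_0$ and $\mathcal N_z=\ker(H^*-z)$, the $\gamma$-field and Weyl function are $\gamma(z)=(\Gamma_0\upharpoonright\mathcal N_z)^{-1}$ and $M(z)=\Gamma_1\gamma(z)$, $z\in\rho(H_0)$. The branch of $\sqrt{\cdot}$ on $\mathbb C\setminus[0,\infty)$ is fixed by $\sqrt1=1$ (boundary value from the upper half-plane), so $\operatorname{Im}\sqrt z>0$. For an $m\times m$ matrix $B=(b_{jk})$, $\bigoplus_{s=1}^nB$ is identified with the operator $\{\xi_j\}_j\mapsto\{\sum_kb_{jk}\xi_k\}_j$ on $\mathcal H=\oplus_{j=1}^m\mathbb C^n$. *)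

theory Defs
  imports "HOL-Analysis.Analysis"
begin

definition square_integrable :: "(real^3 \<Rightarrow> complex^'n) \<Rightarrow> bool" where
  "square_integrable F \<longleftrightarrow>
     F \<in> borel_measurable lborel \<and> integrable lborel (\<lambda>x. (norm (F x))\<^sup>2)"

definition l2_rel :: "(real^3 \<Rightarrow> complex^'n) \<Rightarrow> (real^3 \<Rightarrow> complex^'n) \<Rightarrow> bool" where
  "l2_rel F G \<longleftrightarrow>
     square_integrable F \<and> square_integrable G \<and> (AE x in lborel. F x = G x)"

lemma part_equivp_l2_rel: "part_equivp (l2_rel :: _ \<Rightarrow> (real^3 \<Rightarrow> complex^'n) \<Rightarrow> bool)"
proof (rule part_equivpI)
  have "l2_rel (\<lambda>_. 0) (\<lambda>_. 0 :: complex^'n)"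
    by (simp add: l2_rel_def square_integrable_def)
  then show "\<exists>F::real^3 \<Rightarrow> complex^'n. l2_rel F F" by blast
  show "symp (l2_rel :: _ \<Rightarrow> (real^3 \<Rightarrow> complex^'n) \<Rightarrow> bool)"
    by (auto simp: symp_def l2_rel_def elim: eventually_mono)
  show "transp (l2_rel :: _ \<Rightarrow> (real^3 \<Rightarrow> complex^'n) \<Rightarrow> bool)"
    by (auto simp: transp_def l2_rel_def elim: eventually_elim2)
qed

quotient_type (overloaded) 'n l2 = "real^3 \<Rightarrow> complex^('n::finite)" / partial: l2_rel
  by (rule part_equivp_l2_rel)

definition represents :: "(real^3 \<Rightarrow> complex^'n::finite) \<Rightarrow> 'n l2 \<Rightarrow> bool" where
  "represents F f \<longleftrightarrow> square_integrable F \<and> abs_l2 F = f"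

lemma norm_vector_scalar_mult: "norm (c *s (v :: complex^'n)) = cmod c * norm v"
  by (simp add: norm_vec_def norm_mult L2_set_right_distrib)

lemma square_integrable_scale:
  fixes F :: "real^3 \<Rightarrow> complex^'n"
  assumes "square_integrable F"
  shows "square_integrable (\<lambda>x. c *s F x)"
proof -
  have "continuous_on UNIV (\<lambda>v::complex^'n. c *s v)"
    by (auto simp: vector_scalar_mult_def intro!: continuous_intros)
  then have "(\<lambda>v::complex^'n. c *s v) \<in> borel_measurable borel"
    by (rule borel_measurable_continuous_onI)
  then have "(\<lambda>x. c *s F x) \<in> borel_measurable lborel"
    using assms measurable_compose unfolding square_integrable_def by blast
  with assms show ?thesis
    by (simp add: square_integrable_def norm_vector_scalar_mult power_mult_distrib)
qed

lift_definition l2_scale :: "complex \<Rightarrow> 'n::finite l2 \<Rightarrow> 'n l2" is "\<lambda>c F x. c *s F x"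
  by (auto simp: l2_rel_def square_integrable_scale elim: eventually_mono)

lift_definition l2_inner :: "'n::finite l2 \<Rightarrow> 'n l2 \<Rightarrow> complex" is
  "\<lambda>F G. \<integral>x. (\<Sum>s\<in>UNIV. F x $ s * cnj (G x $ s)) \<partial>lborel"
proof -
  fix F F' G G' :: "real^3 \<Rightarrow> complex^'n"
  assume F: "l2_rel F F'" and G: "l2_rel G G'"
  have meas: "(\<lambda>x. \<Sum>s\<in>UNIV. A x $ s * cnj (B x $ s)) \<in> borel_measurable lborel"
    if "square_integrable A" "square_integrable B" for A B :: "real^3 \<Rightarrow> complex^'n"
  proof -
    have "(\<lambda>v::complex^'n. v $ s) \<in> borel_measurable borel"
      "(\<lambda>v::complex^'n. cnj (v $ s)) \<in> borel_measurable borel" for s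
      by (intro borel_measurable_continuous_onI continuous_intros)+
    from this[THEN measurable_compose[rotated]] that show ?thesis
      unfolding square_integrable_def
      by (intro borel_measurable_sum borel_measurable_times) auto
  qed
  show "(\<integral>x. (\<Sum>s\<in>UNIV. F x $ s * cnj (G x $ s)) \<partial>lborel)
      = (\<integral>x. (\<Sum>s\<in>UNIV. F' x $ s * cnj (G' x $ s)) \<partial>lborel)"
    using F G by (intro integral_cong_AE meas) (auto simp: l2_rel_def)
qed

definition partial :: "3 \<Rightarrow> (real^3 \<Rightarrow> real) \<Rightarrow> real^3 \<Rightarrow> real" where
  "partial i \<phi> x = frechet_derivative \<phi> (at x) (axis i 1)"

text \<open>The multi-index of order \<open>k\<close> is encoded as a list of \<open>k\<close> coordinate directions.\<close>

definition iter_partial :: "3 list \<Rightarrow> (real^3 \<Rightarrow> real) \<Rightarrow> real^3 \<Rightarrow> real" where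
  "iter_partial is \<phi> = foldr partial is \<phi>"

definition test_function :: "(real^3 \<Rightarrow> real) \<Rightarrow> bool" where
  "test_function \<phi> \<longleftrightarrow>
     (\<forall>is x. iter_partial is \<phi> differentiable (at x)) \<and> bounded {x. \<phi> x \<noteq> 0}"

text \<open>Real-valued test functions suffice, by linearity.\<close>

definition weak_deriv ::
    "3 list \<Rightarrow> (real^3 \<Rightarrow> complex^'n) \<Rightarrow> (real^3 \<Rightarrow> complex^'n) \<Rightarrow> bool" where
  "weak_deriv is F G \<longleftrightarrow>
     (\<forall>\<phi>. test_function \<phi> \<longrightarrow>
        (\<integral>x. iter_partial is \<phi> x *\<^sub>R F x \<partial>lborel)
          = (- 1) ^ length is *\<^sub>R (\<integral>x. \<phi> x *\<^sub>R G x \<partial>lborel))"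

definition sobolev_W22 :: "(real^3 \<Rightarrow> complex^'n) \<Rightarrow> bool" where
  "sobolev_W22 F \<longleftrightarrow>
     square_integrable F \<and>
     (\<forall>is. length is \<le> 2 \<longrightarrow> (\<exists>G. square_integrable G \<and> weak_deriv is F G))"

text \<open>Operators are given by their graphs. The values \<open>F (X j)\<close> are those of the continuous
  representative, which every \<open>W\<^sub>2\<^sup>2\<close> class in dimension three has.\<close>

definition minimal_op :: "('m \<Rightarrow> real^3) \<Rightarrow> ('n::finite l2 \<times> 'n l2) set" where
  "minimal_op X =
     {(f, g). \<exists>F D. represents F f \<and> continuous_on UNIV F \<and> sobolev_W22 F \<and> (\<forall>j. F (X j) = 0) \<and>
        (\<forall>i. square_integrable (D i) \<and> weak_deriv [i, i] F (D i)) \<and>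
        represents (\<lambda>x. - (\<Sum>i\<in>UNIV. D i x)) g}"

definition adjoint_op :: "('n::finite l2 \<times> 'n l2) set \<Rightarrow> ('n l2 \<times> 'n l2) set" where
  "adjoint_op A = {(f, g). \<forall>(u, v)\<in>A. l2_inner v f = l2_inner u g}"

definition defect_space :: "('m \<Rightarrow> real^3) \<Rightarrow> complex \<Rightarrow> 'n::finite l2 set" where
  "defect_space X z = {f. (f, l2_scale z f) \<in> adjoint_op (minimal_op X)}"

text \<open>The boundary maps are pointwise limits, so they are evaluated on the representative that is
  continuous away from the centres. It exists for \<open>f\<close> in the domain of the adjoint,
  and it is unique off the centres, hence the limits do not depend on the choice.\<close>

definition regular_rep :: "('m \<Rightarrow> real^3) \<Rightarrow> 'n::finite l2 \<Rightarrow> real^3 \<Rightarrow> complex^'n" where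
  "regular_rep X f = (SOME F. represents F f \<and> continuous_on (- range X) F)"

definition xi0 :: "('m \<Rightarrow> real^3) \<Rightarrow> 'n::finite l2 \<Rightarrow> 'm \<Rightarrow> complex^'n" where
  "xi0 X f j = Lim (at (X j)) (\<lambda>x. norm (x - X j) *\<^sub>R regular_rep X f x)"

definition Gamma0 :: "('m::finite \<Rightarrow> real^3) \<Rightarrow> 'n::finite l2 \<Rightarrow> complex^'n^'m" where
  "Gamma0 X f = (\<chi> j. (4 * pi) *\<^sub>R xi0 X f j)"

definition Gamma1 :: "('m::finite \<Rightarrow> real^3) \<Rightarrow> 'n::finite l2 \<Rightarrow> complex^'n^'m" where
  "Gamma1 X f =
     (\<chi> j. Lim (at (X j)) (\<lambda>x. regular_rep X f x - (1 / norm (x - X j)) *\<^sub>R xi0 X f j))"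

definition gamma_field ::
    "('m::finite \<Rightarrow> real^3) \<Rightarrow> complex \<Rightarrow> complex^'n^'m \<Rightarrow> 'n::finite l2" where
  "gamma_field X z = the_inv_into (defect_space X z) (Gamma0 X)"

definition weyl_function ::
    "('m::finite \<Rightarrow> real^3) \<Rightarrow> complex \<Rightarrow> complex^'n::finite^'m \<Rightarrow> complex^'n^'m" where
  "weyl_function X z = Gamma1 X \<circ> gamma_field X z"

text \<open>The branch with cut \<open>[0, \<infinity>)\<close>; on the cut it takes the boundary value from above.\<close>

definition sqrt_up :: "complex \<Rightarrow> complex" where
  "sqrt_up z = complex_of_real (sqrt (cmod z)) * exp (\<i> * complex_of_real (Arg2pi z / 2))"

lemma sqrt_up_power2: "(sqrt_up z)\<^sup>2 = z"
proof -
  have "(exp (\<i> * complex_of_real (Arg2pi z / 2)))\<^sup>2 = exp (\<i> * complex_of_real (Arg2pi z))"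
    by (simp add: exp_double[symmetric])
  moreover have "(complex_of_real (sqrt (cmod z)))\<^sup>2 = complex_of_real (cmod z)"
    by (metis norm_ge_zero of_real_power real_sqrt_pow2)
  ultimately show ?thesis
    using Arg2pi_eq[of z] by (simp add: sqrt_up_def power_mult_distrib)
qed

lemma Im_sqrt_up_pos:
  assumes "z \<notin> \<real>\<^sub>\<ge>\<^sub>0"
  shows "Im (sqrt_up z) > 0"
proof -
  have "z \<noteq> 0" using assms by auto
  have "Arg2pi z \<noteq> 0"
    using assms Arg2pi_eq_0[of z] by (auto simp: complex_nonneg_Reals_iff complex_is_Real_iff)
  then have "0 < Arg2pi z" "Arg2pi z < 2 * pi"
    using Arg2pi_ge_0[of z] Arg2pi_lt_2pi[of z] by auto
  then have "sin (Arg2pi z / 2) > 0" by (intro sin_gt_zero) auto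
  with \<open>z \<noteq> 0\<close> show ?thesis
    by (simp add: sqrt_up_def Im_exp)
qed

lemma sqrt_up_1: "sqrt_up 1 = 1"
  using Arg2pi_of_real[of 1] by (simp add: sqrt_up_def)

definition G_tilde :: "complex \<Rightarrow> real^3 \<Rightarrow> complex" where
  "G_tilde k x =
     (if x = 0 then 0 else exp (\<i> * k * of_real (norm x)) / (4 * of_real pi * of_real (norm x)))"

definition M_s :: "('m::finite \<Rightarrow> real^3) \<Rightarrow> complex \<Rightarrow> complex^'m^'m" where
  "M_s X z =
     (\<chi> j k. \<i> * sqrt_up z / (4 * of_real pi) * (if j = k then 1 else 0)
             + G_tilde (sqrt_up z) (X j - X k))"

text \<open>The direct sum of \<open>CARD('n)\<close> copies of \<open>B\<close>, acting on \<open>m\<close>-tuples of vectors in \<open>\<complex>\<^sup>n\<close>.\<close>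

definition direct_sum_copies :: "complex^'m^'m \<Rightarrow> complex^'n^'m::finite \<Rightarrow> complex^'n^'m" where
  "direct_sum_copies B \<xi> = (\<chi> j. \<Sum>k\<in>UNIV. B $ j $ k *s \<xi> $ k)"

end

theory Submission imports Defs begin

text \<open>
Let \<open>k\<close> be the square root of \<open>z\<close> with positive imaginary part, and let
\<open>G\<^sub>j (x) = exp (\<i> k |x - X j|) / (4 \<pi> |x - X j|)\<close>. The core of the theorem is that the defect space consists
exactly of the functions \<open>\<Sum>\<^sub>j G\<^sub>j \<xi>\<^sub>j\<close> (\<open>point_sources\<close>). Given this, the boundary values can be read off: near
\<open>X j\<close> the function \<open>G\<^sub>j\<close> is \<open>1 / (4 \<pi> r) + \<i> k / (4 \<pi>) + o(1)\<close> and the others are continuous, so that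
\<open>\<Gamma>\<^sub>0\<close> maps \<open>\<Sum>\<^sub>j G\<^sub>j \<xi>\<^sub>j\<close> to \<open>\<xi>\<close>, and \<open>\<Gamma>\<^sub>1\<close> applied to it is the matrix of the Weyl function applied
to \<open>\<xi>\<close> (\<open>Gamma0_point_sources\<close>, \<open>Gamma1_point_sources\<close>). The boundary maps are evaluated on a chosen
representative, but two representatives that are continuous off the centres agree there.

Both inclusions rest on Green's representation (\<open>representation_formula\<close>): for \<open>Im \<kappa> > 0\<close>, a
square integrable \<open>u\<close> with square integrable weak Laplacian and continuous at \<open>a\<close> has \<open>u(a)\<close> proportional to
the integral of \<open>(-\<Delta>u - \<kappa>\<^sup>2 u)\<close> against the fundamental solution centred at \<open>a\<close>. It is
obtained by replacing the distance \<open>r\<close> to \<open>a\<close> with \<open>s = sqrt (r\<^sup>2 + \<epsilon>\<^sup>2)\<close>. The resulting \<open>G\<^sub>\<epsilon>\<close> is smooth and decays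
exponentially, so after a cutoff it is a legitimate test function, and \<open>-(\<Delta> + \<kappa>\<^sup>2) G\<^sub>\<epsilon>\<close> is explicit: it is
\<open>\<epsilon>\<^sup>2 / s\<^sup>5\<close> times a bounded function of \<open>s\<close>, an approximate identity
(\<open>laplacian_green\<close>, \<open>smoothed_delta_approximate_identity\<close>).

The functions \<open>\<Sum>\<^sub>j G\<^sub>j \<xi>\<^sub>j\<close> lie in the defect space because, by the representation formula, pairing them with
\<open>(-\<Delta> - cnj z) u\<close> gives a combination of the values \<open>u (X j)\<close>, which vanish on the domain of the minimal operator
(\<open>point_sources_in_defect_space\<close>).

Conversely, let \<open>f\<close> be a component of an element of the defect space. The functional that sends a test function
\<open>\<phi>\<close> to the integral of \<open>(-\<Delta>\<phi> - z \<phi>) f\<close> vanishes whenever \<open>\<phi>\<close> vanishes at all centres, hence it is a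
combination of the evaluations at the centres, and by the representation formula some \<open>\<Sum>\<^sub>j G\<^sub>j \<eta>\<^sub>j\<close> induces the
same functional (\<open>weak_solution_off_points\<close>). The difference \<open>h\<close> of the two functions solves \<open>-\<Delta>h = z h\<close> weakly on the whole space.
Testing with translates of \<open>G\<^sub>\<epsilon>\<close> shows that all convolutions of \<open>h\<close> with the approximate identity vanish, and
\<open>\<epsilon> \<rightarrow> 0\<close> gives \<open>h = 0\<close> (\<open>helmholtz_equation_trivial\<close>).
\<close>

section \<open>Smooth functions and test functions\<close>

lemma partial_eqI:
  "(f has_derivative f') (at x) \<Longrightarrow> partial i f x = f' (axis i 1)"
  unfolding partial_def using frechet_derivative_at by metis

lemma has_derivative_differentiable:
  "f differentiable (at x) \<Longrightarrow> (f has_derivative frechet_derivative f (at x)) (at x)"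
  by (simp add: frechet_derivative_works[symmetric])

lemma has_derivative_componentI:
  "((\<lambda>x::real^3. x $ i) has_derivative (\<lambda>h. h $ i)) (at x)"
  by (rule bounded_linear.has_derivative[OF bounded_linear_vec_nth has_derivative_ident])

lemma partial_add:
  assumes "f differentiable (at x)" "g differentiable (at x)"
  shows "partial i (\<lambda>x. f x + g x) x = partial i f x + partial i g x"
  by (subst partial_eqI[OF has_derivative_add[OF assms[THEN has_derivative_differentiable]]])
     (simp add: partial_def)

lemma partial_mult:
  assumes "f differentiable (at x)" "g differentiable (at x)"
  shows "partial i (\<lambda>x. f x * g x) x = f x * partial i g x + partial i f x * g x"
  by (subst partial_eqI[OF has_derivative_mult[OF assms[THEN has_derivative_differentiable]]])
     (simp add: partial_def)

lemma partial_const: "partial i (\<lambda>x. c) = (\<lambda>x. 0)"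
  by (rule ext, rule partial_eqI[where f'="\<lambda>h. 0", simplified]) simp

lemma partial_cmult:
  assumes "f differentiable (at x)"
  shows "partial i (\<lambda>x. c * f x) x = c * partial i f x"
  using partial_mult[of "\<lambda>x. c" x f i] assms by (simp add: partial_const)

lemma partial_component: "partial i (\<lambda>x. x $ j) = (\<lambda>x. if i = j then 1 else 0)"
  by (rule ext) (subst partial_eqI[OF has_derivative_componentI], simp add: axis_def)

lemma has_derivative_chain_real:
  fixes g :: "real^3 \<Rightarrow> real"
  assumes "(u has_real_derivative u') (at (g x))" "(g has_derivative g') (at x)"
  shows "((\<lambda>x. u (g x)) has_derivative (\<lambda>h. u' * g' h)) (at x)"
  using diff_chain_at[OF assms(2) assms(1)[unfolded has_field_derivative_def]]
  by (simp add: o_def)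

lemma partial_chain:
  assumes "(u has_real_derivative u') (at (g x))" "g differentiable (at x)"
  shows "partial i (\<lambda>x. u (g x)) x = u' * partial i g x"
  by (subst partial_eqI[OF has_derivative_chain_real[OF assms(1) has_derivative_differentiable[OF assms(2)]]])
     (simp add: partial_def)

definition smooth :: "(real^3 \<Rightarrow> real) \<Rightarrow> bool" where
  "smooth \<phi> \<longleftrightarrow> (\<forall>is x. iter_partial is \<phi> differentiable (at x))"

lemma iter_partial_Nil [simp]: "iter_partial [] \<phi> = \<phi>"
  by (simp add: iter_partial_def)

lemma iter_partial_Cons: "iter_partial (i # is) \<phi> = partial i (iter_partial is \<phi>)"
  by (simp add: iter_partial_def)

lemma iter_partial_append: "iter_partial (is @ js) \<phi> = iter_partial is (iter_partial js \<phi>)"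
  by (simp add: iter_partial_def)

lemma smooth_iter_partial: "smooth \<phi> \<Longrightarrow> smooth (iter_partial is \<phi>)"
  unfolding smooth_def by (metis iter_partial_append)

lemma smooth_partial: "smooth \<phi> \<Longrightarrow> smooth (partial i \<phi>)"
  using smooth_iter_partial[of \<phi> "[i]"] by (simp add: iter_partial_Cons)

lemma smooth_differentiable: "smooth \<phi> \<Longrightarrow> \<phi> differentiable (at x)"
  unfolding smooth_def by (metis iter_partial_Nil)

text \<open>A class of functions that is differentiable and closed under partial derivatives consists of smooth
functions. This reduces closure properties of smoothness to a single step of differentiation.\<close>

lemma smooth_coinduct:
  assumes "C \<phi>"
    and step: "\<And>\<psi>. C \<psi> \<Longrightarrow> (\<forall>x. \<psi> differentiable (at x)) \<and> (\<forall>i. C (partial i \<psi>))"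
  shows "smooth \<phi>"
proof -
  have "C (iter_partial is \<phi>)" for "is"
    by (induction "is") (auto simp: iter_partial_Cons assms)
  with step show ?thesis by (auto simp: smooth_def)
qed

text \<open>The rule \<open>base\<close> puts all smooth functions into the hull. The hull is then again a class of smooth
functions by coinduction, which turns its introduction rules into closure properties of \<open>smooth\<close>.
In the rule \<open>comp\<close> the sequence \<open>u\<close> lists the successive derivatives of a function on \<open>S\<close>; restricting
to a set that contains the values of \<open>g\<close> covers real powers of positive functions.\<close>

inductive smooth_hull :: "(real^3 \<Rightarrow> real) \<Rightarrow> bool" where
  base: "smooth f \<Longrightarrow> smooth_hull f"
| const: "smooth_hull (\<lambda>x. c)"
| component: "smooth_hull (\<lambda>x. x $ i)"
| add: "smooth_hull f \<Longrightarrow> smooth_hull g \<Longrightarrow> smooth_hull (\<lambda>x. f x + g x)"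
| mult: "smooth_hull f \<Longrightarrow> smooth_hull g \<Longrightarrow> smooth_hull (\<lambda>x. f x * g x)"
| comp: "(\<And>n t. t \<in> S \<Longrightarrow> (u n has_real_derivative u (Suc n) t) (at t)) \<Longrightarrow>
    (\<And>x. g x \<in> S) \<Longrightarrow> smooth_hull g \<Longrightarrow> smooth_hull (\<lambda>x. u n (g x))"

lemma smooth_hull_partial:
  "smooth_hull f \<Longrightarrow> (\<forall>x. f differentiable (at x)) \<and> (\<forall>i. smooth_hull (partial i f))"
proof (induction rule: smooth_hull.induct)
  case (base f)
  then show ?case by (auto intro: smooth_hull.base smooth_partial smooth_differentiable)
next
  case (const c)
  then show ?case by (auto simp: partial_const intro: smooth_hull.const)
next
  case (component i)
  have "(\<lambda>x::real^3. x $ i) differentiable (at x)" for x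
    using has_derivative_componentI differentiableI by blast
  then show ?case by (auto simp: partial_component intro: smooth_hull.const)
next
  case (add f g)
  then have "partial i (\<lambda>x. f x + g x) = (\<lambda>x. partial i f x + partial i g x)" for i
    by (intro ext partial_add) auto
  with add show ?case by (auto intro: smooth_hull.add)
next
  case (mult f g)
  then have "partial i (\<lambda>x. f x * g x) = (\<lambda>x. f x * partial i g x + partial i f x * g x)" for i
    by (intro ext partial_mult) auto
  with mult show ?case by (auto intro!: smooth_hull.add smooth_hull.mult)
next
  case (comp S u g n)
  then have "partial i (\<lambda>x. u n (g x)) = (\<lambda>x. u (Suc n) (g x) * partial i g x)" for i
    by (intro ext partial_chain) auto
  moreover have "(\<lambda>x. u n (g x)) differentiable (at x)" for x
  proof -
    have "(u n has_real_derivative u (Suc n) (g x)) (at (g x))" using comp by blast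
    moreover have "(g has_derivative frechet_derivative g (at x)) (at x)"
      using comp(4) by (intro has_derivative_differentiable) blast
    ultimately show ?thesis by (rule differentiableI[OF has_derivative_chain_real])
  qed
  ultimately show ?case using comp
    by (auto intro!: smooth_hull.mult smooth_hull.comp[where S=S and u=u and n="Suc n"])
qed

lemma smooth_hull_eq: "smooth_hull f \<longleftrightarrow> smooth f"
  using smooth_coinduct[of smooth_hull f] smooth_hull_partial smooth_hull.base by blast

lemmas smooth_const = smooth_hull.const[unfolded smooth_hull_eq]
lemmas smooth_component = smooth_hull.component[unfolded smooth_hull_eq]
lemmas smooth_add = smooth_hull.add[unfolded smooth_hull_eq]
lemmas smooth_mult = smooth_hull.mult[unfolded smooth_hull_eq]
lemmas smooth_comp = smooth_hull.comp[unfolded smooth_hull_eq]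

lemma smooth_sum: "(\<And>j. j \<in> A \<Longrightarrow> smooth (f j)) \<Longrightarrow> smooth (\<lambda>x. \<Sum>j\<in>A. f j x)"
  by (induction A rule: infinite_finite_induct) (auto simp: smooth_const intro: smooth_add)

lemma smooth_power: "smooth f \<Longrightarrow> smooth (\<lambda>x. f x ^ n)"
  by (induction n) (auto simp: smooth_const intro: smooth_mult)

lemma norm_power2_vec: "(norm (x :: real^3))\<^sup>2 = (\<Sum>i\<in>UNIV. (x $ i)\<^sup>2)"
  by (simp add: norm_vec_def L2_set_def sum_nonneg)

lemma smooth_norm_power2: "smooth (\<lambda>x. (norm x)\<^sup>2)"
  unfolding norm_power2_vec by (intro smooth_sum smooth_power smooth_component)

lemma smooth_powr:
  assumes "smooth g" "\<And>x. g x > 0"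
  shows "smooth (\<lambda>x. g x powr p)"
proof -
  define u where "u n t = (\<Prod>k<n. p - real k) * t powr (p - real n)" for n and t :: real
  have "(u n has_real_derivative u (Suc n) t) (at t)" if "t \<in> {0<..}" for n t
  proof -
    have "u (Suc n) t = (\<Prod>k<n. p - real k) * ((p - real n) * t powr (p - real n - 1))"
      by (simp add: u_def diff_diff_eq add.commute)
    moreover have "((\<lambda>t. t powr (p - real n)) has_real_derivative (p - real n) * t powr (p - real n - 1)) (at t)"
      using that by (intro has_real_derivative_powr) auto
    ultimately show ?thesis unfolding u_def[of n, abs_def] by (simp add: DERIV_cmult)
  qed
  from smooth_comp[of "{0<..}" u g 0, OF this] assms show ?thesis
    by (simp add: u_def)
qed

lemma smooth_exp:
  assumes "smooth g"
  shows "smooth (\<lambda>x. exp (g x))"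
  using smooth_comp[of UNIV "\<lambda>n. exp" g 0] assms by (auto intro!: derivative_eq_intros)

lemma smooth_cos:
  assumes "smooth g"
  shows "smooth (\<lambda>x. cos (g x))"
proof -
  have "((\<lambda>t. cos (t + real n * (pi/2))) has_real_derivative cos (t + real (Suc n) * (pi/2))) (at t)"
    for n t
  proof -
    have "cos (t + real (Suc n) * (pi/2)) = cos ((t + real n * (pi/2)) + pi/2)"
      by (simp add: algebra_simps add_divide_distrib)
    also have "\<dots> = - sin (t + real n * (pi/2))" by (subst cos_add) simp
    finally show ?thesis by (auto intro!: derivative_eq_intros)
  qed
  from smooth_comp[of UNIV "\<lambda>n t. cos (t + real n * (pi/2))" g 0, OF this] assms
  show ?thesis by simp
qed

lemma poly_exp_inverse_tendsto_0:
  "((\<lambda>t. poly p (1/t) * exp (- 1/t)) \<longlongrightarrow> 0) (at_right (0::real))"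
proof -
  have *: "((\<lambda>y. poly p y * exp (- y)) \<longlongrightarrow> 0) (at_top :: real filter)"
  proof -
    have "((\<lambda>y. \<Sum>i\<le>degree p. coeff p i * (y ^ i / exp y)) \<longlongrightarrow> (\<Sum>i\<le>degree p. coeff p i * 0)) at_top"
      by (intro tendsto_sum tendsto_mult tendsto_const tendsto_power_div_exp_0)
    moreover have "(\<Sum>i\<le>degree p. coeff p i * (y ^ i / exp y)) = poly p y * exp (- y)" for y
      by (simp add: poly_altdef sum_distrib_right exp_minus divide_inverse mult.assoc)
    ultimately show ?thesis by simp
  qed
  have "filterlim (\<lambda>t::real. 1/t) at_top (at_right 0)"
    using filterlim_inverse_at_top_right by (simp add: inverse_eq_divide)
  from filterlim_compose[OF * this] show ?thesis by simp
qed

text \<open>The \<open>n\<close>-th derivative of \<open>exp (-1/t)\<close> is \<open>p\<^sub>n (1/t) exp (-1/t)\<close>, and differentiating once more gives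
the recursion for the polynomials \<open>p\<^sub>n\<close>.\<close>

fun flat_poly :: "nat \<Rightarrow> real poly" where
  "flat_poly 0 = 1"
| "flat_poly (Suc n) = [:0,0,1:] * (flat_poly n - pderiv (flat_poly n))"

definition flat :: "nat \<Rightarrow> real \<Rightarrow> real" where
  "flat n t = (if t > 0 then poly (flat_poly n) (1/t) * exp (- 1/t) else 0)"

text \<open>Away from \<open>0\<close> this is the recursion for the polynomials; at \<open>0\<close> the difference quotient is
\<open>y p\<^sub>n (y) exp (-y)\<close> with \<open>y = 1/t\<close>, and the exponential beats the polynomial.\<close>

lemma flat_has_derivative: "(flat n has_real_derivative flat (Suc n) t) (at t)"
proof -
  consider "t > 0" | "t < 0" | "t = 0" by linarith
  then show ?thesis
  proof cases
    case 1
    have "((\<lambda>t. poly (flat_poly n) (1/t) * exp (- 1/t)) has_real_derivative flat (Suc n) t) (at t)"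
      using 1 unfolding flat_def
      by (auto intro!: derivative_eq_intros DERIV_chain'[OF _ poly_DERIV]
          simp: power2_eq_square field_simps)
    then show ?thesis
    proof (rule DERIV_cong_ev[THEN iffD1, rotated -1])
      show "\<forall>\<^sub>F x in nhds t. poly (flat_poly n) (1/x) * exp (- 1/x) = flat n x"
        using eventually_nhds_in_open[of "{0<..}" t] 1
        by (auto simp: flat_def elim!: eventually_mono)
    qed auto
  next
    case 2
    have "((\<lambda>t. 0) has_real_derivative flat (Suc n) t) (at t)"
      using 2 by (auto simp: flat_def)
    then show ?thesis
    proof (rule DERIV_cong_ev[THEN iffD1, rotated -1])
      show "\<forall>\<^sub>F x in nhds t. 0 = flat n x"
        using eventually_nhds_in_open[of "{..<0}" t] 2
        by (auto simp: flat_def elim!: eventually_mono)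
    qed auto
  next
    case 3
    have "((\<lambda>h. flat n h / h) \<longlongrightarrow> 0) (at_right 0)"
      using poly_exp_inverse_tendsto_0[of "pCons 0 (flat_poly n)"]
    proof (rule Lim_transform_eventually)
      show "\<forall>\<^sub>F x in at_right 0. poly (pCons 0 (flat_poly n)) (1/x) * exp (- 1/x) = flat n x / x"
        by (auto simp: eventually_at_filter flat_def)
    qed
    moreover have "((\<lambda>h. flat n h / h) \<longlongrightarrow> 0) (at_left 0)"
      by (rule Lim_transform_eventually[OF tendsto_const])
         (auto simp: eventually_at_filter flat_def)
    ultimately have "((\<lambda>h. flat n h / h) \<longlongrightarrow> 0) (at 0)"
      by (simp add: filterlim_at_split)
    then show ?thesis using 3 by (simp add: has_field_derivative_iff flat_def)
  qed
qed

text \<open>The value at the origin is positive but not normalised; the places that need a cutoff equal to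
\<open>1\<close> at a point divide by it.\<close>

definition bump :: "real^3 \<Rightarrow> real" where
  "bump x = flat 0 (1 - (norm x)\<^sup>2)"

lemma smooth_bump: "smooth bump"
proof -
  have "smooth (\<lambda>x. 1 + (-1) * (norm x)\<^sup>2)"
    by (intro smooth_add smooth_mult smooth_const smooth_norm_power2)
  from smooth_comp[of UNIV flat _ 0, OF flat_has_derivative _ this]
  show ?thesis by (simp add: bump_def[abs_def])
qed

lemma bump_0: "bump 0 > 0"
  by (simp add: bump_def flat_def)

lemma bump_eq_0: "norm x \<ge> 1 \<Longrightarrow> bump x = 0"
  using one_le_power[of "norm x" 2] by (auto simp: bump_def flat_def not_less)

lemma test_function_altdef: "test_function \<phi> \<longleftrightarrow> smooth \<phi> \<and> bounded {x. \<phi> x \<noteq> 0}"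
  by (simp add: test_function_def smooth_def)

lemma test_function_bump: "test_function bump"
proof -
  have "{x. bump x \<noteq> 0} \<subseteq> ball 0 1" using bump_eq_0 by (force simp: not_le)
  then have "bounded {x. bump x \<noteq> 0}" using bounded_subset bounded_ball by blast
  then show ?thesis by (simp add: test_function_altdef smooth_bump)
qed

lemma test_function_mult:
  assumes "test_function \<phi>" "smooth \<psi>"
  shows "test_function (\<lambda>x. \<phi> x * \<psi> x)"
  using assms bounded_subset[of "{x. \<phi> x \<noteq> 0}" "{x. \<phi> x * \<psi> x \<noteq> 0}"]
  by (auto simp: test_function_altdef smooth_mult)

lemma test_function_cmult: "test_function \<phi> \<Longrightarrow> test_function (\<lambda>x. c * \<phi> x)"
  using test_function_mult[OF _ smooth_const, of \<phi> c] by (simp add: mult.commute)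

lemma test_function_add:
  assumes "test_function \<phi>" "test_function \<psi>"
  shows "test_function (\<lambda>x. \<phi> x + \<psi> x)"
proof -
  have "{x. \<phi> x + \<psi> x \<noteq> 0} \<subseteq> {x. \<phi> x \<noteq> 0} \<union> {x. \<psi> x \<noteq> 0}" by auto
  then show ?thesis using assms bounded_subset[OF bounded_Un[THEN iffD2]]
    by (auto simp: test_function_altdef intro: smooth_add)
qed

lemma test_function_zero: "test_function (\<lambda>x. 0)"
  by (simp add: test_function_altdef smooth_const)

lemma test_function_sum:
  "(\<And>j. j \<in> A \<Longrightarrow> test_function (f j)) \<Longrightarrow> test_function (\<lambda>x. \<Sum>j\<in>A. f j x)"
  by (induction A rule: infinite_finite_induct)
     (auto simp: test_function_zero intro: test_function_add)

lemma partial_eq_0: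
  assumes "open U" "x \<in> U" "\<And>y. y \<in> U \<Longrightarrow> f y = 0"
  shows "partial i f x = 0"
proof -
  have "(f has_derivative (\<lambda>h. 0)) (at x)"
    by (rule has_derivative_transform_within_open[OF has_derivative_const assms(1,2)]) (simp add: assms)
  from partial_eqI[OF this] show ?thesis by simp
qed

text \<open>Only the behaviour on the open complement of a ball enters, where all partial derivatives of the
zero function vanish; this avoids closures of supports.\<close>

lemma iter_partial_support: 
  assumes "\<And>x. r < norm x \<Longrightarrow> \<phi> x = 0" "r < norm x"
  shows "iter_partial is \<phi> x = 0"
  using assms(2)
proof (induction "is" arbitrary: x)
  case (Cons i "is")
  have "open {y::real^3. r < norm y}" by (intro open_Collect_less continuous_intros)
  from partial_eq_0[OF this _ Cons.IH] Cons.prems show ?case by (simp add: iter_partial_Cons)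
qed (use assms in auto)

lemma test_function_support:
  assumes "test_function \<phi>"
  shows "\<exists>r>0. \<forall>x is. r < norm x \<longrightarrow> iter_partial is \<phi> x = 0"
proof -
  from assms obtain r where "r > 0" "\<And>x. \<phi> x \<noteq> 0 \<Longrightarrow> norm x \<le> r"
    unfolding test_function_def by (auto simp: bounded_pos)
  moreover from this(2) have "\<phi> x = 0" if "r < norm x" for x using that by (meson not_le)
  ultimately show ?thesis using iter_partial_support[of r \<phi>] by (intro exI[of _ r]) simp
qed

lemma test_function_iter_partial:
  assumes "test_function \<phi>"
  shows "test_function (iter_partial is \<phi>)"
proof -
  obtain r where "\<forall>x is. r < norm x \<longrightarrow> iter_partial is \<phi> x = 0"
    using test_function_support[OF assms] by (elim exE conjE)
  then have "{x. iter_partial is \<phi> x \<noteq> 0} \<subseteq> cball 0 r" by (auto simp: not_le[symmetric])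
  then have "bounded {x. iter_partial is \<phi> x \<noteq> 0}" using bounded_subset bounded_cball by blast
  then show ?thesis using assms smooth_iter_partial
    by (auto simp: test_function_altdef)
qed

lemma test_function_partial: "test_function \<phi> \<Longrightarrow> test_function (partial i \<phi>)"
  using test_function_iter_partial[of \<phi> "[i]"] by (simp add: iter_partial_Cons)

lemma smooth_continuous: "smooth \<phi> \<Longrightarrow> continuous_on S \<phi>"
  by (intro continuous_at_imp_continuous_on ballI differentiable_imp_continuous_within smooth_differentiable)

lemma test_function_continuous: "test_function \<phi> \<Longrightarrow> continuous_on S \<phi>"
  by (auto simp: test_function_altdef smooth_continuous)

lemma test_function_bounded:
  assumes "test_function \<phi>"
  obtains B where "B > 0" "\<And>x. \<bar>\<phi> x\<bar> \<le> B"
proof -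
  obtain r where r: "r > 0" "\<forall>x is. r < norm x \<longrightarrow> iter_partial is \<phi> x = 0"
    using test_function_support[OF assms] by (elim exE conjE)
  have "bounded (\<phi> ` cball 0 r)"
    by (intro compact_imp_bounded compact_continuous_image test_function_continuous[OF assms]) auto
  then obtain B where "B > 0" "\<And>x. x \<in> cball 0 r \<Longrightarrow> \<bar>\<phi> x\<bar> \<le> B"
    by (auto simp: bounded_pos)
  moreover have "\<bar>\<phi> x\<bar> \<le> B" for x
    using calculation r(2)[rule_format, of x "[]"] by (cases "norm x \<le> r") auto
  ultimately show ?thesis using that by blast
qed

lemma partial_affine:
  assumes "f differentiable (at (c *\<^sub>R (x - a)))"
  shows "partial i (\<lambda>x. f (c *\<^sub>R (x - a))) x = c * partial i f (c *\<^sub>R (x - a))"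
proof -
  have "((\<lambda>x. c *\<^sub>R (x - a)) has_derivative (\<lambda>h. c *\<^sub>R h)) (at x)"
    by (auto intro!: derivative_eq_intros)
  from diff_chain_at[OF this has_derivative_differentiable[OF assms]]
  have "((\<lambda>x. f (c *\<^sub>R (x - a))) has_derivative (\<lambda>h. frechet_derivative f (at (c *\<^sub>R (x - a))) (c *\<^sub>R h))) (at x)"
    by (simp add: o_def)
  from partial_eqI[OF this] show ?thesis
    using linear_scale[OF linear_frechet_derivative[OF assms]] by (simp add: partial_def)
qed

lemma iter_partial_affine:
  assumes "smooth f"
  shows "iter_partial is (\<lambda>x. f (c *\<^sub>R (x - a))) = (\<lambda>x. c ^ length is * iter_partial is f (c *\<^sub>R (x - a)))"
proof (induction "is")
  case (Cons i "is")
  let ?g = "\<lambda>x. iter_partial is f (c *\<^sub>R (x - a))"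
  have d: "iter_partial is f differentiable (at y)" for y
    using assms smooth_def by blast
  have "?g differentiable (at x)" for x
  proof -
    have "(\<lambda>x. c *\<^sub>R (x - a)) differentiable (at x)"
      by (intro derivative_intros differentiable_scaleR differentiable_diff)
    from differentiable_chain_at[OF this d] show ?thesis by (simp add: o_def)
  qed
  then show ?case
    by (auto simp: iter_partial_Cons Cons.IH partial_cmult partial_affine[OF d])
qed simp

lemma smooth_affine: 
  assumes "smooth f" shows "smooth (\<lambda>x. f (c *\<^sub>R (x - a)))"
  unfolding smooth_def iter_partial_affine[OF assms]
proof (intro allI)
  fix "is" x
  have "(\<lambda>x. c *\<^sub>R (x - a)) differentiable (at x)"
    by (intro derivative_intros differentiable_scaleR differentiable_diff)
  moreover have "iter_partial is f differentiable (at (c *\<^sub>R (x - a)))"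
    using assms smooth_def by blast
  ultimately have "(\<lambda>x. iter_partial is f (c *\<^sub>R (x - a))) differentiable (at x)"
    using differentiable_chain_at[of "\<lambda>x. c *\<^sub>R (x - a)"] by (simp add: o_def)
  then show "(\<lambda>x. c ^ length is * iter_partial is f (c *\<^sub>R (x - a))) differentiable (at x)"
    by simp
qed

lemma test_function_affine:
  assumes "test_function f" "c \<noteq> 0" shows "test_function (\<lambda>x. f (c *\<^sub>R (x - a)))"
proof -
  obtain r where r: "\<forall>x is. r < norm x \<longrightarrow> iter_partial is f x = 0"
    using test_function_support[OF assms(1)] by (elim exE conjE)
  have "{x. f (c *\<^sub>R (x - a)) \<noteq> 0} \<subseteq> cball a (r / \<bar>c\<bar>)"
  proof
    fix x assume "x \<in> {x. f (c *\<^sub>R (x - a)) \<noteq> 0}"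
    then have "norm (c *\<^sub>R (x - a)) \<le> r" using r[rule_format, of "c *\<^sub>R (x - a)" "[]"] by (cases "r < norm (c *\<^sub>R (x - a))") auto
    then show "x \<in> cball a (r / \<bar>c\<bar>)" using assms(2) by (simp add: pos_le_divide_eq dist_norm norm_minus_commute mult.commute)
  qed
  then have "bounded {x. f (c *\<^sub>R (x - a)) \<noteq> 0}" using bounded_subset bounded_cball by blast
  then show ?thesis using assms(1)
    by (auto simp: test_function_altdef smooth_affine)
qed

section \<open>Integration by parts\<close>

lemma integral_translate:
  fixes f :: "'a::euclidean_space \<Rightarrow> 'b::{banach, second_countable_topology}"
  assumes "f \<in> borel_measurable lborel"
  shows "(\<integral>x. f (x + a) \<partial>lborel) = (\<integral>x. f x \<partial>lborel)"
proof -
  have "(\<integral>x. f x \<partial>lborel) = (\<integral>x. f x \<partial>distr lborel borel ((+) a))"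
    by (simp add: lborel_distr_plus)
  also have "\<dots> = (\<integral>x. f (a + x) \<partial>lborel)"
    using assms by (intro integral_distr) auto
  finally show ?thesis by (simp add: add.commute)
qed

lemma integrable_translate:
  fixes f :: "'a::euclidean_space \<Rightarrow> 'b::{banach, second_countable_topology}"
  assumes "integrable lborel f"
  shows "integrable lborel (\<lambda>x. f (x + a))"
proof -
  have "integrable (distr lborel borel ((+) a)) f"
    using assms by (simp add: lborel_distr_plus)
  then show ?thesis
    by (subst (asm) integrable_distr_eq) (use assms in \<open>auto simp: add.commute\<close>)
qed

lemma measurable_translate:
  fixes f :: "'a::euclidean_space \<Rightarrow> 'b::topological_space"
  assumes "f \<in> borel_measurable lborel"
  shows "(\<lambda>x. f (x + a)) \<in> borel_measurable lborel"
  using assms by measurable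

lemma integral_scale:
  fixes f :: "'a::euclidean_space \<Rightarrow> 'b::{banach, second_countable_topology}"
  assumes "f \<in> borel_measurable lborel" "c > 0"
  shows "(\<integral>x. f x \<partial>lborel) = (\<integral>x. c ^ DIM('a) *\<^sub>R f (c *\<^sub>R x) \<partial>lborel)"
proof -
  have "(\<integral>x. f x \<partial>lborel) = (\<integral>x. f x \<partial>density (distr lborel borel (\<lambda>x. 0 + c *\<^sub>R x)) (\<lambda>_. \<bar>c\<bar>^DIM('a)))"
    using lborel_affine[of c "0::'a"] assms(2) by simp
  also have "\<dots> = (\<integral>x. c^DIM('a) *\<^sub>R f (c *\<^sub>R x) \<partial>lborel)"
    using assms by (subst integral_density) (auto simp: integral_distr)
  finally show ?thesis .
qed

lemma test_function_integrable:
  assumes "test_function \<phi>"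
  shows "integrable lborel \<phi>"
proof -
  obtain r where r: "r > 0" "\<forall>x is. r < norm x \<longrightarrow> iter_partial is \<phi> x = 0"
    using test_function_support[OF assms] by (elim exE conjE)
  have "integrable lborel (\<lambda>x. indicator (cball 0 r) x *\<^sub>R \<phi> x)"
    by (intro borel_integrable_compact test_function_continuous assms) auto
  moreover have "(\<lambda>x. indicator (cball 0 r) x *\<^sub>R \<phi> x) = \<phi>"
    using r(2)[rule_format, of _ "[]"] by (force simp: indicator_def fun_eq_iff)
  ultimately show ?thesis by (simp only:)
qed

text \<open>The integral of a difference quotient vanishes by translation invariance of Lebesgue measure, and
the difference quotients converge boundedly on a fixed ball. This replaces the fundamental theorem
of calculus along lines together with Fubini.\<close>

lemma integral_partial_eq_0:
  assumes "test_function \<phi>"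
  shows "(\<integral>x. partial i \<phi> x \<partial>lborel) = 0"
proof -
  define e :: "real^3" where "e = axis i 1"
  define h where "h n = 1 / real (Suc n)" for n
  have h: "0 < h n" "h n \<le> 1" for n by (auto simp: h_def)
  have h0: "h \<longlonglongrightarrow> 0" unfolding h_def using LIMSEQ_inverse_real_of_nat by (simp add: inverse_eq_divide)
  obtain r where r: "r > 0" "\<forall>x is. r < norm x \<longrightarrow> iter_partial is \<phi> x = 0"
    using test_function_support[OF assms] by (elim exE conjE)
  obtain B where B: "B > 0" "\<And>x. \<bar>partial i \<phi> x\<bar> \<le> B"
    using test_function_bounded[OF test_function_partial[OF assms]] by metis
  have line: "((\<lambda>t. \<phi> (x + t *\<^sub>R e)) has_real_derivative partial i \<phi> (x + t *\<^sub>R e)) (at t)" for x t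
  proof -
    have d: "(\<phi> has_derivative frechet_derivative \<phi> (at (x + t *\<^sub>R e))) (at (x + t *\<^sub>R e))"
      using assms by (auto simp: test_function_altdef intro: has_derivative_differentiable smooth_differentiable)
    have "((\<lambda>t. x + t *\<^sub>R e) has_derivative (\<lambda>h. h *\<^sub>R e)) (at t)"
      by (auto intro!: derivative_eq_intros)
    from diff_chain_at[OF this d]
    show ?thesis
      using linear_scale[OF has_derivative_linear[OF d]]
      by (simp add: o_def has_field_derivative_def partial_def e_def mult_commute_abs)
  qed
  define q where "q n x = (\<phi> (x + h n *\<^sub>R e) - \<phi> x) / h n" for n x
  have meas: "\<phi> \<in> borel_measurable borel" "partial i \<phi> \<in> borel_measurable borel"
    by (intro borel_measurable_continuous_onI test_function_continuous test_function_partial assms)+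
  have int: "integrable lborel \<phi>" by (rule test_function_integrable[OF assms])
  have q0: "(\<integral>x. q n x \<partial>lborel) = 0" for n
    using integrable_translate[OF int, of "h n *\<^sub>R e"] integral_translate[of \<phi> "h n *\<^sub>R e"] int
    by (simp add: q_def)
  have "(\<lambda>n. \<integral>x. q n x \<partial>lborel) \<longlonglongrightarrow> (\<integral>x. partial i \<phi> x \<partial>lborel)"
  proof (rule integral_dominated_convergence[where w="\<lambda>x. B * indicator (cball 0 (r + 1)) x"])
    show "integrable lborel (\<lambda>x::real^3. B * indicator (cball 0 (r + 1)) x)"
      using emeasure_bounded_finite[of "cball 0 (r + 1) :: (real^3) set"] by (intro integrable_mult_right) simp
    show "AE x in lborel. (\<lambda>n. q n x) \<longlonglongrightarrow> partial i \<phi> x"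
    proof (rule AE_I2)
      fix x
      have "((\<lambda>t. (\<phi> (x + t *\<^sub>R e) - \<phi> x) / t) \<longlongrightarrow> partial i \<phi> x) (at 0)"
        using line[of x 0] by (simp add: has_field_derivative_iff)
      moreover have "filterlim h (at 0) sequentially"
        using h0 h(1) by (intro filterlim_atI) (auto simp: less_imp_neq[symmetric])
      ultimately show "(\<lambda>n. q n x) \<longlonglongrightarrow> partial i \<phi> x"
        unfolding q_def using filterlim_compose by blast
    qed
    show "AE x in lborel. norm (q n x) \<le> B * indicator (cball 0 (r + 1)) x" for n
    proof (rule AE_I2)
      fix x
      show "norm (q n x) \<le> B * indicator (cball 0 (r + 1)) x"
      proof (cases "norm x \<le> r + 1")
        case True
        obtain z where "\<phi> (x + h n *\<^sub>R e) - \<phi> (x + 0 *\<^sub>R e) = (h n - 0) * partial i \<phi> (x + z *\<^sub>R e)"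
          using MVT2[OF h(1)[of n], of "\<lambda>t. \<phi> (x + t *\<^sub>R e)" "\<lambda>t. partial i \<phi> (x + t *\<^sub>R e)"] line by blast
        then have "q n x = partial i \<phi> (x + z *\<^sub>R e)" using h(1)[of n] by (simp add: q_def)
        then show ?thesis using B True by simp
      next
        case False
        have "norm x \<le> norm (x + h n *\<^sub>R e) + norm (h n *\<^sub>R e)"
          using norm_triangle_ineq4[of "x + h n *\<^sub>R e" "h n *\<^sub>R e"] by simp
        also have "norm (h n *\<^sub>R e) \<le> 1" using h[of n] by (simp add: e_def)
        finally have "r < norm (x + h n *\<^sub>R e)" "r < norm x" using False by auto
        then have "q n x = 0" using r(2)[rule_format, of _ "[]"] by (simp add: q_def)
        then show ?thesis using B by simp
      qed
    qed
  qed (use meas in \<open>auto simp: q_def\<close>)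
  with q0 show ?thesis by (simp add: LIMSEQ_const_iff)
qed

lemma integral_by_parts_partial:
  assumes "test_function \<phi>" "test_function \<psi>"
  shows "(\<integral>x. partial i \<phi> x * \<psi> x \<partial>lborel) = - (\<integral>x. \<phi> x * partial i \<psi> x \<partial>lborel)"
proof -
  have s: "smooth \<phi>" "smooth \<psi>" using assms by (auto simp: test_function_altdef)
  have int: "integrable lborel (\<lambda>x. partial i \<phi> x * \<psi> x)" "integrable lborel (\<lambda>x. \<phi> x * partial i \<psi> x)"
    by (intro test_function_integrable test_function_mult test_function_partial assms s smooth_partial)+
  have "partial i (\<lambda>x. \<phi> x * \<psi> x) = (\<lambda>x. \<phi> x * partial i \<psi> x + partial i \<phi> x * \<psi> x)"
    using s by (intro ext partial_mult smooth_differentiable)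
  then show ?thesis
    using integral_partial_eq_0[OF test_function_mult[OF assms(1) s(2)], of i] int by simp
qed

text \<open>Moving the derivatives over one at a time reverses their order. Keeping the reversed list avoids any
appeal to the symmetry of mixed partial derivatives.\<close>

lemma integral_by_parts:
  assumes "test_function \<phi>" "test_function \<psi>"
  shows "(\<integral>x. iter_partial is \<phi> x * \<psi> x \<partial>lborel)
    = (- 1) ^ length is * (\<integral>x. \<phi> x * iter_partial (rev is) \<psi> x \<partial>lborel)"
  using assms(2)
proof (induction "is" arbitrary: \<psi>)
  case (Cons i "is")
  show ?case
    using Cons.IH[OF test_function_partial[OF Cons.prems], of i]
      integral_by_parts_partial[OF test_function_iter_partial[OF assms(1), of "is"] Cons.prems, of i]
    by (simp add: iter_partial_Cons iter_partial_append)
qed simp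

section \<open>Square integrable functions\<close>

text \<open>The analysis is done for scalar functions; a vector-valued function is square integrable exactly
if its components satisfy this predicate.\<close>

definition L2 :: "(real^3 \<Rightarrow> complex) \<Rightarrow> bool" where
  "L2 F \<longleftrightarrow> F \<in> borel_measurable lborel \<and> integrable lborel (\<lambda>x. (norm (F x))\<^sup>2)"

lemma L2_bound:
  assumes "L2 G" "F \<in> borel_measurable lborel" "AE x in lborel. norm (F x) \<le> C * norm (G x)"
  shows "L2 F"
proof -
  have "integrable lborel (\<lambda>x. (norm (F x))\<^sup>2)"
  proof (rule Bochner_Integration.integrable_bound)
    show "integrable lborel (\<lambda>x. C\<^sup>2 * (norm (G x))\<^sup>2)" using assms(1) by (auto simp: L2_def)
    show "AE x in lborel. norm ((norm (F x))\<^sup>2) \<le> norm (C\<^sup>2 * (norm (G x))\<^sup>2)"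
      using assms(3)
    proof eventually_elim
      case (elim x)
      then show ?case using power_mono[OF elim norm_ge_zero, of 2] by (simp add: power_mult_distrib)
    qed
  qed (use assms(2) in measurable)
  with assms show ?thesis by (simp add: L2_def)
qed

lemma mult_le_sum_squares: "s * t \<le> s\<^sup>2 + (t :: real)\<^sup>2"
  using sum_squares_bound[of s t] zero_le_power2[of s] zero_le_power2[of t]
  by (cases "s * t \<le> 0") linarith+

lemma L2_mult_integrable:
  assumes "L2 F" "L2 G"
  shows "integrable lborel (\<lambda>x. F x * G x)"
proof (rule Bochner_Integration.integrable_bound)
  show "integrable lborel (\<lambda>x. (norm (F x))\<^sup>2 + (norm (G x))\<^sup>2)" using assms by (auto simp: L2_def)
  show "(\<lambda>x. F x * G x) \<in> borel_measurable lborel" using assms by (auto simp: L2_def)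
  show "AE x in lborel. norm (F x * G x) \<le> norm ((norm (F x))\<^sup>2 + (norm (G x))\<^sup>2)"
    by (auto simp: norm_mult mult_le_sum_squares)
qed

lemma L2_add:
  assumes "L2 F" "L2 G"
  shows "L2 (\<lambda>x. F x + G x)"
proof -
  have "integrable lborel (\<lambda>x. (norm (F x + G x))\<^sup>2)"
  proof (rule Bochner_Integration.integrable_bound)
    show "integrable lborel (\<lambda>x. 2 * (norm (F x))\<^sup>2 + 2 * (norm (G x))\<^sup>2)"
      using assms by (auto simp: L2_def)
    have "(norm (a + b))\<^sup>2 \<le> 2 * (norm a)\<^sup>2 + 2 * (norm b)\<^sup>2" for a b :: complex
    proof -
      have "(norm (a + b))\<^sup>2 \<le> (norm a + norm b)\<^sup>2" by (intro power_mono norm_triangle_ineq) auto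
      also have "\<dots> \<le> 2 * (norm a)\<^sup>2 + 2 * (norm b)\<^sup>2"
        using sum_squares_bound[of "norm a" "norm b"] by (simp add: power2_sum)
      finally show ?thesis .
    qed
    then show "AE x in lborel. norm ((norm (F x + G x))\<^sup>2) \<le> norm (2 * (norm (F x))\<^sup>2 + 2 * (norm (G x))\<^sup>2)"
      by simp
  qed (use assms in \<open>auto simp: L2_def\<close>)
  with assms show ?thesis by (auto simp: L2_def)
qed

lemma L2_cmult: "L2 F \<Longrightarrow> L2 (\<lambda>x. c * F x)"
  by (auto simp: L2_def norm_mult power_mult_distrib)

lemma L2_uminus: "L2 F \<Longrightarrow> L2 (\<lambda>x. - F x)"
  using L2_cmult[of F "-1"] by simp

lemma L2_diff: "L2 F \<Longrightarrow> L2 G \<Longrightarrow> L2 (\<lambda>x. F x - G x)"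
  using L2_add[OF _ L2_uminus] by fastforce

lemma L2_cnj: "L2 F \<Longrightarrow> L2 (\<lambda>x. cnj (F x))"
proof -
  assume F: "L2 F"
  have "cnj \<in> borel_measurable borel" by (intro borel_measurable_continuous_onI continuous_intros)
  with F show ?thesis using measurable_compose[of F lborel borel cnj] by (auto simp: L2_def)
qed

lemma L2_0: "L2 (\<lambda>x. 0)"
  by (simp add: L2_def)

lemma L2_sum: "(\<And>j. j \<in> A \<Longrightarrow> L2 (f j)) \<Longrightarrow> L2 (\<lambda>x. \<Sum>j\<in>A. f j x)"
  by (induction A rule: infinite_finite_induct) (auto simp: L2_0 intro: L2_add)

lemma L2_translate: "L2 F \<Longrightarrow> L2 (\<lambda>x. F (x + a))"
  using integrable_translate[of "\<lambda>x. (norm (F x))\<^sup>2" a] measurable_translate[of F a]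
  by (auto simp: L2_def)

lemma L2_indicator:
  assumes "A \<in> sets borel" "emeasure lborel A < \<infinity>"
  shows "L2 (indicator A :: real^3 \<Rightarrow> complex)"
proof -
  have "(\<lambda>x::real^3. (norm (indicator A x :: complex))\<^sup>2) = indicator A"
    by (auto simp: indicator_def)
  with assms show ?thesis by (auto simp: L2_def)
qed

lemma L2_test_function:
  assumes "test_function \<phi>"
  shows "L2 (\<lambda>x. of_real (\<phi> x))"
proof -
  have "integrable lborel (\<lambda>x. \<phi> x * \<phi> x)"
    using assms by (intro test_function_integrable test_function_mult) (auto simp: test_function_altdef)
  moreover have "\<phi> \<in> borel_measurable borel"
    by (intro borel_measurable_continuous_onI test_function_continuous assms)
  ultimately show ?thesis by (simp add: L2_def power2_eq_square)
qed

section \<open>Radial integrals\<close>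

text \<open>Polar coordinates for radial functions: for \<open>r \<ge> 0\<close> both measures give \<open>4/3 \<pi> r\<^sup>3\<close> to \<open>{..r}\<close>, the left one because
this is the volume of a ball.\<close>

lemma distr_norm_lborel:
  "distr lborel borel (norm :: real^3 \<Rightarrow> real) = density lborel (\<lambda>r. ennreal (4 * pi * r\<^sup>2) * indicator {0..} r)"
  (is "?M = ?N")
proof (rule measure_eqI_generator_eq[where E="range (\<lambda>r. {..r})" and \<Omega>=UNIV and A="\<lambda>n. {..real n}"])
  have val: "emeasure ?M {..r} = ennreal (4/3 * pi * (max r 0) ^ 3)" for r
  proof -
    have eq: "(norm :: real^3 \<Rightarrow> real) -` {..r} = cball 0 r" by auto
    show ?thesis
      by (cases "r \<ge> 0") (simp_all add: emeasure_distr eq emeasure_cball unit_ball_vol_3 max_def)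
  qed
  have "emeasure ?N {..r} = ennreal (4/3 * pi * (max r 0) ^ 3)" for r
  proof (cases "r \<ge> 0")
    case True
    have "emeasure ?N {..r} = (\<integral>\<^sup>+t. ennreal (4 * pi * t\<^sup>2) * indicator {0..r} t \<partial>lborel)"
      by (subst emeasure_density) (auto intro!: nn_integral_cong simp: indicator_def)
    also have "\<dots> = (\<lambda>t. 4/3 * pi * t ^ 3) r - (\<lambda>t. 4/3 * pi * t ^ 3) 0"
      by (rule nn_integral_FTC_Icc) (use True in \<open>auto intro!: derivative_eq_intros simp: field_simps\<close>)
    finally show ?thesis using True by (simp add: max_def)
  next
    case False
    then have "emeasure ?N {..r} = (\<integral>\<^sup>+t. 0 \<partial>(lborel::real measure))"
      by (subst emeasure_density) (auto intro!: nn_integral_cong simp: indicator_def simp del: nn_integral_const)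
    with False show ?thesis by (simp add: max_def)
  qed
  with val show "\<And>X. X \<in> range (\<lambda>r. {..r}) \<Longrightarrow> emeasure ?M X = emeasure ?N X" by auto
  show "emeasure ?M {..real n} \<noteq> \<infinity>" for n by (simp add: val)
  show "Int_stable (range (\<lambda>r::real. {..r}))" by (auto simp: Int_stable_def)
  show "(\<Union>n. {..real n}) = UNIV" using real_arch_simple by blast
  show "sets ?M = sigma_sets UNIV (range (\<lambda>r. {..r}))" "sets ?N = sigma_sets UNIV (range (\<lambda>r. {..r}))"
    by (simp_all add: borel_eq_atMost)
qed auto

lemma nn_integral_radial:
  assumes [measurable]: "f \<in> borel_measurable borel"
  shows "(\<integral>\<^sup>+x. f (norm (x :: real^3)) \<partial>lborel)
    = (\<integral>\<^sup>+r. ennreal (4 * pi * r\<^sup>2) * f r * indicator {0..} r \<partial>lborel)"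
proof -
  have "(\<integral>\<^sup>+x. f (norm (x :: real^3)) \<partial>lborel) = (\<integral>\<^sup>+r. f r \<partial>distr lborel borel (norm :: real^3 \<Rightarrow> real))"
    by (rule nn_integral_distr[symmetric]) auto
  also have "\<dots> = (\<integral>\<^sup>+r. ennreal (4 * pi * r\<^sup>2) * f r * indicator {0..} r \<partial>lborel)"
    unfolding distr_norm_lborel by (subst nn_integral_density) (auto intro!: nn_integral_cong simp: mult_ac)
  finally show ?thesis .
qed

text \<open>A radial function is integrable as soon as its weighted profile has a majorant \<open>g\<close> with an explicit
antiderivative \<open>F\<close> that converges at infinity.\<close>

lemma integrable_radial:
  fixes f :: "real \<Rightarrow> real"
  assumes [measurable]: "f \<in> borel_measurable borel" and nonneg: "\<And>r. r \<ge> 0 \<Longrightarrow> f r \<ge> 0"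
    and g: "g \<in> borel_measurable borel" "\<And>r. r \<ge> 0 \<Longrightarrow> 4 * pi * r\<^sup>2 * f r \<le> g r"
    and F: "\<And>r. r \<ge> 0 \<Longrightarrow> (F has_real_derivative g r) (at r)" "(F \<longlongrightarrow> T) at_top"
  shows "integrable lborel (\<lambda>x :: real^3. f (norm x))"
proof (rule integrableI_nonneg)
  have gp: "g r \<ge> 0" if "r \<ge> 0" for r
    using order_trans[OF _ g(2)[OF that]] nonneg[OF that] by simp
  have "(\<integral>\<^sup>+x. ennreal (f (norm (x :: real^3))) \<partial>lborel)
      = (\<integral>\<^sup>+r. ennreal (4 * pi * r\<^sup>2) * ennreal (f r) * indicator {0..} r \<partial>lborel)"
    by (rule nn_integral_radial) auto
  also have "\<dots> \<le> (\<integral>\<^sup>+r. ennreal (g r) * indicator {0..} r \<partial>lborel)"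
    by (intro nn_integral_mono) (use g(2) in \<open>auto simp: indicator_def ennreal_mult[symmetric] nonneg intro!: ennreal_leI\<close>)
  also have "\<dots> = T - F 0" by (rule nn_integral_FTC_atLeast[OF g(1) F(1) gp F(2)])
  also have "\<dots> < \<infinity>" by simp
  finally show "(\<integral>\<^sup>+x. ennreal (f (norm (x :: real^3))) \<partial>lborel) < \<infinity>" .
qed (use nonneg in auto)

text \<open>The square of the singularity \<open>1/r\<close> is integrable in dimension three since the weight \<open>r\<^sup>2\<close> cancels it.
This is what puts the fundamental solutions into the Hilbert space.\<close>

lemma L2_exp_over_norm:
  assumes "c > 0"
  shows "L2 (\<lambda>x. of_real (exp (- c * norm x) / norm x))"
proof -
  have "integrable lborel (\<lambda>x :: real^3. (\<lambda>r. (exp (- c * r) / r)\<^sup>2) (norm x))"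
  proof (rule integrable_radial[where g="\<lambda>r. 4 * pi * exp (- 2 * c * r)"
        and F="\<lambda>r. - (4 * pi / (2 * c)) * exp (- 2 * c * r)" and T="- (4 * pi / (2 * c)) * 0"])
    show "((\<lambda>r. - (4 * pi / (2 * c)) * exp (- 2 * c * r)) \<longlongrightarrow> - (4 * pi / (2 * c)) * 0) at_top"
    proof (intro tendsto_mult tendsto_const)
      have "filterlim (\<lambda>r. 2 * c * r) at_top at_top"
        using assms by (intro filterlim_tendsto_pos_mult_at_top[OF tendsto_const _ filterlim_ident]) auto
      then have "filterlim (\<lambda>r. - 2 * c * r) at_bot at_top"
        by (simp add: filterlim_uminus_at_bot)
      then show "((\<lambda>r. exp (- 2 * c * r)) \<longlongrightarrow> 0) at_top"
        by (rule filterlim_compose[OF exp_at_bot])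
    qed
    show "4 * pi * r\<^sup>2 * (exp (- c * r) / r)\<^sup>2 \<le> 4 * pi * exp (- 2 * c * r)" for r
      by (auto simp: power_divide exp_double[symmetric] mult.assoc)
    show "((\<lambda>r. - (4 * pi / (2 * c)) * exp (- 2 * c * r)) has_real_derivative 4 * pi * exp (- 2 * c * r)) (at r)" for r
      using assms by (auto intro!: derivative_eq_intros)
  qed auto
  then show ?thesis by (simp add: L2_def norm_divide)
qed

text \<open>At the price of half the decay rate, the exponential is dominated by the function of the previous lemma:
\<open>c r / 2 \<le> exp (c r / 2)\<close>.\<close>

lemma L2_exp_norm:
  assumes "c > 0"
  shows "L2 (\<lambda>x. of_real (exp (- c * norm x)))"
proof (rule L2_bound[where C="2/c"])
  show "L2 (\<lambda>x. of_real (exp (- (c/2) * norm x) / norm x))"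
    using assms by (intro L2_exp_over_norm) auto
  have "AE x in lborel. x \<noteq> (0::real^3)" by (rule AE_lborel_singleton)
  then show "AE x in lborel. norm (complex_of_real (exp (- c * norm (x::real^3))))
      \<le> 2/c * norm (complex_of_real (exp (- (c/2) * norm x) / norm x))"
  proof eventually_elim
    case (elim x)
    have "c/2 * norm x \<le> exp (c/2 * norm x)" using exp_ge_add_one_self[of "c/2 * norm x"] by linarith
    then have "norm x \<le> 2/c * exp (c/2 * norm x)" using assms by (simp add: field_simps)
    then have "norm x * exp (- c * norm x) \<le> 2/c * exp (c/2 * norm x) * exp (- c * norm x)"
      by (intro mult_right_mono) auto
    also have "\<dots> = 2/c * exp (- (c/2) * norm x)" by (simp add: exp_add[symmetric] mult.assoc)
    finally have "exp (- c * norm x) \<le> 2/c * exp (- (c/2) * norm x) / norm x"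
      using elim by (subst pos_le_divide_eq) (simp_all add: mult.commute)
    then show ?case by (simp add: norm_divide)
  qed
qed auto

text \<open>\<open>3 / sqrt (1 + r\<^sup>2) ^ 5\<close> is the divergence of the field \<open>x / sqrt (1 + r\<^sup>2) ^ 3\<close>, so a third of the flux of this
field through the sphere of radius \<open>r\<close> serves as the antiderivative.\<close>

lemma integrable_inverse_power5:
  "integrable lborel (\<lambda>x :: real^3. 1 / sqrt (1 + (norm x)\<^sup>2) ^ 5)"
proof (rule integrable_radial[where f="\<lambda>r. 1 / sqrt (1 + r\<^sup>2) ^ 5" and g="\<lambda>r. 4 * pi * r\<^sup>2 * (1 / sqrt (1 + r\<^sup>2) ^ 5)"
      and F="\<lambda>r. 4 * pi / 3 * (r / sqrt (1 + r\<^sup>2)) ^ 3" and T="4 * pi / 3 * 1 ^ 3"])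
  show "((\<lambda>r. 4 * pi / 3 * (r / sqrt (1 + r\<^sup>2)) ^ 3) has_real_derivative 4 * pi * r\<^sup>2 * (1 / sqrt (1 + r\<^sup>2) ^ 5)) (at r)" for r
  proof -
    define s where "s = sqrt (1 + r\<^sup>2)"
    have s: "s > 0" "s\<^sup>2 = 1 + r\<^sup>2" unfolding s_def by (auto simp: add_pos_nonneg)
    have p: "1 + r\<^sup>2 > 0" by (simp add: add_pos_nonneg)
    have "((\<lambda>r. 1 + r\<^sup>2) has_real_derivative 2 * r) (at r)"
      by (auto intro!: derivative_eq_intros)
    from DERIV_chain'[OF this DERIV_real_sqrt[OF p]]
    have "((\<lambda>r. sqrt (1 + r\<^sup>2)) has_real_derivative r / s) (at r)"
      using s(1) by (simp add: s_def field_simps)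
    then have "((\<lambda>r. r / sqrt (1 + r\<^sup>2)) has_real_derivative (1 * s - r * (r / s)) / (s * s)) (at r)"
      unfolding s_def using s(1)[unfolded s_def] by (intro DERIV_divide DERIV_ident) auto
    also have "(1 * s - r * (r / s)) / (s * s) = 1 / s ^ 3"
      using s by (simp add: field_simps power2_eq_square power3_eq_cube)
    finally have "((\<lambda>r. 4 * pi / 3 * (r / sqrt (1 + r\<^sup>2)) ^ 3) has_real_derivative
        4 * pi / 3 * (real 3 * (1 / s ^ 3 * (r / s) ^ (3 - Suc 0)))) (at r)"
      unfolding s_def by (intro DERIV_cmult DERIV_power)
    also have "4 * pi / 3 * (real 3 * (1 / s ^ 3 * (r / s) ^ (3 - Suc 0))) = 4 * pi * r\<^sup>2 * (1 / s ^ 5)"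
      using s(1) by (simp add: power_divide field_simps power_add[symmetric])
    finally show ?thesis unfolding s_def .
  qed
  have "((\<lambda>r::real. r / sqrt (1 + r\<^sup>2)) \<longlongrightarrow> 1) at_top"
  proof -
    have "((\<lambda>r::real. 1 / sqrt ((1/r)\<^sup>2 + 1)) \<longlongrightarrow> 1 / sqrt (0\<^sup>2 + 1)) at_top"
      using tendsto_inverse_0_at_top[OF filterlim_ident]
      by (intro tendsto_divide tendsto_const tendsto_real_sqrt tendsto_add tendsto_power) (auto simp: inverse_eq_divide)
    then have "((\<lambda>r::real. 1 / sqrt ((1/r)\<^sup>2 + 1)) \<longlongrightarrow> 1) at_top" by simp
    then show ?thesis
    proof (rule Lim_transform_eventually)
      show "\<forall>\<^sub>F r in at_top. 1 / sqrt ((1/r)\<^sup>2 + 1) = r / sqrt (1 + r\<^sup>2)"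
        using eventually_gt_at_top[of 0]
      proof eventually_elim
        case (elim r)
        have "(1/r)\<^sup>2 + 1 = (1 + r\<^sup>2) / r\<^sup>2" using elim by (simp add: field_simps)
        then show ?case using elim by (simp add: real_sqrt_divide)
      qed
    qed
  qed
  then show "((\<lambda>r. 4 * pi / 3 * (r / sqrt (1 + r\<^sup>2)) ^ 3) \<longlongrightarrow> 4 * pi / 3 * 1 ^ 3) at_top"
    by (intro tendsto_mult tendsto_power tendsto_const)
qed auto

section \<open>Weak Laplacians\<close>

definition laplacian :: "(real^3 \<Rightarrow> real) \<Rightarrow> real^3 \<Rightarrow> real" where
  "laplacian \<phi> x = (\<Sum>i\<in>UNIV. partial i (partial i \<phi>) x)"

definition weak_laplacian :: "(real^3 \<Rightarrow> complex) \<Rightarrow> (real^3 \<Rightarrow> complex) \<Rightarrow> bool" where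
  "weak_laplacian F L \<longleftrightarrow> (\<forall>\<phi>. test_function \<phi> \<longrightarrow>
     (\<integral>x. of_real (laplacian \<phi> x) * F x \<partial>lborel) = (\<integral>x. of_real (\<phi> x) * L x \<partial>lborel))"

lemma partial_partial_mult:
  assumes "smooth f" "smooth g"
  shows "partial i (partial i (\<lambda>x. f x * g x)) x
    = f x * partial i (partial i g) x + 2 * (partial i f x * partial i g x) + partial i (partial i f) x * g x"
proof -
  note d = smooth_differentiable smooth_partial assms
  have "partial i (\<lambda>x. f x * g x) = (\<lambda>x. f x * partial i g x + partial i f x * g x)"
    by (intro ext partial_mult d)
  moreover have "partial i (\<lambda>x. f x * partial i g x + partial i f x * g x) x
      = partial i (\<lambda>x. f x * partial i g x) x + partial i (\<lambda>x. partial i f x * g x) x"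
    by (intro partial_add smooth_differentiable smooth_mult smooth_partial assms)
  ultimately show ?thesis
    by (simp add: partial_mult[OF smooth_differentiable smooth_differentiable] smooth_partial assms)
qed

lemma laplacian_mult:
  assumes "smooth f" "smooth g"
  shows "laplacian (\<lambda>x. f x * g x) x
    = f x * laplacian g x + 2 * (\<Sum>i\<in>UNIV. partial i f x * partial i g x) + laplacian f x * g x"
  by (simp add: laplacian_def partial_partial_mult[OF assms] sum.distrib sum_distrib_left sum_distrib_right)

lemma smooth_laplacian: "smooth \<phi> \<Longrightarrow> smooth (laplacian \<phi>)"
  unfolding laplacian_def[abs_def] by (intro smooth_sum smooth_partial)

lemma test_function_laplacian: "test_function \<phi> \<Longrightarrow> test_function (laplacian \<phi>)"
  unfolding laplacian_def[abs_def] by (intro test_function_sum test_function_partial)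

lemma partial_affine_smooth:
  assumes "smooth f"
  shows "partial i (\<lambda>x. f (c *\<^sub>R (x - a))) x = c * partial i f (c *\<^sub>R (x - a))"
  using partial_affine[OF smooth_differentiable[OF assms]] .

lemma laplacian_affine:
  assumes "smooth f"
  shows "laplacian (\<lambda>x. f (c *\<^sub>R (x - a))) x = c\<^sup>2 * laplacian f (c *\<^sub>R (x - a))"
proof -
  have "partial i (partial i (\<lambda>x. f (c *\<^sub>R (x - a)))) x = c\<^sup>2 * partial i (partial i f) (c *\<^sub>R (x - a))" for i
    using fun_cong[OF iter_partial_affine[OF assms, of "[i,i]" c a], of x]
    by (simp add: iter_partial_Cons power2_eq_square)
  then show ?thesis by (simp add: laplacian_def sum_distrib_left)
qed

lemma smooth_measurable: "smooth f \<Longrightarrow> f \<in> borel_measurable borel"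
  by (intro borel_measurable_continuous_onI smooth_continuous)

text \<open>The function \<open>g\<close> is cut off by \<open>x \<mapsto> bump (h x)\<close> with \<open>h \<rightarrow> 0\<close>. Each derivative that falls on the cutoff
carries a factor \<open>h\<close>, so in the limit only \<open>bump 0\<close> times the Laplacian of \<open>g\<close> remains; exponential
decay supplies the dominating function, whose product with a square integrable one is integrable.\<close>

lemma weak_laplacian_smooth_decaying:
  assumes wl: "weak_laplacian F L" and F: "L2 F" and L: "L2 L" and g: "smooth g" and b: "b > 0"
    and C: "\<And>x. \<bar>g x\<bar> \<le> C * exp (- b * norm x)"
      "\<And>i x. \<bar>partial i g x\<bar> \<le> C * exp (- b * norm x)"
      "\<And>x. \<bar>laplacian g x\<bar> \<le> C * exp (- b * norm x)"
  shows "(\<integral>x. of_real (laplacian g x) * F x \<partial>lborel) = (\<integral>x. of_real (g x) * L x \<partial>lborel)"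
proof -
  define h where "h n = 1 / real (Suc n)" for n
  have h: "0 < h n" "h n \<le> 1" for n by (auto simp: h_def)
  have h0: "h \<longlonglongrightarrow> 0" unfolding h_def using LIMSEQ_inverse_real_of_nat by (simp add: inverse_eq_divide)
  obtain M1 where M1: "M1 > 0" "\<And>x. \<bar>bump x\<bar> \<le> M1"
    using test_function_bounded[OF test_function_bump] by metis
  have "\<exists>M. \<forall>x. \<bar>partial i bump x\<bar> \<le> M" for i
    using test_function_bounded[OF test_function_partial[OF test_function_bump]] by metis
  then obtain M2 where M2: "\<And>i x. \<bar>partial i bump x\<bar> \<le> M2 i" by metis
  obtain M3 where M3: "M3 > 0" "\<And>x. \<bar>laplacian bump x\<bar> \<le> M3"
    using test_function_bounded[OF test_function_laplacian[OF test_function_bump]] by metis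
  have M2': "M2 i \<ge> 0" for i using M2[of i 0] by linarith
  \<comment> \<open>One constant for the three groups of terms in the product rule for the Laplacian.\<close>
  define M where "M = M1 + 2 * (\<Sum>i\<in>UNIV. M2 i) + M3"
  have C0: "C \<ge> 0" using order_trans[OF abs_ge_zero C(1)[of 0]] by simp
  define B where "B n x = bump (h n *\<^sub>R (x - 0))" for n x
  define \<phi> where "\<phi> n x = B n x * g x" for n x
  have sB: "smooth (B n)" for n unfolding B_def by (intro smooth_affine smooth_bump)
  have tB: "test_function (B n)" for n unfolding B_def using h(1)[of n]
    by (intro test_function_affine test_function_bump) auto
  have t\<phi>: "test_function (\<phi> n)" for n
    unfolding \<phi>_def by (intro test_function_mult tB g)
  have pB: "partial i (B n) x = h n * partial i bump (h n *\<^sub>R x)" for i n x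
    using partial_affine_smooth[OF smooth_bump, of i "h n" 0 x] by (simp add: B_def[abs_def])
  have lB: "laplacian (B n) x = (h n)\<^sup>2 * laplacian bump (h n *\<^sub>R x)" for n x
    using laplacian_affine[OF smooth_bump, of "h n" 0 x] by (simp add: B_def[abs_def])
  have lap: "laplacian (\<phi> n) x = bump (h n *\<^sub>R x) * laplacian g x
      + 2 * (\<Sum>i\<in>UNIV. h n * partial i bump (h n *\<^sub>R x) * partial i g x)
      + (h n)\<^sup>2 * laplacian bump (h n *\<^sub>R x) * g x" for n x
    unfolding \<phi>_def[abs_def] laplacian_mult[OF sB g] pB lB by (simp add: B_def)
  have hx: "(\<lambda>n. h n *\<^sub>R x) \<longlonglongrightarrow> 0" for x :: "real^3"
    using tendsto_scaleR[OF h0 tendsto_const[of x]] by simp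
  have lim: "(\<lambda>n. f (h n *\<^sub>R x)) \<longlonglongrightarrow> f 0" if "smooth f" for f and x :: "real^3"
    using smooth_continuous[OF that, of UNIV] hx[of x]
    by (intro isCont_tendsto_compose[of _ f]) (auto simp: continuous_on_eq_continuous_at)
  have lim_lap: "(\<lambda>n. laplacian (\<phi> n) x) \<longlonglongrightarrow> bump 0 * laplacian g x" for x
  proof -
    have "(\<lambda>n. laplacian (\<phi> n) x) \<longlonglongrightarrow> bump 0 * laplacian g x
      + 2 * (\<Sum>i\<in>UNIV. 0 * partial i bump 0 * partial i g x) + 0\<^sup>2 * laplacian bump 0 * g x"
      unfolding lap
      by (intro tendsto_add tendsto_mult tendsto_sum tendsto_const lim tendsto_power h0
          smooth_bump smooth_partial smooth_laplacian)
    then show ?thesis by simp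
  qed
  have lim_\<phi>: "(\<lambda>n. \<phi> n x) \<longlonglongrightarrow> bump 0 * g x" for x
    unfolding \<phi>_def B_def by (simp, intro tendsto_mult tendsto_const lim smooth_bump)
  have bd_lap: "\<bar>laplacian (\<phi> n) x\<bar> \<le> M * C * exp (- b * norm x)" for n x
  proof -
    let ?e = "C * exp (- b * norm x)"
    have e0: "?e \<ge> 0" using C0 by simp
    have "\<bar>bump (h n *\<^sub>R x) * laplacian g x\<bar> \<le> M1 * ?e"
      unfolding abs_mult using M1 C by (intro mult_mono) auto
    moreover have "\<bar>\<Sum>i\<in>UNIV. h n * partial i bump (h n *\<^sub>R x) * partial i g x\<bar> \<le> (\<Sum>i\<in>UNIV. M2 i * ?e)"
    proof (rule order_trans[OF sum_abs], rule sum_mono)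
      fix i :: 3
      have "\<bar>h n\<bar> * \<bar>partial i bump (h n *\<^sub>R x)\<bar> \<le> 1 * M2 i"
        using h[of n] M2 by (intro mult_mono) (auto simp: less_imp_le)
      then show "\<bar>h n * partial i bump (h n *\<^sub>R x) * partial i g x\<bar> \<le> M2 i * ?e"
        unfolding abs_mult using C(2) M2' by (intro mult_mono) auto
    qed
    moreover have "\<bar>(h n)\<^sup>2 * laplacian bump (h n *\<^sub>R x) * g x\<bar> \<le> M3 * ?e"
    proof -
      have "\<bar>(h n)\<^sup>2\<bar> * \<bar>laplacian bump (h n *\<^sub>R x)\<bar> \<le> 1 * M3"
        using h[of n] M3 by (intro mult_mono) (auto simp: less_imp_le abs_square_le_1 power_le_one)
      then show ?thesis unfolding abs_mult using C(1) M3 by (intro mult_mono) auto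
    qed
    ultimately have "\<bar>laplacian (\<phi> n) x\<bar> \<le> M1 * ?e + 2 * (\<Sum>i\<in>UNIV. M2 i * ?e) + M3 * ?e"
      unfolding lap by linarith
    also have "\<dots> = M * C * exp (- b * norm x)"
      by (simp add: M_def algebra_simps sum_distrib_left sum_distrib_right)
    finally show ?thesis .
  qed
  have bd_\<phi>: "\<bar>\<phi> n x\<bar> \<le> M1 * C * exp (- b * norm x)" for n x
    unfolding \<phi>_def B_def abs_mult mult.assoc using M1 C by (intro mult_mono) auto
  have dom: "(\<lambda>n. \<integral>x. of_real (u n x) * G x \<partial>lborel) \<longlonglongrightarrow> (\<integral>x. of_real (bump 0 * v x) * G x \<partial>lborel)"
    if G: "L2 G" and u: "\<And>n. smooth (u n)" and v: "smooth v" and lim: "\<And>x. (\<lambda>n. u n x) \<longlonglongrightarrow> bump 0 * v x"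
      and bd: "\<And>n x. \<bar>u n x\<bar> \<le> D * exp (- b * norm x)" for u v G D
  proof (rule integral_dominated_convergence[where w="\<lambda>x. norm (of_real D * (of_real (exp (- b * norm x)) * G x))"])
    have [measurable]: "u n \<in> borel_measurable borel" "v \<in> borel_measurable borel" "G \<in> borel_measurable borel" for n
      using u v G by (auto simp: smooth_measurable L2_def)
    show "(\<lambda>x. complex_of_real (u n x) * G x) \<in> borel_measurable lborel" for n by measurable
    show "(\<lambda>x. complex_of_real (bump 0 * v x) * G x) \<in> borel_measurable lborel" by measurable
    show "integrable lborel (\<lambda>x. norm (of_real D * (of_real (exp (- b * norm x)) * G x)))"
      by (intro integrable_norm integrable_mult_right L2_mult_integrable G L2_exp_norm b)
    show "AE x in lborel. (\<lambda>n. complex_of_real (u n x) * G x) \<longlonglongrightarrow> complex_of_real (bump 0 * v x) * G x"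
      by (intro AE_I2 tendsto_mult tendsto_of_real lim tendsto_const)
    show "AE x in lborel. norm (complex_of_real (u n x) * G x) \<le> norm (of_real D * (of_real (exp (- b * norm x)) * G x))" for n
    proof (rule AE_I2)
      fix x
      have "\<bar>u n x\<bar> \<le> \<bar>D\<bar> * exp (- b * norm x)"
        by (rule order_trans[OF bd]) (rule mult_right_mono, auto)
      then have "\<bar>u n x\<bar> * norm (G x) \<le> \<bar>D\<bar> * exp (- b * norm x) * norm (G x)"
        by (rule mult_right_mono) simp
      then show "norm (complex_of_real (u n x) * G x) \<le> norm (of_real D * (of_real (exp (- b * norm x)) * G x))"
        by (simp add: norm_mult mult.assoc)
    qed
  qed
  have l1: "(\<lambda>n. \<integral>x. of_real (laplacian (\<phi> n) x) * F x \<partial>lborel) \<longlonglongrightarrow> (\<integral>x. of_real (bump 0 * laplacian g x) * F x \<partial>lborel)"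
    by (rule dom[OF F _ _ lim_lap bd_lap])
       (use t\<phi> g in \<open>auto intro!: smooth_laplacian simp: test_function_altdef\<close>)
  have l2: "(\<lambda>n. \<integral>x. of_real (\<phi> n x) * L x \<partial>lborel) \<longlonglongrightarrow> (\<integral>x. of_real (bump 0 * g x) * L x \<partial>lborel)"
    by (rule dom[OF L _ _ lim_\<phi> bd_\<phi>]) (use t\<phi> g in \<open>auto simp: test_function_altdef\<close>)
  have e: "(\<integral>x. of_real (laplacian (\<phi> n) x) * F x \<partial>lborel) = (\<integral>x. of_real (\<phi> n x) * L x \<partial>lborel)" for n
    using wl t\<phi> by (auto simp: weak_laplacian_def)
  have "(\<integral>x. of_real (bump 0 * laplacian g x) * F x \<partial>lborel) = (\<integral>x. of_real (bump 0 * g x) * L x \<partial>lborel)"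
    by (rule LIMSEQ_unique[OF l1[unfolded e] l2])
  then show ?thesis using bump_0 by (simp add: mult.assoc)
qed

section \<open>The regularised fundamental solution\<close>

text \<open>The smoothed radius, a smooth substitute for the distance to the origin. Inserting it into the fundamental solution
removes the singularity and keeps the derivatives explicit.\<close>

definition srad :: "real \<Rightarrow> real^3 \<Rightarrow> real" where
  "srad \<epsilon> x = sqrt (\<epsilon>\<^sup>2 + (norm x)\<^sup>2)"

text \<open>The radial profile of the outgoing fundamental solution of \<open>-\<Delta> - \<kappa>\<^sup>2\<close>. At \<open>s = 0\<close> it has the default value
\<open>0\<close> of division by zero; all estimates there are almost everywhere.\<close>

definition green :: "complex \<Rightarrow> real \<Rightarrow> complex" where
  "green \<kappa> s = exp (\<i> * \<kappa> * of_real s) / (4 * of_real pi * of_real s)"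

text \<open>\<open>green1\<close> and \<open>green2\<close> are the first and second iterates of \<open>(1/s) d/ds\<close> on \<open>green\<close>. This operator fits
\<open>srad\<close>, whose gradient is \<open>x / srad \<epsilon> x\<close>: each partial derivative of a radial function
is a coordinate times an iterate.\<close>

definition green1 :: "complex \<Rightarrow> real \<Rightarrow> complex" where
  "green1 \<kappa> s = exp (\<i> * \<kappa> * of_real s) * (\<i> * \<kappa> * of_real s - 1) / (4 * of_real pi * of_real s ^ 3)"

definition green2 :: "complex \<Rightarrow> real \<Rightarrow> complex" where
  "green2 \<kappa> s = exp (\<i> * \<kappa> * of_real s) * (3 - 3 * \<i> * \<kappa> * of_real s - \<kappa>\<^sup>2 * of_real s ^ 2)
     / (4 * of_real pi * of_real s ^ 5)"

text \<open>This is \<open>-(\<Delta> + \<kappa>\<^sup>2)\<close> applied to the regularised fundamental solution, hence an approximation of the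
point mass at the origin.\<close>

definition smoothed_delta :: "real \<Rightarrow> complex \<Rightarrow> real^3 \<Rightarrow> complex" where
  "smoothed_delta \<epsilon> \<kappa> x = of_real (\<epsilon>\<^sup>2) * green2 \<kappa> (srad \<epsilon> x)"

lemma green_has_derivative:
  assumes "s > 0"
  shows "(green \<kappa> has_vector_derivative s *\<^sub>R green1 \<kappa> s) (at s)"
proof -
  let ?w = "complex_of_real s"
  have "((\<lambda>w. exp (\<i> * \<kappa> * w) / (4 * of_real pi * w)) has_field_derivative
      (exp (\<i> * \<kappa> * ?w) * (\<i> * \<kappa>) * (4 * of_real pi * ?w) - exp (\<i> * \<kappa> * ?w) * (4 * of_real pi)) /
        ((4 * of_real pi * ?w) * (4 * of_real pi * ?w))) (at ?w)"
    using assms by (auto intro!: derivative_eq_intros)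
  also have "(exp (\<i> * \<kappa> * ?w) * (\<i> * \<kappa>) * (4 * of_real pi * ?w) - exp (\<i> * \<kappa> * ?w) * (4 * of_real pi)) /
        ((4 * of_real pi * ?w) * (4 * of_real pi * ?w)) = s *\<^sub>R green1 \<kappa> s"
    using assms by (simp add: green1_def scaleR_conv_of_real field_simps power3_eq_cube)
  finally show ?thesis
    unfolding green_def[abs_def] by (rule has_vector_derivative_real_field)
qed

lemma green1_has_derivative:
  assumes "s > 0"
  shows "(green1 \<kappa> has_vector_derivative s *\<^sub>R green2 \<kappa> s) (at s)"
proof -
  let ?w = "complex_of_real s"
  define E where "E = exp (\<i> * \<kappa> * ?w)"
  have "((\<lambda>w. exp (\<i> * \<kappa> * w) * (\<i> * \<kappa> * w - 1) / (4 * of_real pi * w ^ 3)) has_field_derivative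
      ((E * (\<i> * \<kappa>) * (\<i> * \<kappa> * ?w - 1) + E * (\<i> * \<kappa>)) * (4 * of_real pi * ?w ^ 3)
        - (E * (\<i> * \<kappa> * ?w - 1)) * (4 * of_real pi * (3 * ?w ^ 2))) /
        ((4 * of_real pi * ?w ^ 3) * (4 * of_real pi * ?w ^ 3))) (at ?w)"
    using assms unfolding E_def by (auto intro!: derivative_eq_intros)
  also have "((E * (\<i> * \<kappa>) * (\<i> * \<kappa> * ?w - 1) + E * (\<i> * \<kappa>)) * (4 * of_real pi * ?w ^ 3)
        - (E * (\<i> * \<kappa> * ?w - 1)) * (4 * of_real pi * (3 * ?w ^ 2))) /
        ((4 * of_real pi * ?w ^ 3) * (4 * of_real pi * ?w ^ 3)) = s *\<^sub>R green2 \<kappa> s"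
  proof -
    have "((E * (\<i> * \<kappa>) * (\<i> * \<kappa> * ?w - 1) + E * (\<i> * \<kappa>)) * (4 * of_real pi * ?w ^ 3)
        - (E * (\<i> * \<kappa> * ?w - 1)) * (4 * of_real pi * (3 * ?w ^ 2)))
      = 4 * of_real pi * ?w ^ 2 * (E * (3 - 3 * \<i> * \<kappa> * ?w - \<kappa>\<^sup>2 * ?w ^ 2))"
      by (simp add: power2_eq_square power3_eq_cube algebra_simps)
    moreover have alg: "4 * p * w ^ 2 * N / ((4 * p * w ^ 3) * (4 * p * w ^ 3)) = w * (N / (4 * p * w ^ 5))"
      if "w \<noteq> 0" "p \<noteq> 0" for w p N :: complex
      using that by (simp add: field_simps power_numeral_reduce)
    ultimately have "((E * (\<i> * \<kappa>) * (\<i> * \<kappa> * ?w - 1) + E * (\<i> * \<kappa>)) * (4 * of_real pi * ?w ^ 3)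
        - (E * (\<i> * \<kappa> * ?w - 1)) * (4 * of_real pi * (3 * ?w ^ 2))) /
        ((4 * of_real pi * ?w ^ 3) * (4 * of_real pi * ?w ^ 3))
      = ?w * (E * (3 - 3 * \<i> * \<kappa> * ?w - \<kappa>\<^sup>2 * ?w ^ 2) / (4 * of_real pi * ?w ^ 5))"
      using assms by (metis (no_types) of_real_eq_0_iff pi_neq_zero less_numeral_extra(3))
    then show ?thesis by (simp only: green2_def scaleR_conv_of_real E_def)
  qed
  finally show ?thesis
    unfolding green1_def[abs_def] by (rule has_vector_derivative_real_field)
qed

lemma srad_pos: "\<epsilon> > 0 \<Longrightarrow> srad \<epsilon> x > 0"
  by (simp add: srad_def add_pos_nonneg)

lemma srad_ge: "\<epsilon> > 0 \<Longrightarrow> srad \<epsilon> x \<ge> \<epsilon>" "srad \<epsilon> x \<ge> norm x"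
  by (auto simp: srad_def intro!: real_le_rsqrt)

lemma srad_power2: "(srad \<epsilon> x)\<^sup>2 = \<epsilon>\<^sup>2 + (norm x)\<^sup>2"
  by (simp add: srad_def)

lemma smooth_srad_arg: "smooth (\<lambda>x. \<epsilon>\<^sup>2 + (norm x)\<^sup>2)"
  by (intro smooth_add smooth_const smooth_norm_power2)

lemma smooth_srad: "\<epsilon> > 0 \<Longrightarrow> smooth (srad \<epsilon>)"
  using smooth_powr[OF smooth_srad_arg, of \<epsilon> "1/2"]
  by (simp add: srad_def[abs_def] powr_half_sqrt add_pos_nonneg)

lemma smooth_inverse_srad: "\<epsilon> > 0 \<Longrightarrow> smooth (\<lambda>x. 1 / srad \<epsilon> x)"
  using smooth_powr[OF smooth_srad_arg, of \<epsilon> "-1/2"]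
  by (simp add: srad_def[abs_def] powr_half_sqrt add_pos_nonneg powr_minus_divide)

text \<open>Products of real elementary functions, to which the closure properties of \<open>smooth\<close> apply; the sine is
written as a shifted cosine.\<close>

lemma Re_green: "Re (green \<kappa> s) = exp (- Im \<kappa> * s) * cos (Re \<kappa> * s) * (1 / (4 * pi)) * (1 / s)"
  and Im_green: "Im (green \<kappa> s) = exp (- Im \<kappa> * s) * cos (Re \<kappa> * s + - (pi/2)) * (1 / (4 * pi)) * (1 / s)"
proof -
  have "green \<kappa> s = exp (\<i> * \<kappa> * of_real s) / of_real (4 * pi * s)" by (simp add: green_def)
  then show "Re (green \<kappa> s) = exp (- Im \<kappa> * s) * cos (Re \<kappa> * s) * (1 / (4 * pi)) * (1 / s)"
    "Im (green \<kappa> s) = exp (- Im \<kappa> * s) * cos (Re \<kappa> * s + - (pi/2)) * (1 / (4 * pi)) * (1 / s)"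
    by (simp_all only: Re_divide_of_real Im_divide_of_real)
       (simp_all add: Re_exp Im_exp cos_diff)
qed

text \<open>Test functions are real-valued, so complex kernels enter through their real parts; \<open>c = 1\<close> and
\<open>c = -\<i>\<close> give the real and the imaginary part.\<close>

lemma smooth_green:
  assumes "\<epsilon> > 0"
  shows "smooth (\<lambda>x. Re (c * green \<kappa> (srad \<epsilon> x)))"
proof -
  have "smooth (\<lambda>x. Re c * Re (green \<kappa> (srad \<epsilon> x)) + (- Im c) * Im (green \<kappa> (srad \<epsilon> x)))"
    unfolding Re_green Im_green
    by (intro smooth_add smooth_mult smooth_const smooth_exp smooth_cos smooth_srad smooth_inverse_srad assms)
  then show ?thesis by simp
qed

lemma partial_radial:
  assumes "\<epsilon> > 0" and f: "\<And>s. s > 0 \<Longrightarrow> (f has_vector_derivative s *\<^sub>R f' s) (at s)"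
  shows "partial i (\<lambda>x. Re (c * f (srad \<epsilon> x))) x = x $ i * Re (c * f' (srad \<epsilon> x))"
proof -
  let ?s = "srad \<epsilon> x"
  have s: "?s > 0" by (rule srad_pos[OF assms(1)])
  have a: "((\<lambda>x::real^3. \<epsilon>\<^sup>2 + x \<bullet> x) has_derivative (\<lambda>h. 2 * (x \<bullet> h))) (at x)"
    by (auto intro!: derivative_eq_intros simp: inner_commute)
  have b: "\<epsilon>\<^sup>2 + x \<bullet> x > 0" using assms(1) by (simp add: add_pos_nonneg)
  have "((\<lambda>x. sqrt (\<epsilon>\<^sup>2 + x \<bullet> x)) has_derivative
      (\<lambda>h. inverse (sqrt (\<epsilon>\<^sup>2 + x \<bullet> x)) / 2 * (2 * (x \<bullet> h)))) (at x)"
    by (rule has_derivative_chain_real[OF DERIV_real_sqrt[OF b] a])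
  moreover have "(\<lambda>x. sqrt (\<epsilon>\<^sup>2 + x \<bullet> x)) = srad \<epsilon>" and "sqrt (\<epsilon>\<^sup>2 + x \<bullet> x) = ?s"
    by (simp_all add: srad_def power2_norm_eq_inner fun_eq_iff)
  ultimately have "(srad \<epsilon> has_derivative (\<lambda>h. inverse ?s * (x \<bullet> h))) (at x)" by simp
  from partial_eqI[OF this] differentiableI[OF this]
  have srad: "partial i (srad \<epsilon>) x = x $ i / ?s" "srad \<epsilon> differentiable (at x)"
    by (auto simp: inner_axis divide_inverse mult.commute)
  have "((\<lambda>s. c * f s) has_vector_derivative c * (?s *\<^sub>R f' ?s)) (at ?s)"
    by (rule has_vector_derivative_mult_right[OF f[OF s]])
  then have "((\<lambda>s. Re (c * f s)) has_real_derivative Re (c * (?s *\<^sub>R f' ?s))) (at ?s)"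
    by (rule has_field_derivative_Re)
  from partial_chain[OF this srad(2)] srad(1) s show ?thesis by simp
qed

lemma partial_green:
  assumes "\<epsilon> > 0"
  shows "partial i (\<lambda>x. Re (c * green \<kappa> (srad \<epsilon> x))) = (\<lambda>x. x $ i * Re (c * green1 \<kappa> (srad \<epsilon> x)))"
  by (intro ext partial_radial assms green_has_derivative)

text \<open>Summing over the coordinates gives \<open>3 green1 + r\<^sup>2 green2\<close> at \<open>s = srad \<epsilon> x\<close>. With \<open>r\<^sup>2 = s\<^sup>2 - \<epsilon>\<^sup>2\<close> the part
\<open>3 green1 + s\<^sup>2 green2\<close> is \<open>-\<kappa>\<^sup>2 green\<close>, the radial Helmholtz equation, and \<open>\<epsilon>\<^sup>2 green2\<close> is what is left.\<close>

lemma laplacian_green: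
  assumes "\<epsilon> > 0"
  shows "laplacian (\<lambda>x. Re (c * green \<kappa> (srad \<epsilon> x))) x
    = Re (c * (- \<kappa>\<^sup>2 * green \<kappa> (srad \<epsilon> x) - smoothed_delta \<epsilon> \<kappa> x))"
proof -
  let ?s = "srad \<epsilon> x"
  have s: "?s > 0" by (rule srad_pos[OF assms])
  have d: "(\<lambda>x. Re (c * green1 \<kappa> (srad \<epsilon> x))) differentiable (at x)" for x
  proof -
    have "((\<lambda>s. c * green1 \<kappa> s) has_vector_derivative c * (srad \<epsilon> x *\<^sub>R green2 \<kappa> (srad \<epsilon> x))) (at (srad \<epsilon> x))"
      by (rule has_vector_derivative_mult_right[OF green1_has_derivative[OF srad_pos[OF assms]]])
    from has_derivative_chain_real[OF has_field_derivative_Re[OF this] has_derivative_differentiable[OF smooth_differentiable[OF smooth_srad[OF assms]]]]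
    show ?thesis by (rule differentiableI)
  qed
  have d': "(\<lambda>x. x $ i) differentiable (at x)" for i and x :: "real^3"
    by (rule smooth_differentiable[OF smooth_component])
  have "partial i (partial i (\<lambda>x. Re (c * green \<kappa> (srad \<epsilon> x)))) x
      = (x $ i)\<^sup>2 * Re (c * green2 \<kappa> ?s) + Re (c * green1 \<kappa> ?s)" for i
    unfolding partial_green[OF assms]
    by (subst partial_mult[OF d' d], subst partial_radial[OF assms green1_has_derivative])
       (simp_all only: partial_component power2_eq_square mult_1 mult.assoc if_True simp_thms)
  then have "laplacian (\<lambda>x. Re (c * green \<kappa> (srad \<epsilon> x))) x
      = (norm x)\<^sup>2 * Re (c * green2 \<kappa> ?s) + 3 * Re (c * green1 \<kappa> ?s)"
    by (simp add: laplacian_def sum.distrib norm_power2_vec sum_distrib_right)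
  also have "\<dots> = Re (c * (of_real ((norm x)\<^sup>2) * green2 \<kappa> ?s + 3 * green1 \<kappa> ?s))"
    by (simp add: algebra_simps)
  also have "of_real ((norm x)\<^sup>2) * green2 \<kappa> ?s + 3 * green1 \<kappa> ?s
      = - \<kappa>\<^sup>2 * green \<kappa> ?s - smoothed_delta \<epsilon> \<kappa> x"
  proof -
    have n: "(norm x)\<^sup>2 = ?s\<^sup>2 - \<epsilon>\<^sup>2" by (simp add: srad_power2)
    have "of_real (?s\<^sup>2) * green2 \<kappa> ?s + 3 * green1 \<kappa> ?s = - \<kappa>\<^sup>2 * green \<kappa> ?s"
    proof -
      define w where "w = complex_of_real ?s"
      have w: "w \<noteq> 0" using s by (simp add: w_def)
      have alg: "w ^ 2 * (E * (3 - 3 * \<i> * \<kappa> * w - \<kappa>\<^sup>2 * w ^ 2) / (4 * p * w ^ 5)) + 3 * (E * (\<i> * \<kappa> * w - 1) / (4 * p * w ^ 3))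
          = - \<kappa>\<^sup>2 * (E / (4 * p * w))" if "w \<noteq> 0" "p \<noteq> 0" for E p w :: complex
      proof -
        have "w ^ 2 * (N / (4 * p * w ^ 5)) = N / (4 * p * w ^ 3)" for N
        proof -
          have eq: "4 * p * w ^ 5 = w ^ 2 * (4 * p * w ^ 3)" by (simp add: power_numeral_reduce)
          show ?thesis unfolding times_divide_eq_right eq
            by (rule nonzero_mult_divide_mult_cancel_left) (use that in simp)
        qed
        note 1 = this
        have 2: "- \<kappa>\<^sup>2 * (E / (4 * p * w)) = w ^ 2 * (- \<kappa>\<^sup>2 * E) / (4 * p * w ^ 3)"
        proof -
          have eq: "4 * p * w ^ 3 = w ^ 2 * (4 * p * w)" by (simp add: power_numeral_reduce)
          show ?thesis unfolding times_divide_eq_right eq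
            by (rule nonzero_mult_divide_mult_cancel_left[symmetric]) (use that in simp)
        qed
        have 3: "E * (3 - 3 * \<i> * \<kappa> * w - \<kappa>\<^sup>2 * w ^ 2) + 3 * (E * (\<i> * \<kappa> * w - 1)) = w ^ 2 * (- \<kappa>\<^sup>2 * E)"
          by (simp add: algebra_simps)
        show ?thesis unfolding 1 2 3[symmetric] by (simp add: add_divide_distrib)
      qed
      show ?thesis unfolding green_def green1_def green2_def of_real_power w_def[symmetric]
        by (rule alg[OF w]) simp
    qed
    then show ?thesis unfolding n smoothed_delta_def by (simp add: algebra_simps)
  qed
  finally show ?thesis .
qed


lemma norm_green: "s > 0 \<Longrightarrow> norm (green \<kappa> s) = exp (- Im \<kappa> * s) / (4 * pi * s)"
  by (simp add: green_def norm_divide norm_mult)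

lemma green_srad_bound:
  assumes "\<epsilon> > 0" "Im \<kappa> > 0"
  shows "norm (green \<kappa> (srad \<epsilon> x)) \<le> 1 / \<epsilon> * exp (- Im \<kappa> * norm x)"
    and "x \<noteq> 0 \<Longrightarrow> norm (green \<kappa> (srad \<epsilon> x)) \<le> exp (- Im \<kappa> * norm x) / norm x"
proof -
  let ?s = "srad \<epsilon> x"
  have *: "norm (green \<kappa> ?s) \<le> exp (- Im \<kappa> * norm x) / t" if "0 < t" "t \<le> ?s" for t
    unfolding norm_green[OF srad_pos[OF assms(1)]]
  proof (rule frac_le)
    show "exp (- Im \<kappa> * ?s) \<le> exp (- Im \<kappa> * norm x)" using assms srad_ge(2)[of x \<epsilon>] by simp
    have "1 * ?s \<le> 4 * pi * ?s" using pi_gt3 srad_pos[OF assms(1), of x] by (intro mult_right_mono) auto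
    then show "t \<le> 4 * pi * ?s" unfolding mult_1 by (rule order_trans[OF that(2)])
  qed (use that in auto)
  from *[of \<epsilon>] show "norm (green \<kappa> ?s) \<le> 1 / \<epsilon> * exp (- Im \<kappa> * norm x)"
    using assms srad_ge(1)[OF assms(1), of x] by simp
  show "norm (green \<kappa> ?s) \<le> exp (- Im \<kappa> * norm x) / norm x" if "x \<noteq> 0"
    using that *[of "norm x"] srad_ge(2) by simp
qed

lemma green1_bound:
  assumes "\<epsilon> > 0" "s \<ge> \<epsilon>"
  shows "s * norm (green1 \<kappa> s) \<le> (norm \<kappa> / \<epsilon> + 1 / \<epsilon>\<^sup>2) * exp (- Im \<kappa> * s)"
proof -
  have s: "s > 0" using assms by simp
  have "s * norm (green1 \<kappa> s) = exp (- Im \<kappa> * s) * (norm (\<i> * \<kappa> * of_real s - 1) / (4 * pi * s\<^sup>2))"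
    using s by (simp add: green1_def norm_divide norm_mult norm_power power2_eq_square power3_eq_cube)
  also have "\<dots> \<le> exp (- Im \<kappa> * s) * ((norm \<kappa> * s + 1) / s\<^sup>2)"
  proof (intro mult_left_mono frac_le)
    show "norm (\<i> * \<kappa> * of_real s - 1) \<le> norm \<kappa> * s + 1"
      using norm_triangle_ineq4[of "\<i> * \<kappa> * of_real s" 1] s by (simp add: norm_mult)
    have "1 * s\<^sup>2 \<le> 4 * pi * s\<^sup>2" using pi_gt3 by (intro mult_right_mono) auto
    then show "s\<^sup>2 \<le> 4 * pi * s\<^sup>2" by simp
  qed (use s in auto)
  also have "(norm \<kappa> * s + 1) / s\<^sup>2 = norm \<kappa> / s + 1 / s\<^sup>2"
    using s by (simp add: field_simps power2_eq_square)
  also have "exp (- Im \<kappa> * s) * (norm \<kappa> / s + 1 / s\<^sup>2) \<le> exp (- Im \<kappa> * s) * (norm \<kappa> / \<epsilon> + 1 / \<epsilon>\<^sup>2)"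
    using assms by (intro mult_left_mono add_mono divide_left_mono power_mono mult_pos_pos zero_less_power) auto
  finally show ?thesis by (simp add: mult.commute)
qed

text \<open>Half of the exponential decay absorbs the polynomial factor, through \<open>s b / 4 \<le> exp (s b / 4)\<close> for \<open>b = Im \<kappa>\<close>. So \<open>green2\<close>
is bounded by a pure fifth power of \<open>1/s\<close>, the profile that has the right scaling for an approximate
identity, times an exponential that controls the tails.\<close>

lemma green2_bound:
  assumes "Im \<kappa> > 0"
  shows "\<exists>B\<ge>0. \<forall>s>0. norm (green2 \<kappa> s) \<le> B * exp (- (Im \<kappa> / 2) * s) / s ^ 5"
proof (intro exI conjI allI impI)
  let ?b = "Im \<kappa>"
  let ?B = "3 + 3 * norm \<kappa> * (4 / ?b) + (norm \<kappa>)\<^sup>2 * (4 / ?b)\<^sup>2"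
  show "0 \<le> ?B" using assms by simp
  fix s :: real assume s: "s > 0"
  let ?e = "exp (?b / 2 * s)" and ?q = "exp (?b / 4 * s)"
  have qq: "?q\<^sup>2 = ?e" by (simp add: exp_double[symmetric])
  have q1: "1 \<le> ?q" using assms s by simp
  have "?b / 4 * s \<le> ?q" using exp_ge_add_one_self[of "?b / 4 * s"] by linarith
  then have sq: "s \<le> 4 / ?b * ?q" using assms by (simp add: field_simps)
  have "?q \<le> ?e" unfolding qq[symmetric] using power_increasing[of 1 2 ?q] q1 by simp
  then have a1: "s \<le> 4 / ?b * ?e" using order_trans[OF sq mult_left_mono[of ?q ?e "4 / ?b"]] assms by simp
  have a2: "s\<^sup>2 \<le> (4 / ?b)\<^sup>2 * ?e"
    using power_mono[OF sq, of 2] s by (simp only: power_mult_distrib qq)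
  have a0: "1 \<le> ?e" using assms s by simp
  have "norm (3 - 3 * \<i> * \<kappa> * of_real s - \<kappa>\<^sup>2 * of_real s ^ 2) \<le> 3 + 3 * norm \<kappa> * s + (norm \<kappa>)\<^sup>2 * s\<^sup>2"
    using norm_triangle_ineq4[of "3 - 3 * \<i> * \<kappa> * of_real s" "\<kappa>\<^sup>2 * of_real s ^ 2"]
      norm_triangle_ineq4[of 3 "3 * \<i> * \<kappa> * of_real s"] s
    by (simp add: norm_mult norm_power)
  also have "\<dots> \<le> 3 * ?e + 3 * norm \<kappa> * (4 / ?b * ?e) + (norm \<kappa>)\<^sup>2 * ((4 / ?b)\<^sup>2 * ?e)"
    using a0 a1 a2 by (intro add_mono mult_left_mono) auto
  also have "\<dots> = ?B * ?e" by (simp add: algebra_simps)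
  finally have *: "norm (3 - 3 * \<i> * \<kappa> * of_real s - \<kappa>\<^sup>2 * of_real s ^ 2) \<le> ?B * ?e" .
  have "norm (green2 \<kappa> s) = exp (- ?b * s) * norm (3 - 3 * \<i> * \<kappa> * of_real s - \<kappa>\<^sup>2 * of_real s ^ 2) / (4 * pi * s ^ 5)"
    using s by (simp add: green2_def norm_divide norm_mult norm_power)
  also have "\<dots> \<le> exp (- ?b * s) * (?B * ?e) / s ^ 5"
  proof (rule frac_le)
    show "exp (- ?b * s) * norm (3 - 3 * \<i> * \<kappa> * of_real s - \<kappa>\<^sup>2 * of_real s ^ 2) \<le> exp (- ?b * s) * (?B * ?e)"
      by (rule mult_left_mono[OF *]) simp
    then show "0 \<le> exp (- ?b * s) * (?B * ?e)" by (rule order_trans[rotated]) simp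
    have "1 * s ^ 5 \<le> 4 * pi * s ^ 5" using pi_gt3 s by (intro mult_right_mono) auto
    then show "s ^ 5 \<le> 4 * pi * s ^ 5" by simp
  qed (use s in simp)
  also have "exp (- ?b * s) * (?B * ?e) = ?B * exp (- (?b / 2) * s)"
  proof -
    have "exp (- ?b * s) * ?e = exp (- (?b / 2) * s)" by (simp add: exp_add[symmetric])
    then show ?thesis by (metis mult.left_commute)
  qed
  finally show "norm (green2 \<kappa> s) \<le> ?B * exp (- (?b / 2) * s) / s ^ 5" .
qed

lemma smoothed_delta_bound:
  assumes "Im \<kappa> > 0"
  shows "\<exists>B\<ge>0. \<forall>\<epsilon>>0. \<forall>x. norm (smoothed_delta \<epsilon> \<kappa> x)
    \<le> B * \<epsilon>\<^sup>2 / srad \<epsilon> x ^ 5 * exp (- (Im \<kappa> / 2) * norm x)"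
proof -
  obtain B where B: "B \<ge> 0" "\<And>s. s > 0 \<Longrightarrow> norm (green2 \<kappa> s) \<le> B * exp (- (Im \<kappa> / 2) * s) / s ^ 5"
    using green2_bound[OF assms] by auto
  have "norm (smoothed_delta \<epsilon> \<kappa> x) \<le> B * \<epsilon>\<^sup>2 / srad \<epsilon> x ^ 5 * exp (- (Im \<kappa> / 2) * norm x)" if "\<epsilon> > 0" for \<epsilon> x
  proof -
    let ?s = "srad \<epsilon> x"
    have "norm (smoothed_delta \<epsilon> \<kappa> x) = \<epsilon>\<^sup>2 * norm (green2 \<kappa> ?s)"
      by (simp add: smoothed_delta_def norm_mult norm_power)
    also have "\<dots> \<le> \<epsilon>\<^sup>2 * (B * exp (- (Im \<kappa> / 2) * ?s) / ?s ^ 5)"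
      by (intro mult_left_mono B srad_pos that) simp
    also have "\<dots> \<le> \<epsilon>\<^sup>2 * (B * exp (- (Im \<kappa> / 2) * norm x) / ?s ^ 5)"
      using assms srad_ge(2)[of x \<epsilon>] srad_pos[OF that, of x] B(1)
      by (intro mult_left_mono divide_right_mono) auto
    finally show ?thesis by (simp add: mult_ac)
  qed
  with B(1) show ?thesis by blast
qed

lemma continuous_on_srad: "\<epsilon> > 0 \<Longrightarrow> continuous_on S (srad \<epsilon>)"
  by (intro smooth_continuous smooth_srad)

lemma continuous_on_green_srad: "\<epsilon> > 0 \<Longrightarrow> continuous_on S (\<lambda>x. green \<kappa> (srad \<epsilon> x))"
  using srad_pos[of \<epsilon>] unfolding green_def
  by (intro continuous_intros continuous_on_srad) (auto simp: less_imp_neq[symmetric])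

lemma continuous_on_smoothed_delta: "\<epsilon> > 0 \<Longrightarrow> continuous_on S (smoothed_delta \<epsilon> \<kappa>)"
  using srad_pos[of \<epsilon>] unfolding smoothed_delta_def[abs_def] green2_def
  by (intro continuous_intros continuous_on_srad) (auto simp: less_imp_neq[symmetric])

lemma L2_green_srad:
  assumes "\<epsilon> > 0" "Im \<kappa> > 0"
  shows "L2 (\<lambda>x. green \<kappa> (srad \<epsilon> x))"
  by (rule L2_bound[OF L2_exp_norm[OF assms(2)], where C="1 / \<epsilon>"])
     (use green_srad_bound(1)[OF assms] assms continuous_on_green_srad in
       \<open>auto intro!: borel_measurable_continuous_onI\<close>)

lemma smoothed_delta_exp_bound:
  assumes "\<epsilon> > 0" "Im \<kappa> > 0"
  shows "\<exists>C\<ge>0. \<forall>x. norm (smoothed_delta \<epsilon> \<kappa> x) \<le> C * exp (- (Im \<kappa> / 2) * norm x)"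
proof -
  obtain B where B: "B \<ge> 0" "\<And>x. norm (smoothed_delta \<epsilon> \<kappa> x) \<le> B * \<epsilon>\<^sup>2 / srad \<epsilon> x ^ 5 * exp (- (Im \<kappa> / 2) * norm x)"
    using smoothed_delta_bound[OF assms(2)] assms(1) by blast
  have "norm (smoothed_delta \<epsilon> \<kappa> x) \<le> B * \<epsilon>\<^sup>2 / \<epsilon> ^ 5 * exp (- (Im \<kappa> / 2) * norm x)" for x
  proof -
    have "B * \<epsilon>\<^sup>2 / srad \<epsilon> x ^ 5 \<le> B * \<epsilon>\<^sup>2 / \<epsilon> ^ 5"
      using B(1) assms(1) srad_ge(1)[OF assms(1), of x] srad_pos[OF assms(1), of x]
      by (intro divide_left_mono power_mono mult_pos_pos zero_less_power) auto
    then show ?thesis by (intro order_trans[OF B(2)] mult_right_mono) auto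
  qed
  moreover have "0 \<le> B * \<epsilon>\<^sup>2 / \<epsilon> ^ 5" using B(1) assms(1) by simp
  ultimately show ?thesis by blast
qed

lemma L2_smoothed_delta:
  assumes "\<epsilon> > 0" "Im \<kappa> > 0"
  shows "L2 (smoothed_delta \<epsilon> \<kappa>)"
proof -
  obtain C where C: "C \<ge> 0" "\<forall>x. norm (smoothed_delta \<epsilon> \<kappa> x) \<le> C * exp (- (Im \<kappa> / 2) * norm x)"
    using smoothed_delta_exp_bound[OF assms] by blast
  show ?thesis
  proof (rule L2_bound[where C=C])
    show "L2 (\<lambda>x. of_real (exp (- (Im \<kappa> / 2) * norm x)))" by (rule L2_exp_norm) (use assms in simp)
    show "smoothed_delta \<epsilon> \<kappa> \<in> borel_measurable lborel"
      using continuous_on_smoothed_delta[OF assms(1)] by (auto intro!: borel_measurable_continuous_onI)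
  qed (use C in simp)
qed

lemma L2_Re: "L2 F \<Longrightarrow> L2 (\<lambda>x. of_real (Re (F x)))"
  by (rule L2_bound[where C=1 and G=F]) (auto simp: abs_Re_le_cmod L2_def)

lemma integral_by_Re:
  assumes "L2 A" "L2 F"
  shows "(\<integral>x. A x * F x \<partial>lborel) = (\<integral>x. of_real (Re (1 * A x)) * F x \<partial>lborel)
    + \<i> * (\<integral>x. of_real (Re (- \<i> * A x)) * F x \<partial>lborel)"
proof -
  have i: "integrable lborel (\<lambda>x. complex_of_real (Re (c * A x)) * F x)" for c
    by (intro L2_mult_integrable L2_Re L2_cmult assms)
  have "(\<integral>x. of_real (Re (1 * A x)) * F x \<partial>lborel) + \<i> * (\<integral>x. of_real (Re (- \<i> * A x)) * F x \<partial>lborel)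
    = (\<integral>x. of_real (Re (1 * A x)) * F x + \<i> * (of_real (Re (- \<i> * A x)) * F x) \<partial>lborel)"
    unfolding Bochner_Integration.integral_add[OF i integrable_mult_right[OF i]] integral_mult_right_zero ..
  also have "(\<lambda>x. of_real (Re (1 * A x)) * F x + \<i> * (of_real (Re (- \<i> * A x)) * F x)) = (\<lambda>x. A x * F x)"
  proof
    fix x
    show "of_real (Re (1 * A x)) * F x + \<i> * (of_real (Re (- \<i> * A x)) * F x) = A x * F x"
      by (simp add: complex_eq_iff algebra_simps)
  qed
  finally show ?thesis by simp
qed

text \<open>The regularised fundamental solution is smooth and decays exponentially together with its derivatives, so it may be
paired with the weak Laplacian of \<open>F\<close>.\<close>

lemma regularized_representation:
  assumes wl: "weak_laplacian F L" and F: "L2 F" and L: "L2 L" and "\<epsilon> > 0" "Im \<kappa> > 0"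
  shows "(\<integral>x. (- \<kappa>\<^sup>2 * green \<kappa> (srad \<epsilon> x) - smoothed_delta \<epsilon> \<kappa> x) * F x \<partial>lborel)
    = (\<integral>x. green \<kappa> (srad \<epsilon> x) * L x \<partial>lborel)"
proof -
  let ?Y = "\<lambda>x. green \<kappa> (srad \<epsilon> x)"
  let ?A = "\<lambda>x. - \<kappa>\<^sup>2 * ?Y x - smoothed_delta \<epsilon> \<kappa> x"
  let ?e = "\<lambda>x::real^3. exp (- (Im \<kappa> / 2) * norm x)"
  obtain B where B: "B \<ge> 0" "\<forall>x. norm (smoothed_delta \<epsilon> \<kappa> x) \<le> B * ?e x"
    using smoothed_delta_exp_bound[OF assms(4,5)] by blast
  have ee: "exp (- Im \<kappa> * s) \<le> ?e x" if "norm x \<le> s" for s x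
  proof -
    have "Im \<kappa> / 2 * norm x \<le> Im \<kappa> * s"
      using assms(5) that by (intro mult_mono) auto
    then show ?thesis by simp
  qed
  have Y: "norm (?Y x) \<le> 1 / \<epsilon> * ?e x" for x
    by (rule order_trans[OF green_srad_bound(1)[OF assms(4,5)]], rule mult_left_mono, rule ee) (use assms in auto)
  have Y1: "\<bar>x $ i\<bar> * norm (green1 \<kappa> (srad \<epsilon> x)) \<le> (norm \<kappa> / \<epsilon> + 1 / \<epsilon>\<^sup>2) * ?e x" for i x
  proof -
    have "\<bar>x $ i\<bar> * norm (green1 \<kappa> (srad \<epsilon> x)) \<le> srad \<epsilon> x * norm (green1 \<kappa> (srad \<epsilon> x))"
      using order_trans[OF component_le_norm_cart srad_ge(2)[of x \<epsilon>]] by (rule mult_right_mono) simp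
    also have "\<dots> \<le> (norm \<kappa> / \<epsilon> + 1 / \<epsilon>\<^sup>2) * exp (- Im \<kappa> * srad \<epsilon> x)"
      by (rule green1_bound[OF assms(4) srad_ge(1)[OF assms(4)]])
    also have "\<dots> \<le> (norm \<kappa> / \<epsilon> + 1 / \<epsilon>\<^sup>2) * ?e x"
      by (rule mult_left_mono, rule ee, rule srad_ge(2)) (use assms in auto)
    finally show ?thesis .
  qed
  \<comment> \<open>The sum of the bounds for the function, its gradient and its Laplacian, so that one constant serves all three.\<close>
  define C where "C = 1 / \<epsilon> + (norm \<kappa> / \<epsilon> + 1 / \<epsilon>\<^sup>2) + ((norm \<kappa>)\<^sup>2 * (1 / \<epsilon>) + B)"
  have A: "norm (?A x) \<le> ((norm \<kappa>)\<^sup>2 * (1 / \<epsilon>) + B) * ?e x" for x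
  proof -
    have "norm (?A x) \<le> norm (- \<kappa>\<^sup>2 * ?Y x) + norm (smoothed_delta \<epsilon> \<kappa> x)" by (rule norm_triangle_ineq4)
    also have "norm (- \<kappa>\<^sup>2 * ?Y x) = (norm \<kappa>)\<^sup>2 * norm (?Y x)" by (simp add: norm_mult norm_power)
    also have "\<dots> + norm (smoothed_delta \<epsilon> \<kappa> x) \<le> (norm \<kappa>)\<^sup>2 * (1 / \<epsilon> * ?e x) + B * ?e x"
      using B(2) by (intro add_mono mult_left_mono Y) auto
    finally show ?thesis by (simp add: algebra_simps)
  qed
  have le: "t \<le> norm c * C * ?e x" if "t \<le> norm c * u" "u \<le> D * ?e x" "D \<le> C" for t u D x and c :: complex
  proof -
    have "u \<le> C * ?e x" by (rule order_trans[OF that(2)]) (rule mult_right_mono[OF that(3)], simp)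
    then have "norm c * u \<le> norm c * (C * ?e x)" by (rule mult_left_mono) simp
    with that(1) show ?thesis by (simp add: mult.assoc)
  qed
  have re: "\<bar>Re (c * w)\<bar> \<le> norm c * norm w" for c w
    using abs_Re_le_cmod[of "c * w"] by (simp add: norm_mult)
  have nn: "0 \<le> 1 / \<epsilon>" "0 \<le> norm \<kappa> / \<epsilon> + 1 / \<epsilon>\<^sup>2" "0 \<le> (norm \<kappa>)\<^sup>2 * (1 / \<epsilon>) + B"
    using assms B by auto
  have main: "(\<integral>x. of_real (Re (c * ?A x)) * F x \<partial>lborel) = (\<integral>x. of_real (Re (c * ?Y x)) * L x \<partial>lborel)" for c
    unfolding laplacian_green[OF assms(4), symmetric]
  proof (rule weak_laplacian_smooth_decaying[OF wl F L smooth_green[OF assms(4)], where b="Im \<kappa> / 2" and C="norm c * C"])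
    show "\<bar>Re (c * ?Y x)\<bar> \<le> norm c * C * ?e x" for x
      by (rule le[OF re Y]) (use nn in \<open>simp add: C_def\<close>)
    show "\<bar>partial i (\<lambda>x. Re (c * ?Y x)) x\<bar> \<le> norm c * C * ?e x" for i x
    proof (rule le[OF _ Y1[of x i]])
      show "\<bar>partial i (\<lambda>x. Re (c * ?Y x)) x\<bar> \<le> norm c * (\<bar>x $ i\<bar> * norm (green1 \<kappa> (srad \<epsilon> x)))"
        unfolding partial_green[OF assms(4)] abs_mult
        using mult_left_mono[OF re[of c "green1 \<kappa> (srad \<epsilon> x)"], of "\<bar>x $ i\<bar>"] by (simp add: mult_ac)
    qed (use nn in \<open>simp add: C_def\<close>)
    show "\<bar>laplacian (\<lambda>x. Re (c * ?Y x)) x\<bar> \<le> norm c * C * ?e x" for x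
      unfolding laplacian_green[OF assms(4)]
      by (rule le[OF re A]) (use nn in \<open>simp add: C_def\<close>)
  qed (use assms in auto)
  have "(\<integral>x. ?A x * F x \<partial>lborel) = (\<integral>x. of_real (Re (1 * ?A x)) * F x \<partial>lborel)
      + \<i> * (\<integral>x. of_real (Re (- \<i> * ?A x)) * F x \<partial>lborel)"
    by (intro integral_by_Re F L2_diff L2_cmult L2_green_srad L2_smoothed_delta assms)
  also have "\<dots> = (\<integral>x. of_real (Re (1 * ?Y x)) * L x \<partial>lborel)
      + \<i> * (\<integral>x. of_real (Re (- \<i> * ?Y x)) * L x \<partial>lborel)"
    by (simp only: main)
  also have "\<dots> = (\<integral>x. ?Y x * L x \<partial>lborel)"
    by (intro integral_by_Re[symmetric] L L2_green_srad assms)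
  finally show ?thesis .
qed

section \<open>Approximation of the point mass\<close>

text \<open>Dominated convergence is applied along this sequence of regularisation parameters.\<close>

definition eps :: "nat \<Rightarrow> real" where
  "eps n = 1 / real (Suc n)"

lemma eps_pos: "eps n > 0"
  by (simp add: eps_def)

lemma eps_tendsto_0: "eps \<longlonglongrightarrow> 0"
  unfolding eps_def[abs_def] using LIMSEQ_inverse_real_of_nat by (simp add: inverse_eq_divide)

text \<open>The limit of the masses of the smoothed point masses. Its value is \<open>1\<close>; the arguments below only divide by it.\<close>

definition smoothed_delta_mass :: real where
  "smoothed_delta_mass = 3 / (4 * pi) * (\<integral>x. 1 / srad 1 (x :: real^3) ^ 5 \<partial>lborel)"

lemma integrable_srad_power5: "integrable lborel (\<lambda>x. 1 / srad 1 x ^ 5)"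
  using integrable_inverse_power5 by (simp add: srad_def)

lemma smoothed_delta_mass_nonzero: "smoothed_delta_mass \<noteq> 0"
proof
  assume "smoothed_delta_mass = 0"
  then have "(\<integral>x. 1 / srad 1 (x :: real^3) ^ 5 \<partial>lborel) = 0" by (simp add: smoothed_delta_mass_def)
  then have "AE x in lborel. 1 / srad 1 (x :: real^3) ^ 5 = 0"
    using srad_pos[of 1] by (subst (asm) integral_nonneg_eq_0_iff_AE[OF integrable_srad_power5]) (auto simp: less_imp_le)
  then have "AE x in (lborel :: (real^3) measure). False"
    by eventually_elim (use srad_pos[of 1] in \<open>auto simp: less_imp_neq[symmetric]\<close>)
  then show False by (simp add: AE_iff_null null_sets_def)
qed

lemma srad_scale:
  assumes "\<epsilon> > 0"
  shows "srad \<epsilon> (\<epsilon> *\<^sub>R x) = \<epsilon> * srad 1 x"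
proof -
  have "\<epsilon>\<^sup>2 + (norm (\<epsilon> *\<^sub>R x))\<^sup>2 = \<epsilon>\<^sup>2 * (1\<^sup>2 + (norm x)\<^sup>2)"
    by (simp add: power_mult_distrib algebra_simps)
  then show ?thesis using assms by (simp add: srad_def real_sqrt_mult)
qed

text \<open>The profile \<open>\<epsilon>\<^sup>2 / srad\<^sup>5\<close> is homogeneous of degree \<open>-3\<close> in \<open>(\<epsilon>, x)\<close>, so the substitution
\<open>x = \<epsilon> y\<close> removes \<open>\<epsilon>\<close>.\<close>

lemma integral_scaled_power5:
  assumes "\<epsilon> > 0"
  shows "(\<integral>x. \<epsilon>\<^sup>2 / srad \<epsilon> x ^ 5 \<partial>lborel) = (\<integral>x. 1 / srad 1 (x :: real^3) ^ 5 \<partial>lborel)"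
    and "integrable lborel (\<lambda>x. \<epsilon>\<^sup>2 / srad \<epsilon> x ^ 5)"
proof -
  have c: "continuous_on UNIV (\<lambda>x. \<epsilon>\<^sup>2 / srad \<epsilon> x ^ 5)"
    using srad_pos[OF assms] by (intro continuous_intros continuous_on_srad assms) (auto simp: less_imp_neq[symmetric])
  have "(\<integral>x. \<epsilon>\<^sup>2 / srad \<epsilon> x ^ 5 \<partial>lborel) = (\<integral>x. \<epsilon> ^ DIM(real^3) *\<^sub>R (\<epsilon>\<^sup>2 / srad \<epsilon> (\<epsilon> *\<^sub>R x) ^ 5) \<partial>lborel)"
    by (rule integral_scale[OF _ assms]) (use borel_measurable_continuous_onI[OF c] in simp)
  also have "\<dots> = (\<integral>x. 1 / srad 1 (x :: real^3) ^ 5 \<partial>lborel)"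
    unfolding srad_scale[OF assms] using assms
    by (intro Bochner_Integration.integral_cong) (auto simp: power_mult_distrib power_add[symmetric])
  finally show "(\<integral>x. \<epsilon>\<^sup>2 / srad \<epsilon> x ^ 5 \<partial>lborel) = (\<integral>x. 1 / srad 1 (x :: real^3) ^ 5 \<partial>lborel)" .
  define m where "m = min 1 \<epsilon>"
  have m: "0 < m" "m \<le> 1" "m \<le> \<epsilon>" using assms by (auto simp: m_def)
  show "integrable lborel (\<lambda>x. \<epsilon>\<^sup>2 / srad \<epsilon> x ^ 5)"
  proof (rule Bochner_Integration.integrable_bound)
    show "integrable lborel (\<lambda>x. \<epsilon>\<^sup>2 / m ^ 5 * (1 / srad 1 x ^ 5))"
      by (intro integrable_mult_right integrable_srad_power5)
    show "(\<lambda>x. \<epsilon>\<^sup>2 / srad \<epsilon> x ^ 5) \<in> borel_measurable lborel"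
      using borel_measurable_continuous_onI[OF c] by simp
    have "\<epsilon>\<^sup>2 / srad \<epsilon> x ^ 5 \<le> \<epsilon>\<^sup>2 / m ^ 5 * (1 / srad 1 x ^ 5)" for x
    proof -
      have r: "srad \<epsilon> x > 0" "srad 1 x > 0" using srad_pos[OF assms] srad_pos[of 1] by auto
      have "m\<^sup>2 * 1\<^sup>2 + m\<^sup>2 * (norm x)\<^sup>2 \<le> \<epsilon>\<^sup>2 + 1 * (norm x)\<^sup>2"
        using m by (intro add_mono mult_right_mono) (auto simp: power_le_one power_mono)
      then have "(m * srad 1 x)\<^sup>2 \<le> (srad \<epsilon> x)\<^sup>2"
        unfolding power_mult_distrib srad_power2 by (simp add: algebra_simps)
      then have "m * srad 1 x \<le> srad \<epsilon> x" by (rule power2_le_imp_le) (use r in simp)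
      then have "\<epsilon>\<^sup>2 / srad \<epsilon> x ^ 5 \<le> \<epsilon>\<^sup>2 / (m * srad 1 x) ^ 5"
        using r m by (intro divide_left_mono power_mono mult_pos_pos zero_less_power) auto
      then show ?thesis by (simp add: power_mult_distrib)
    qed
    then show "AE x in lborel. norm (\<epsilon>\<^sup>2 / srad \<epsilon> x ^ 5) \<le> norm (\<epsilon>\<^sup>2 / m ^ 5 * (1 / srad 1 x ^ 5))"
      using srad_pos[OF assms] srad_pos[of 1] m by (intro AE_I2) (auto simp: less_imp_le abs_mult)
  qed
qed

text \<open>Near the origin, on a ball where \<open>F\<close> is bounded by continuity, the substitution \<open>x = \<epsilon> y\<close> turns the integral
into one with a majorant proportional to \<open>1 / sqrt (1 + |y|\<^sup>2) ^ 5\<close>. Outside the ball the kernel is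
\<open>O(\<epsilon>\<^sup>2)\<close> times an exponential, and square integrability of \<open>F\<close> suffices.\<close>

lemma smoothed_delta_approximate_identity:
  assumes \<kappa>: "Im \<kappa> > 0" and F: "L2 F" and cont: "isCont F 0"
  shows "(\<lambda>n. \<integral>x. smoothed_delta (eps n) \<kappa> x * F x \<partial>lborel) \<longlonglongrightarrow> of_real smoothed_delta_mass * F 0"
proof -
  let ?K = "\<lambda>n. smoothed_delta (eps n) \<kappa>"
  obtain B where B: "B \<ge> 0" "\<And>\<epsilon> x. \<epsilon> > 0 \<Longrightarrow> norm (smoothed_delta \<epsilon> \<kappa> x)
      \<le> B * \<epsilon>\<^sup>2 / srad \<epsilon> x ^ 5 * exp (- (Im \<kappa> / 2) * norm x)"
    using smoothed_delta_bound[OF \<kappa>] by blast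
  obtain \<delta> where \<delta>: "\<delta> > 0" "\<And>x. norm x < \<delta> \<Longrightarrow> norm (F x) \<le> norm (F 0) + 1"
  proof -
    obtain \<delta> where "\<delta> > 0" and d: "\<And>x. dist x 0 < \<delta> \<Longrightarrow> dist (F x) (F 0) < 1"
      using cont unfolding continuous_at_eps_delta by (metis zero_less_one)
    moreover have "norm (F x) \<le> norm (F 0) + 1" if "norm x < \<delta>" for x
      using d[of x] that norm_triangle_ineq2[of "F x" "F 0"] by (simp add: dist_norm)
    ultimately show ?thesis using that by blast
  qed
  \<comment> \<open>The ball on which \<open>F\<close> is bounded; \<open>I\<close> and \<open>J\<close> are the contributions from inside and outside.\<close>
  define U :: "(real^3) set" where "U = ball 0 \<delta>"
  have [measurable]: "U \<in> sets borel" by (simp add: U_def)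
  have [measurable]: "F \<in> borel_measurable borel" using F by (simp add: L2_def)
  have [measurable]: "?K n \<in> borel_measurable borel" for n
    by (intro borel_measurable_continuous_onI continuous_on_smoothed_delta eps_pos)
  have KF: "integrable lborel (\<lambda>x. ?K n x * F x)" for n
    by (intro L2_mult_integrable L2_smoothed_delta eps_pos \<kappa> F)
  define I where "I n = (\<integral>x. indicator U x * (?K n x * F x) \<partial>lborel)" for n
  define J where "J n = (\<integral>x. indicator (- U) x * (?K n x * F x) \<partial>lborel)" for n
  have ind: "integrable lborel (\<lambda>x. indicator A x * (?K n x * F x))" if [measurable]: "A \<in> sets borel" for A n
    by (rule Bochner_Integration.integrable_bound[OF KF[of n]]) (auto simp: norm_mult indicator_def)
  have split: "(\<integral>x. ?K n x * F x \<partial>lborel) = I n + J n" for n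
  proof -
    have "I n + J n = (\<integral>x. indicator U x * (?K n x * F x) + indicator (- U) x * (?K n x * F x) \<partial>lborel)"
      unfolding I_def J_def by (rule Bochner_Integration.integral_add[symmetric]) (intro ind; measurable)+
    also have "\<dots> = (\<integral>x. ?K n x * F x \<partial>lborel)"
      by (intro Bochner_Integration.integral_cong) (auto simp: indicator_def)
    finally show ?thesis ..
  qed
  have J: "J \<longlonglongrightarrow> 0"
  proof (rule Lim_null_comparison)
    define D where "D = (\<integral>x. norm (complex_of_real (exp (- (Im \<kappa> / 2) * norm x)) * F x) \<partial>lborel)"
    have iD: "integrable lborel (\<lambda>x. norm (complex_of_real (exp (- (Im \<kappa> / 2) * norm x)) * F x))"
      using \<kappa> by (intro integrable_norm L2_mult_integrable F L2_exp_norm) auto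
    show "\<forall>\<^sub>F n in sequentially. norm (J n) \<le> B * (eps n)\<^sup>2 / \<delta> ^ 5 * D"
    proof (rule always_eventually, rule allI)
      fix n
      have "norm (J n) \<le> (\<integral>x. norm (indicator (- U) x * (?K n x * F x)) \<partial>lborel)"
        unfolding J_def by (rule integral_norm_bound)
      also have "\<dots> \<le> (\<integral>x. B * (eps n)\<^sup>2 / \<delta> ^ 5 * norm (complex_of_real (exp (- (Im \<kappa> / 2) * norm x)) * F x) \<partial>lborel)"
      proof (rule integral_mono)
        show "integrable lborel (\<lambda>x. norm (indicator (- U) x * (?K n x * F x)))"
          by (intro integrable_norm ind) measurable
        show "integrable lborel (\<lambda>x. B * (eps n)\<^sup>2 / \<delta> ^ 5 * norm (complex_of_real (exp (- (Im \<kappa> / 2) * norm x)) * F x))"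
          by (intro integrable_mult_right iD)
        fix x :: "real^3"
        show "norm (indicator (- U) x * (?K n x * F x)) \<le> B * (eps n)\<^sup>2 / \<delta> ^ 5 * norm (complex_of_real (exp (- (Im \<kappa> / 2) * norm x)) * F x)"
        proof (cases "x \<in> U")
          case True
          then show ?thesis using B \<delta> by simp
        next
          case False
          then have "\<delta> \<le> srad (eps n) x" using srad_ge(2)[of x "eps n"] by (simp add: U_def)
          then have "B * (eps n)\<^sup>2 / srad (eps n) x ^ 5 \<le> B * (eps n)\<^sup>2 / \<delta> ^ 5"
            using B \<delta> srad_pos[OF eps_pos, of n x]
            by (intro divide_left_mono power_mono mult_pos_pos zero_less_power) auto
          then have "B * (eps n)\<^sup>2 / srad (eps n) x ^ 5 * exp (- (Im \<kappa> / 2) * norm x) \<le> B * (eps n)\<^sup>2 / \<delta> ^ 5 * exp (- (Im \<kappa> / 2) * norm x)"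
            by (rule mult_right_mono) simp
          from order_trans[OF B(2)[OF eps_pos] this]
          have "norm (?K n x) * norm (F x) \<le> B * (eps n)\<^sup>2 / \<delta> ^ 5 * exp (- (Im \<kappa> / 2) * norm x) * norm (F x)"
            by (rule mult_right_mono) simp
          with False show ?thesis by (simp add: norm_mult mult.assoc)
        qed
      qed
      also have "\<dots> = B * (eps n)\<^sup>2 / \<delta> ^ 5 * D" unfolding D_def by simp
      finally show "norm (J n) \<le> B * (eps n)\<^sup>2 / \<delta> ^ 5 * D" .
    qed
    have "(\<lambda>n. B * (eps n)\<^sup>2 / \<delta> ^ 5 * D) \<longlonglongrightarrow> B * 0\<^sup>2 / \<delta> ^ 5 * D"
      using \<delta> by (intro tendsto_intros eps_tendsto_0) auto
    then show "(\<lambda>n. B * (eps n)\<^sup>2 / \<delta> ^ 5 * D) \<longlonglongrightarrow> 0" by simp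
  qed
  \<comment> \<open>After rescaling, the kernel is \<open>q (\<epsilon> s)\<close> times a fixed profile in \<open>s\<close>, so only \<open>q 0\<close> survives in the limit.\<close>
  define q where "q s = exp (\<i> * \<kappa> * of_real s) * (3 - 3 * \<i> * \<kappa> * of_real s - \<kappa>\<^sup>2 * of_real s ^ 2) / (4 * of_real pi)" for s
  define f where "f n x = of_real (eps n ^ 3) * (indicator U (eps n *\<^sub>R x) * (?K n (eps n *\<^sub>R x) * F (eps n *\<^sub>R x)))" for n x
  have f_eq: "f n x = indicator U (eps n *\<^sub>R x) * (q (eps n * srad 1 x) / of_real (srad 1 x) ^ 5 * F (eps n *\<^sub>R x))" for n x
  proof -
    have p: "eps n > 0" "srad 1 x > 0" using eps_pos srad_pos[of 1] by auto
    have "of_real (eps n ^ 3) * ?K n (eps n *\<^sub>R x) = q (eps n * srad 1 x) / of_real (srad 1 x) ^ 5"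
    proof -
      have alg: "e ^ 3 * (e\<^sup>2 * (N / (4 * p * (e * r) ^ 5))) = N / (4 * p) / r ^ 5" if "e \<noteq> 0" for e r N p :: complex
      proof -
        have "e ^ 3 * (e\<^sup>2 * (N / (4 * p * (e * r) ^ 5))) = (e ^ 5 * N) / (e ^ 5 * (4 * p * r ^ 5))"
          by (simp add: power_mult_distrib mult_ac power_add[symmetric])
        also have "\<dots> = N / (4 * p * r ^ 5)" by (rule nonzero_mult_divide_mult_cancel_left) (use that in simp)
        finally show ?thesis by simp
      qed
      show ?thesis
        unfolding smoothed_delta_def green2_def srad_scale[OF p(1)] q_def of_real_power of_real_mult
        by (rule alg) (use p in simp)
    qed
    then show ?thesis by (simp add: f_def mult_ac)
  qed
  have I_eq: "I n = (\<integral>x. f n x \<partial>lborel)" for n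
  proof -
    have "I n = (\<integral>x. eps n ^ DIM(real^3) *\<^sub>R (indicator U (eps n *\<^sub>R x) * (?K n (eps n *\<^sub>R x) * F (eps n *\<^sub>R x))) \<partial>lborel)"
      unfolding I_def by (rule integral_scale[OF _ eps_pos]) measurable
    then show ?thesis by (simp add: f_def scaleR_conv_of_real)
  qed
  have ex: "(\<lambda>n. eps n *\<^sub>R x) \<longlonglongrightarrow> 0" for x :: "real^3"
    using tendsto_scaleR[OF eps_tendsto_0 tendsto_const[of x]] by simp
  have q0: "q 0 = 3 / (4 * of_real pi)" by (simp add: q_def)
  have "(\<lambda>n. \<integral>x. f n x \<partial>lborel) \<longlonglongrightarrow> (\<integral>x. q 0 / of_real (srad 1 x) ^ 5 * F 0 \<partial>lborel)"
  proof (rule integral_dominated_convergence[where w="\<lambda>x. B * (norm (F 0) + 1) * (1 / srad 1 x ^ 5)"])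
    show "f n \<in> borel_measurable lborel" for n unfolding f_def[abs_def] by measurable
    have [measurable]: "srad 1 \<in> borel_measurable borel"
      by (intro borel_measurable_continuous_onI continuous_on_srad) simp
    show "(\<lambda>x. q 0 / of_real (srad 1 x) ^ 5 * F 0) \<in> borel_measurable lborel" by measurable
    show "integrable lborel (\<lambda>x. B * (norm (F 0) + 1) * (1 / srad 1 x ^ 5))"
      by (intro integrable_mult_right integrable_srad_power5)
    show "AE x in lborel. (\<lambda>n. f n x) \<longlonglongrightarrow> q 0 / of_real (srad 1 x) ^ 5 * F 0"
    proof (rule AE_I2)
      fix x :: "real^3"
      have "eventually (\<lambda>n. eps n *\<^sub>R x \<in> U) sequentially"
        using topological_tendstoD[OF ex[of x], of U] \<delta> by (simp add: U_def)
      then have "eventually (\<lambda>n. q (eps n * srad 1 x) / of_real (srad 1 x) ^ 5 * F (eps n *\<^sub>R x) = f n x) sequentially"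
        by eventually_elim (simp add: f_eq)
      moreover have "(\<lambda>n. q (eps n * srad 1 x) / of_real (srad 1 x) ^ 5 * F (eps n *\<^sub>R x)) \<longlonglongrightarrow> q 0 / of_real (srad 1 x) ^ 5 * F 0"
      proof (intro tendsto_mult tendsto_divide tendsto_const)
        have "isCont q 0" unfolding q_def by (intro continuous_intros) auto
        moreover have "(\<lambda>n. eps n * srad 1 x) \<longlonglongrightarrow> 0"
          using tendsto_mult[OF eps_tendsto_0 tendsto_const[of "srad 1 x"]] by simp
        ultimately show "(\<lambda>n. q (eps n * srad 1 x)) \<longlonglongrightarrow> q 0" by (rule isCont_tendsto_compose)
        show "(\<lambda>n. F (eps n *\<^sub>R x)) \<longlonglongrightarrow> F 0" by (rule isCont_tendsto_compose[OF cont ex])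
        show "complex_of_real (srad 1 x) ^ 5 \<noteq> 0" using srad_pos[of 1 x] by simp
      qed
      ultimately show "(\<lambda>n. f n x) \<longlonglongrightarrow> q 0 / of_real (srad 1 x) ^ 5 * F 0"
        by (rule Lim_transform_eventually[rotated])
    qed
    show "AE x in lborel. norm (f n x) \<le> B * (norm (F 0) + 1) * (1 / srad 1 x ^ 5)" for n
    proof (rule AE_I2)
      fix x :: "real^3"
      show "norm (f n x) \<le> B * (norm (F 0) + 1) * (1 / srad 1 x ^ 5)"
      proof (cases "eps n *\<^sub>R x \<in> U")
        case False
        then show ?thesis using B srad_pos[of 1 x] by (simp add: f_def)
      next
        case True
        have p: "eps n > 0" "srad 1 x > 0" using eps_pos srad_pos[of 1] by auto
        have "exp (- (Im \<kappa> / 2) * norm (eps n *\<^sub>R x)) \<le> 1" using \<kappa> p by simp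
        then have "B * (eps n)\<^sup>2 / srad (eps n) (eps n *\<^sub>R x) ^ 5 * exp (- (Im \<kappa> / 2) * norm (eps n *\<^sub>R x))
            \<le> B * (eps n)\<^sup>2 / srad (eps n) (eps n *\<^sub>R x) ^ 5"
          using B(1) srad_pos[OF p(1), of "eps n *\<^sub>R x"]
          by (intro mult_left_le) auto
        from order_trans[OF B(2)[OF p(1)] this]
        have "eps n ^ 3 * norm (?K n (eps n *\<^sub>R x)) \<le> eps n ^ 3 * (B * (eps n)\<^sup>2 / (eps n * srad 1 x) ^ 5)"
          unfolding srad_scale[OF p(1)] by (rule mult_left_mono) (use p in simp)
        also have "\<dots> = (eps n ^ 5 * B) / (eps n ^ 5 * srad 1 x ^ 5)"
          by (simp add: power_mult_distrib mult_ac power_add[symmetric])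
        also have "\<dots> = B / srad 1 x ^ 5" by (rule nonzero_mult_divide_mult_cancel_left) (use p in simp)
        finally have *: "eps n ^ 3 * norm (?K n (eps n *\<^sub>R x)) \<le> B / srad 1 x ^ 5" .
        have "norm (f n x) = eps n ^ 3 * norm (?K n (eps n *\<^sub>R x)) * norm (F (eps n *\<^sub>R x))"
          using True p by (simp add: f_def norm_mult norm_power)
        also have "\<dots> \<le> B / srad 1 x ^ 5 * (norm (F 0) + 1)"
          using True p B by (intro mult_mono * \<delta>(2)) (auto simp: U_def)
        finally show ?thesis by (simp add: mult_ac)
      qed
    qed
  qed
  also have "(\<integral>x. q 0 / of_real (srad 1 x) ^ 5 * F 0 \<partial>lborel) = of_real smoothed_delta_mass * F 0"
  proof -
    have "(\<lambda>x. q 0 / of_real (srad 1 x) ^ 5 * F 0) = (\<lambda>x. q 0 * F 0 * of_real (1 / srad 1 x ^ 5))"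
      by (auto simp: fun_eq_iff)
    then have "(\<integral>x. q 0 / of_real (srad 1 x) ^ 5 * F 0 \<partial>lborel) = q 0 * F 0 * of_real (\<integral>x. 1 / srad 1 x ^ 5 \<partial>lborel)"
      by (simp only: integral_mult_right_zero integral_complex_of_real)
    then show ?thesis by (simp add: q0 smoothed_delta_mass_def)
  qed
  finally have "I \<longlonglongrightarrow> of_real smoothed_delta_mass * F 0" unfolding I_eq[symmetric] .
  from tendsto_add[OF this J] show ?thesis by (simp add: split)
qed

section \<open>The representation formula\<close>

lemma weak_laplacian_translate:
  assumes wl: "weak_laplacian F L" and m: "F \<in> borel_measurable lborel" "L \<in> borel_measurable lborel"
  shows "weak_laplacian (\<lambda>x. F (x + a)) (\<lambda>x. L (x + a))"
  unfolding weak_laplacian_def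
proof (intro allI impI)
  fix \<phi> assume \<phi>: "test_function \<phi>"
  then have s: "smooth \<phi>" by (simp add: test_function_altdef)
  define \<psi> where "\<psi> x = \<phi> (1 *\<^sub>R (x - a))" for x
  have \<psi>: "test_function \<psi>" unfolding \<psi>_def by (intro test_function_affine \<phi>) simp
  then have s': "smooth \<psi>" by (simp add: test_function_altdef)
  have lap: "laplacian \<psi> x = laplacian \<phi> (x - a)" for x
    using laplacian_affine[OF s, of 1 a x] by (simp add: \<psi>_def[abs_def])
  have [measurable]: "F \<in> borel_measurable borel" "L \<in> borel_measurable borel"
    "\<psi> \<in> borel_measurable borel" "laplacian \<psi> \<in> borel_measurable borel"
    using m s' by (auto intro!: smooth_measurable smooth_laplacian)
  have "(\<integral>x. of_real (laplacian \<phi> x) * F (x + a) \<partial>lborel) = (\<integral>x. of_real (laplacian \<psi> x) * F x \<partial>lborel)"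
  proof -
    have "(\<lambda>x. complex_of_real (laplacian \<psi> x) * F x) \<in> borel_measurable lborel" by measurable
    from integral_translate[OF this, of a] show ?thesis by (simp add: lap)
  qed
  also have "\<dots> = (\<integral>x. of_real (\<psi> x) * L x \<partial>lborel)"
    using wl \<psi> by (simp add: weak_laplacian_def)
  also have "\<dots> = (\<integral>x. of_real (\<phi> x) * L (x + a) \<partial>lborel)"
  proof -
    have "(\<lambda>x. complex_of_real (\<psi> x) * L x) \<in> borel_measurable lborel" by measurable
    from integral_translate[OF this, of a] show ?thesis by (simp add: \<psi>_def)
  qed
  finally show "(\<integral>x. of_real (laplacian \<phi> x) * F (x + a) \<partial>lborel) = (\<integral>x. of_real (\<phi> x) * L (x + a) \<partial>lborel)" .
qed

lemma continuous_on_green: "0 \<notin> S \<Longrightarrow> continuous_on S (green \<kappa>)"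
  unfolding green_def[abs_def] by (intro continuous_intros) auto

lemma measurable_green_norm: "(\<lambda>x::real^3. green \<kappa> (norm x)) \<in> borel_measurable borel"
  unfolding green_def by (intro borel_measurable_divide borel_measurable_continuous_onI continuous_intros)

lemma L2_green_norm:
  assumes "Im \<kappa> > 0"
  shows "L2 (\<lambda>x. green \<kappa> (norm x))"
proof (rule L2_bound[OF L2_exp_over_norm[OF assms], where C=1])
  show "(\<lambda>x::real^3. green \<kappa> (norm x)) \<in> borel_measurable lborel"
    using measurable_green_norm by simp
  have "AE x in lborel. x \<noteq> (0::real^3)" by (rule AE_lborel_singleton)
  then show "AE x in lborel. norm (green \<kappa> (norm (x::real^3))) \<le> 1 * norm (complex_of_real (exp (- Im \<kappa> * norm x) / norm x))"
  proof eventually_elim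
    case (elim x)
    then have "exp (- Im \<kappa> * norm x) / (4 * pi * norm x) \<le> exp (- Im \<kappa> * norm x) / norm x"
      using pi_gt3 by (intro divide_left_mono) auto
    with elim show ?case by (simp add: norm_green norm_divide)
  qed
qed

text \<open>Let \<open>\<epsilon> \<rightarrow> 0\<close> in the regularised formula: the smoothed point mass produces \<open>F 0\<close>, and the regularised
fundamental solution is dominated by its singular limit, which is square integrable.\<close>

lemma representation_formula_0:
  assumes wl: "weak_laplacian F L" and F: "L2 F" and L: "L2 L" and \<kappa>: "Im \<kappa> > 0" and cont: "isCont F 0"
  shows "of_real smoothed_delta_mass * F 0 = (\<integral>x. green \<kappa> (norm x) * (- L x - \<kappa>\<^sup>2 * F x) \<partial>lborel)"
proof -
  let ?Y = "\<lambda>n x. green \<kappa> (srad (eps n) x)"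
  define R where "R x = - L x - \<kappa>\<^sup>2 * F x" for x
  have R: "L2 R" unfolding R_def[abs_def] by (intro L2_diff L2_uminus L2_cmult F L)
  have eq: "(\<integral>x. smoothed_delta (eps n) \<kappa> x * F x \<partial>lborel) = (\<integral>x. ?Y n x * R x \<partial>lborel)" for n
  proof -
    have Y: "L2 (?Y n)" and K: "L2 (smoothed_delta (eps n) \<kappa>)"
      by (intro L2_green_srad L2_smoothed_delta eps_pos \<kappa>)+
    note i = L2_mult_integrable[OF Y F] L2_mult_integrable[OF K F] L2_mult_integrable[OF Y L]
    have "(\<integral>x. (- \<kappa>\<^sup>2 * ?Y n x - smoothed_delta (eps n) \<kappa> x) * F x \<partial>lborel)
        = (\<integral>x. - \<kappa>\<^sup>2 * (?Y n x * F x) - smoothed_delta (eps n) \<kappa> x * F x \<partial>lborel)"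
      by (simp add: algebra_simps)
    also have "\<dots> = - \<kappa>\<^sup>2 * (\<integral>x. ?Y n x * F x \<partial>lborel) - (\<integral>x. smoothed_delta (eps n) \<kappa> x * F x \<partial>lborel)"
      by (subst Bochner_Integration.integral_diff[OF integrable_mult_right[OF i(1)] i(2)]) (simp only: integral_mult_right_zero)
    finally have 1: "(\<integral>x. ?Y n x * L x \<partial>lborel)
        = - \<kappa>\<^sup>2 * (\<integral>x. ?Y n x * F x \<partial>lborel) - (\<integral>x. smoothed_delta (eps n) \<kappa> x * F x \<partial>lborel)"
      using regularized_representation[OF wl F L eps_pos \<kappa>] by simp
    have "(\<integral>x. ?Y n x * R x \<partial>lborel) = (\<integral>x. - 1 * (?Y n x * L x) - \<kappa>\<^sup>2 * (?Y n x * F x) \<partial>lborel)"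
      by (simp add: R_def algebra_simps)
    also have "\<dots> = - 1 * (\<integral>x. ?Y n x * L x \<partial>lborel) - \<kappa>\<^sup>2 * (\<integral>x. ?Y n x * F x \<partial>lborel)"
      by (subst Bochner_Integration.integral_diff[OF integrable_mult_right[OF i(3)] integrable_mult_right[OF i(1)]])
         (simp only: integral_mult_right_zero)
    finally show ?thesis using 1 by simp
  qed
  have "(\<lambda>n. \<integral>x. ?Y n x * R x \<partial>lborel) \<longlonglongrightarrow> (\<integral>x. green \<kappa> (norm x) * R x \<partial>lborel)"
  proof (rule integral_dominated_convergence[where w="\<lambda>x. norm (complex_of_real (exp (- Im \<kappa> * norm x) / norm x) * R x)"])
    show "(\<lambda>x. green \<kappa> (norm x) * R x) \<in> borel_measurable lborel"
      using measurable_green_norm R by (intro borel_measurable_times) (auto simp: L2_def)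
    show "(\<lambda>x. ?Y n x * R x) \<in> borel_measurable lborel" for n
      using L2_green_srad[OF eps_pos \<kappa>] R by (intro borel_measurable_times) (auto simp: L2_def)
    show "integrable lborel (\<lambda>x. norm (complex_of_real (exp (- Im \<kappa> * norm x) / norm x) * R x))"
      by (intro integrable_norm L2_mult_integrable L2_exp_over_norm \<kappa> R)
    have nz: "AE x in lborel. x \<noteq> (0::real^3)" by (rule AE_lborel_singleton)
    from nz show "AE x in lborel. (\<lambda>n. ?Y n x * R x) \<longlonglongrightarrow> green \<kappa> (norm x) * R x"
    proof eventually_elim
      case (elim x)
      have "(\<lambda>n. srad (eps n) x) \<longlonglongrightarrow> sqrt (0\<^sup>2 + (norm x)\<^sup>2)"
        unfolding srad_def by (intro tendsto_intros eps_tendsto_0)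
      then have lim: "(\<lambda>n. srad (eps n) x) \<longlonglongrightarrow> norm x" by simp
      have "isCont (green \<kappa>) (norm x)"
        using continuous_on_green[of "{0<..}" \<kappa>] elim
        by (simp add: continuous_on_eq_continuous_at)
      from isCont_tendsto_compose[OF this lim] show ?case by (intro tendsto_mult tendsto_const)
    qed
    from nz show "AE x in lborel. norm (?Y n x * R x) \<le> norm (complex_of_real (exp (- Im \<kappa> * norm x) / norm x) * R x)" for n
    proof eventually_elim
      case (elim x)
      have "norm (?Y n x) * norm (R x) \<le> exp (- Im \<kappa> * norm x) / norm x * norm (R x)"
        by (rule mult_right_mono[OF green_srad_bound(2)[OF eps_pos \<kappa> elim]]) simp
      then show ?case by (simp add: norm_mult norm_divide)
    qed
  qed
  then have "(\<lambda>n. \<integral>x. smoothed_delta (eps n) \<kappa> x * F x \<partial>lborel) \<longlonglongrightarrow> (\<integral>x. green \<kappa> (norm x) * R x \<partial>lborel)"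
    by (simp add: eq)
  from LIMSEQ_unique[OF smoothed_delta_approximate_identity[OF \<kappa> F cont] this]
  show ?thesis by (simp add: R_def)
qed

text \<open>Green's representation: on functions that are continuous at \<open>a\<close>, evaluation at \<open>a\<close> is the pairing of
\<open>-\<Delta> - \<kappa>\<^sup>2\<close> with the fundamental solution centred at \<open>a\<close>.\<close>

lemma representation_formula:
  assumes wl: "weak_laplacian F L" and F: "L2 F" and L: "L2 L" and \<kappa>: "Im \<kappa> > 0" and cont: "isCont F a"
  shows "of_real smoothed_delta_mass * F a = (\<integral>x. green \<kappa> (norm (x - a)) * (- L x - \<kappa>\<^sup>2 * F x) \<partial>lborel)"
proof -
  have cont': "isCont (\<lambda>x. F (x + a)) 0"
    by (rule isCont_o2[where g=F]) (auto intro!: continuous_intros simp: cont)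
  have m: "F \<in> borel_measurable lborel" "L \<in> borel_measurable lborel" using F L by (auto simp: L2_def)
  have [measurable]: "(\<lambda>x. green \<kappa> (norm (x - a))) \<in> borel_measurable borel" 
    using measurable_compose[OF _ measurable_green_norm, of "\<lambda>x. x - a" borel] by simp
  have [measurable]: "F \<in> borel_measurable borel" "L \<in> borel_measurable borel" using m by auto
  have "of_real smoothed_delta_mass * F a = (\<integral>x. green \<kappa> (norm x) * (- L (x + a) - \<kappa>\<^sup>2 * F (x + a)) \<partial>lborel)"
    using representation_formula_0[OF weak_laplacian_translate[OF wl m] L2_translate[OF F] L2_translate[OF L] \<kappa> cont'] by simp
  also have "\<dots> = (\<integral>x. green \<kappa> (norm (x - a)) * (- L x - \<kappa>\<^sup>2 * F x) \<partial>lborel)"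
    using integral_translate[of "\<lambda>x. green \<kappa> (norm (x - a)) * (- L x - \<kappa>\<^sup>2 * F x)" a] by simp
  finally show ?thesis .
qed

text \<open>The terms with \<open>\<kappa>\<^sup>2\<close> on the two sides of the regularised formula cancel.\<close>

lemma smoothed_delta_orthogonal:
  assumes wl: "weak_laplacian h (\<lambda>x. - \<kappa>\<^sup>2 * h x)" and h: "L2 h" and \<kappa>: "Im \<kappa> > 0" and \<epsilon>: "\<epsilon> > 0"
  shows "(\<integral>x. smoothed_delta \<epsilon> \<kappa> (x - a) * h x \<partial>lborel) = 0"
proof -
  let ?Y = "\<lambda>x. green \<kappa> (srad \<epsilon> x)"
  have m: "h \<in> borel_measurable lborel" using h by (simp add: L2_def)
  have [measurable]: "h \<in> borel_measurable borel" using m by simp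
  have [measurable]: "smoothed_delta \<epsilon> \<kappa> \<in> borel_measurable borel"
    by (intro borel_measurable_continuous_onI continuous_on_smoothed_delta \<epsilon>)
  have h': "L2 (\<lambda>x. h (x + a))" by (rule L2_translate[OF h])
  have Y: "L2 ?Y" and K: "L2 (smoothed_delta \<epsilon> \<kappa>)" by (intro L2_green_srad L2_smoothed_delta \<epsilon> \<kappa>)+
  note i = L2_mult_integrable[OF Y h'] L2_mult_integrable[OF K h']
  have "weak_laplacian (\<lambda>x. h (x + a)) (\<lambda>x. - \<kappa>\<^sup>2 * h (x + a))"
    using weak_laplacian_translate[OF wl m] by simp
  from regularized_representation[OF this h' L2_cmult[OF h'] \<epsilon> \<kappa>]
  have "(\<integral>x. - \<kappa>\<^sup>2 * (?Y x * h (x + a)) - smoothed_delta \<epsilon> \<kappa> x * h (x + a) \<partial>lborel)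
     = (\<integral>x. - \<kappa>\<^sup>2 * (?Y x * h (x + a)) \<partial>lborel)"
    by (simp add: algebra_simps)
  then have "(\<integral>x. smoothed_delta \<epsilon> \<kappa> x * h (x + a) \<partial>lborel) = 0"
    by (subst (asm) Bochner_Integration.integral_diff[OF integrable_mult_right[OF i(1)] i(2)]) simp
  then show ?thesis
    using integral_translate[of "\<lambda>x. smoothed_delta \<epsilon> \<kappa> (x - a) * h x" a] by simp
qed

section \<open>Weak solutions of the Helmholtz equation\<close>

text \<open>On a fixed large box the function is integrable, and the sets over which its integral vanishes form a
Dynkin system that contains the intersection-stable generator of boxes.\<close>

lemma AE_eq_0_if_box_integrals_eq_0:
  fixes h :: "'a::euclidean_space \<Rightarrow> complex"
  assumes m: "h \<in> borel_measurable lborel"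
    and int: "\<And>a b. integrable lborel (\<lambda>x. indicator (box a b) x * h x)"
    and zero: "\<And>a b. (\<integral>x. indicator (box a b) x * h x \<partial>lborel) = 0"
  shows "AE x in lborel. h x = 0"
proof -
  have [measurable]: "h \<in> borel_measurable borel" using m by simp
  have inter: "\<exists>p q. box a b \<inter> box c d = (box p q :: 'a set)" for a b c d
    using box_Int_box[of a b c d] by (intro exI)
  define U :: "nat \<Rightarrow> 'a set" where "U n = box (- (real n *\<^sub>R One)) (real n *\<^sub>R One)" for n
  have "AE x in lborel. indicator (U n) x * h x = 0" for n
  proof (rule sigma_finite_measure.density_zero[OF sigma_finite_lborel])
    let ?g = "\<lambda>x. indicator (U n) x * h x"
    show ig: "integrable lborel ?g" unfolding U_def by (rule int)
    have iA: "integrable lborel (\<lambda>x. indicator A x *\<^sub>R ?g x)" if "A \<in> sets borel" for A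
      using ig that by (intro integrable_mult_indicator) auto
    fix A :: "'a set" assume "A \<in> sets lborel"
    then have mem: "A \<in> sigma_sets UNIV (range (\<lambda>(a, b). box a b))" by (simp add: borel_eq_box)
    have st: "Int_stable (range (\<lambda>(a, b). box a b :: 'a set))"
      unfolding Int_stable_def
    proof (intro ballI)
      fix S T :: "'a set" assume "S \<in> range (\<lambda>(a, b). box a b)" "T \<in> range (\<lambda>(a, b). box a b)"
      then obtain a b c d where "S = box a b" "T = box c d" by auto
      then obtain p q where "S \<inter> T = box p q" using inter[of a b c d] by (elim exE) simp
      then show "S \<inter> T \<in> range (\<lambda>(a, b). box a b)" by (intro range_eqI[where x="(p, q)"]) simp
    qed
    have sub: "range (\<lambda>(a, b). box a b :: 'a set) \<subseteq> Pow UNIV" by simp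
    from st sub mem have "(\<integral>x. indicator A x *\<^sub>R ?g x \<partial>lborel) = 0"
    proof (induction rule: sigma_sets_induct_disjoint)
      case (basic A)
      then obtain a b where A: "A = box a b" by auto
      obtain p q where pq: "A \<inter> U n = box p q"
        unfolding A U_def using inter[of a b "- (real n *\<^sub>R One)" "real n *\<^sub>R One"] by (elim exE)
      have "(\<integral>x. indicator A x *\<^sub>R ?g x \<partial>lborel) = (\<integral>x. indicator (A \<inter> U n) x * h x \<partial>lborel)"
        by (intro Bochner_Integration.integral_cong) (auto simp: indicator_def)
      then show ?case unfolding pq by (simp only: zero)
    next
      case empty
      then show ?case by simp
    next
      case (compl A)
      have A: "A \<in> sets borel" using compl(1) by (simp add: borel_eq_box)
      have "(\<integral>x. indicator (UNIV - A) x *\<^sub>R ?g x \<partial>lborel) = (\<integral>x. ?g x - indicator A x *\<^sub>R ?g x \<partial>lborel)"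
        by (intro Bochner_Integration.integral_cong) (auto simp: indicator_def)
      also have "\<dots> = (\<integral>x. ?g x \<partial>lborel) - (\<integral>x. indicator A x *\<^sub>R ?g x \<partial>lborel)"
        by (rule Bochner_Integration.integral_diff[OF ig iA[OF A]])
      also have "\<dots> = 0" using compl(2) zero by (simp add: U_def)
      finally show ?case .
    next
      case (union A)
      have A: "A i \<in> sets lborel" for i using union(2) by (auto simp: borel_eq_box)
      have "set_lebesgue_integral lborel (\<Union>i. A i) ?g = (\<Sum>i. set_lebesgue_integral lborel (A i) ?g)"
      proof (rule lebesgue_integral_countable_add)
        show "set_integrable lborel (\<Union>i. A i) ?g"
          unfolding set_integrable_def by (rule iA) (use A in auto)
      qed (use A union(1) in \<open>auto simp: disjoint_family_on_def\<close>)
      then show ?case using union(3) by (simp add: set_lebesgue_integral_def)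
    qed
    then show "set_lebesgue_integral lborel A ?g = 0"
      by (simp add: set_lebesgue_integral_def)
  qed
  then have "AE x in lborel. \<forall>n. indicator (U n) x * h x = 0" unfolding AE_all_countable by (rule allI)
  then show ?thesis
  proof eventually_elim
    case (elim x)
    have "\<exists>n. x \<in> U n"
    proof -
      obtain n where n: "norm x < real n" using reals_Archimedean2 by blast
      have "\<bar>x \<bullet> i\<bar> < real n" if "i \<in> Basis" for i
        using Basis_le_norm[OF that, of x] n by linarith
      then have "x \<in> U n" by (force simp: U_def mem_box abs_less_iff inner_minus_left)
      then show ?thesis by blast
    qed
    with elim show ?case by (metis indicator_simps(1) mult_1)
  qed
qed

text \<open>Since \<open>\<kappa>\<^sup>2\<close> is not a nonnegative real, the equation \<open>-\<Delta>h = \<kappa>\<^sup>2 h\<close> has no square integrable solution except zero.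
All convolutions of \<open>h\<close> with smoothed point masses vanish. Integrated over a box, and with the convolution
moved onto the indicator \<open>v\<close> of the box by Fubini, this says that \<open>h\<close> is orthogonal to the smoothed
indicators, which converge to a multiple of \<open>v\<close> off the boundary of the box.\<close>

lemma helmholtz_equation_trivial:
  assumes wl: "weak_laplacian h (\<lambda>x. - \<kappa>\<^sup>2 * h x)" and h: "L2 h" and \<kappa>: "Im \<kappa> > 0"
  shows "AE x in lborel. h x = 0"
proof (rule AE_eq_0_if_box_integrals_eq_0)
  show "h \<in> borel_measurable lborel" using h by (simp add: L2_def)
  have box: "L2 (indicator (box a b))" for a b :: "real^3"
    by (rule L2_indicator) (auto simp: emeasure_lborel_box_eq)
  show "integrable lborel (\<lambda>x. indicator (box a b) x * h x)" for a b
    by (rule L2_mult_integrable[OF box h])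
  fix a b :: "real^3"
  define v :: "real^3 \<Rightarrow> complex" where "v = indicator (box a b)"
  have v: "L2 v" unfolding v_def by (rule box)
  have [measurable]: "h \<in> borel_measurable borel" "v \<in> borel_measurable borel" using h v by (auto simp: L2_def)
  obtain \<rho> where \<rho>: "\<And>x. x \<in> box a b \<Longrightarrow> norm x \<le> \<rho>"
    using bounded_box[of a b] by (auto simp: bounded_iff)
  obtain B where B: "B \<ge> 0" "\<And>\<epsilon> x. \<epsilon> > 0 \<Longrightarrow> norm (smoothed_delta \<epsilon> \<kappa> x)
      \<le> B * \<epsilon>\<^sup>2 / srad \<epsilon> x ^ 5 * exp (- (Im \<kappa> / 2) * norm x)"
    using smoothed_delta_bound[OF \<kappa>] by blast
  define J where "J = (\<integral>x. 1 / srad 1 (x :: real^3) ^ 5 \<partial>lborel)"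
  let ?K = "\<lambda>n. smoothed_delta (eps n) \<kappa>"
  have [measurable]: "?K n \<in> borel_measurable borel" for n
    by (intro borel_measurable_continuous_onI continuous_on_smoothed_delta eps_pos)
  have even: "?K n (x - y) = ?K n (y - x)" for n x y
    by (simp add: smoothed_delta_def srad_def norm_minus_commute)
  \<comment> \<open>The smoothed indicator of the box.\<close>
  define w where "w n x = (\<integral>y. ?K n y * v (y + x) \<partial>lborel)" for n x
  have w_eq: "w n x = (\<integral>y. ?K n (y - x) * v y \<partial>lborel)" for n x
    using integral_translate[of "\<lambda>y. ?K n (y - x) * v y" x] by (simp add: w_def)
  have [measurable]: "w n \<in> borel_measurable borel" for n
    unfolding w_def[abs_def] by measurable
  have K: "L2 (?K n)" for n by (intro L2_smoothed_delta eps_pos \<kappa>)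
  have w0: "(\<integral>x. w n x * h x \<partial>lborel) = 0" for n
  proof -
    define f where "f y x = v y * (?K n (y - x) * h x)" for y x
    have KL2: "L2 (\<lambda>x. ?K n (y - x))" for y
    proof -
      have "L2 (\<lambda>x. ?K n (x + (- y)))" by (rule L2_translate[OF K])
      then show ?thesis by (simp add: even[of _ y])
    qed
    have int: "integrable (lborel \<Otimes>\<^sub>M lborel) (case_prod f)"
    proof (rule lborel_pair.Fubini_integrable)
      show "case_prod f \<in> borel_measurable (lborel \<Otimes>\<^sub>M lborel)" unfolding f_def by measurable
      have fi: "integrable lborel (f y)" for y
        unfolding f_def by (intro integrable_mult_right L2_mult_integrable KL2 h)
      then show "AE y in lborel. integrable lborel (\<lambda>x. case_prod f (y, x))" by simp
      define C where "C = (\<integral>x. (norm (?K n x))\<^sup>2 \<partial>lborel) + (\<integral>x. (norm (h x))\<^sup>2 \<partial>lborel)"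
      show "integrable lborel (\<lambda>y. \<integral>x. norm (case_prod f (y, x)) \<partial>lborel)"
      proof (rule Bochner_Integration.integrable_bound)
        show "integrable lborel (\<lambda>y. C * indicator (box a b) y)"
          by (intro integrable_mult_right) (simp add: emeasure_lborel_box_eq)
        show "(\<lambda>y. \<integral>x. norm (case_prod f (y, x)) \<partial>lborel) \<in> borel_measurable lborel"
          unfolding f_def by measurable
        show "AE y in lborel. norm (\<integral>x. norm (case_prod f (y, x)) \<partial>lborel) \<le> norm (C * indicator (box a b) y)"
        proof (rule AE_I2)
          fix y
          have i2: "integrable lborel (\<lambda>x. (norm (?K n (y - x)))\<^sup>2)" "integrable lborel (\<lambda>x. (norm (h x))\<^sup>2)"
            using KL2 h by (auto simp: L2_def)
          have "(\<integral>x. norm (f y x) \<partial>lborel) \<le> (\<integral>x. indicator (box a b) y * ((norm (?K n (y - x)))\<^sup>2 + (norm (h x))\<^sup>2) \<partial>lborel)"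
          proof (rule integral_mono)
            show "integrable lborel (\<lambda>x. norm (f y x))" using fi by simp
            show "integrable lborel (\<lambda>x. indicator (box a b) y * ((norm (?K n (y - x)))\<^sup>2 + (norm (h x))\<^sup>2))"
              using i2 by (intro integrable_mult_right Bochner_Integration.integrable_add)
            show "norm (f y x) \<le> indicator (box a b) y * ((norm (?K n (y - x)))\<^sup>2 + (norm (h x))\<^sup>2)" for x
              using mult_le_sum_squares[of "norm (?K n (y - x))" "norm (h x)"] by (simp add: f_def v_def norm_mult indicator_def)
          qed
          also have "\<dots> = indicator (box a b) y * ((\<integral>x. (norm (?K n (y - x)))\<^sup>2 \<partial>lborel) + (\<integral>x. (norm (h x))\<^sup>2 \<partial>lborel))"
            using i2 by simp
          also have "(\<integral>x. (norm (?K n (y - x)))\<^sup>2 \<partial>lborel) = (\<integral>x. (norm (?K n x))\<^sup>2 \<partial>lborel)"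
            unfolding even[of n y] using integral_translate[of "\<lambda>x. (norm (?K n x))\<^sup>2" "- y"] by simp
          finally have "(\<integral>x. norm (f y x) \<partial>lborel) \<le> C * indicator (box a b) y" by (simp add: C_def mult.commute)
          moreover have "0 \<le> (\<integral>x. norm (f y x) \<partial>lborel)" by simp
          ultimately show "norm (\<integral>x. norm (case_prod f (y, x)) \<partial>lborel) \<le> norm (C * indicator (box a b) y)" by simp
        qed
      qed
    qed
    have "(\<integral>x. w n x * h x \<partial>lborel) = (\<integral>x. (\<integral>y. f y x \<partial>lborel) \<partial>lborel)"
    proof (intro Bochner_Integration.integral_cong refl)
      fix x
      have "(\<integral>y. f y x \<partial>lborel) = (\<integral>y. (?K n (y - x) * v y) * h x \<partial>lborel)"
        by (simp add: f_def mult_ac)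
      then show "w n x * h x = (\<integral>y. f y x \<partial>lborel)" by (simp add: w_eq)
    qed
    also have "\<dots> = (\<integral>y. (\<integral>x. f y x \<partial>lborel) \<partial>lborel)"
      by (rule lborel_pair.Fubini_integral[OF int])
    also have "\<dots> = (\<integral>y. v y * (\<integral>x. ?K n (x - y) * h x \<partial>lborel) \<partial>lborel)"
      by (simp add: f_def even[of n])
    also have "\<dots> = 0" using smoothed_delta_orthogonal[OF wl h \<kappa> eps_pos] by simp
    finally show ?thesis .
  qed
  have "(\<lambda>n. \<integral>x. w n x * h x \<partial>lborel) \<longlonglongrightarrow> (\<integral>x. of_real smoothed_delta_mass * v x * h x \<partial>lborel)"
  proof (rule integral_dominated_convergence[where w="\<lambda>x. norm (of_real (B * exp (Im \<kappa> / 2 * \<rho>) * J) * (of_real (exp (- (Im \<kappa> / 2) * norm x)) * h x))"])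
    show "integrable lborel (\<lambda>x. norm (of_real (B * exp (Im \<kappa> / 2 * \<rho>) * J) * (of_real (exp (- (Im \<kappa> / 2) * norm x)) * h x)))"
      using \<kappa> by (intro integrable_norm integrable_mult_right L2_mult_integrable L2_exp_norm h) auto
    have "AE x in lborel. x \<notin> cbox a b - box a b"
    proof (rule AE_not_in)
      have "emeasure lborel (cbox a b - box a b) = emeasure lborel (cbox a b) - emeasure lborel (box a b)"
        by (rule emeasure_Diff) (auto simp: emeasure_lborel_box_eq box_subset_cbox)
      also have "\<dots> = 0" by (simp add: emeasure_lborel_box_eq emeasure_lborel_cbox_eq)
      finally show "cbox a b - box a b \<in> null_sets lborel" by (auto simp: null_sets_def)
    qed
    then show "AE x in lborel. (\<lambda>n. w n x * h x) \<longlonglongrightarrow> of_real smoothed_delta_mass * v x * h x"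
    proof eventually_elim
      case (elim x)
      have "isCont v x"
      proof (cases "x \<in> box a b")
        case True
        have "eventually (\<lambda>y. v y = 1) (nhds x)"
          using eventually_nhds_in_open[OF open_box True] by eventually_elim (simp add: v_def)
        then show ?thesis using True by (simp add: isCont_cong)
      next
        case False
        with elim have "x \<in> - cbox a b" by auto
        then have "eventually (\<lambda>y. y \<in> - cbox a b) (nhds x)"
          by (intro eventually_nhds_in_open) auto
        then have "eventually (\<lambda>y. v y = 0) (nhds x)"
          by eventually_elim (use box_subset_cbox in \<open>auto simp: v_def indicator_def\<close>)
        then show ?thesis by (simp add: isCont_cong)
      qed
      then have "isCont v (0 + x)" by simp
      moreover have "isCont (\<lambda>y. y + x) 0" by (intro continuous_intros)
      ultimately have "isCont (\<lambda>y. v (y + x)) 0" by (rule isCont_o2[rotated])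
      from smoothed_delta_approximate_identity[OF \<kappa> L2_translate[OF v] this]
      have "(\<lambda>n. w n x) \<longlonglongrightarrow> of_real smoothed_delta_mass * v x" by (simp add: w_def)
      then show ?case by (intro tendsto_mult tendsto_const)
    qed
    show "AE x in lborel. norm (w n x * h x) \<le> norm (of_real (B * exp (Im \<kappa> / 2 * \<rho>) * J) * (of_real (exp (- (Im \<kappa> / 2) * norm x)) * h x))" for n
    proof (rule AE_I2)
      fix x
      have "norm (w n x) \<le> (\<integral>y. norm (?K n y * v (y + x)) \<partial>lborel)"
        unfolding w_def by (rule integral_norm_bound)
      also have "\<dots> \<le> (\<integral>y. (B * exp (Im \<kappa> / 2 * \<rho>) * exp (- (Im \<kappa> / 2) * norm x)) * ((eps n)\<^sup>2 / srad (eps n) y ^ 5) \<partial>lborel)"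
      proof (rule integral_mono)
        show "integrable lborel (\<lambda>y. norm (?K n y * v (y + x)))"
          by (intro integrable_norm L2_mult_integrable K L2_translate v)
        show "integrable lborel (\<lambda>y. (B * exp (Im \<kappa> / 2 * \<rho>) * exp (- (Im \<kappa> / 2) * norm x)) * ((eps n)\<^sup>2 / srad (eps n) y ^ 5))"
          by (intro integrable_mult_right integral_scaled_power5 eps_pos)
        fix y
        have r: "srad (eps n) y > 0" by (rule srad_pos[OF eps_pos])
        show "norm (?K n y * v (y + x)) \<le> (B * exp (Im \<kappa> / 2 * \<rho>) * exp (- (Im \<kappa> / 2) * norm x)) * ((eps n)\<^sup>2 / srad (eps n) y ^ 5)"
        proof (cases "y + x \<in> box a b")
          case False
          then show ?thesis using B(1) r by (simp add: v_def)
        next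
          case True
          have "norm x \<le> norm (y + x) + norm y" using norm_triangle_ineq4[of "y + x" y] by simp
          also have "\<dots> \<le> \<rho> + norm y" using \<rho>[OF True] by simp
          \<comment> \<open>The integrand lives on \<open>|y| \<ge> |x| - \<rho>\<close>, so the decay of the kernel in \<open>y\<close> becomes decay in \<open>x\<close>.\<close>
          finally have "Im \<kappa> / 2 * norm x \<le> Im \<kappa> / 2 * (\<rho> + norm y)" using \<kappa> by (intro mult_left_mono) auto
          then have "exp (- (Im \<kappa> / 2) * norm y) \<le> exp (Im \<kappa> / 2 * \<rho>) * exp (- (Im \<kappa> / 2) * norm x)"
            unfolding exp_add[symmetric] by (simp add: algebra_simps)
          then have "B * (eps n)\<^sup>2 / srad (eps n) y ^ 5 * exp (- (Im \<kappa> / 2) * norm y)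
              \<le> B * (eps n)\<^sup>2 / srad (eps n) y ^ 5 * (exp (Im \<kappa> / 2 * \<rho>) * exp (- (Im \<kappa> / 2) * norm x))"
            using B(1) r by (intro mult_left_mono) auto
          from order_trans[OF B(2)[OF eps_pos] this] True show ?thesis
            by (simp add: v_def mult_ac)
        qed
      qed
      also have "\<dots> = B * exp (Im \<kappa> / 2 * \<rho>) * exp (- (Im \<kappa> / 2) * norm x) * J"
        unfolding integral_mult_right_zero integral_scaled_power5(1)[OF eps_pos] J_def ..
      finally have "norm (w n x) \<le> \<bar>B * exp (Im \<kappa> / 2 * \<rho>) * J\<bar> * exp (- (Im \<kappa> / 2) * norm x)"
        by (rule order_trans) (simp add: abs_mult mult_ac mult_left_mono B(1))
      then have "norm (w n x) * norm (h x) \<le> \<bar>B * exp (Im \<kappa> / 2 * \<rho>) * J\<bar> * exp (- (Im \<kappa> / 2) * norm x) * norm (h x)"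
        by (rule mult_right_mono) simp
      then show "norm (w n x * h x) \<le> norm (of_real (B * exp (Im \<kappa> / 2 * \<rho>) * J) * (of_real (exp (- (Im \<kappa> / 2) * norm x)) * h x))"
        unfolding norm_mult norm_of_real by (simp only: abs_exp_cancel mult.assoc)
    qed
  qed measurable
  then have "(\<integral>x. of_real smoothed_delta_mass * v x * h x \<partial>lborel) = 0"
    by (simp add: w0 LIMSEQ_const_iff)
  then have "of_real smoothed_delta_mass * (\<integral>x. v x * h x \<partial>lborel) = 0"
    by (simp only: mult.assoc integral_mult_right_zero)
  then show "(\<integral>x. indicator (box a b) x * h x \<partial>lborel) = 0"
    using smoothed_delta_mass_nonzero by (simp add: v_def)
qed

section \<open>From vector-valued to scalar functions\<close>

lemma norm_vec_power2: "(norm (v :: complex^'n))\<^sup>2 = (\<Sum>s\<in>UNIV. (norm (v $ s))\<^sup>2)"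
  by (simp add: norm_vec_def L2_set_def sum_nonneg)

lemma measurable_axis: "(\<lambda>c::complex. axis s c :: complex^'n) \<in> borel_measurable borel"
proof -
  have "continuous_on UNIV (\<lambda>c::complex. (\<chi> i. if i = s then c else 0) :: complex^'n)"
  proof (intro continuous_on_vec_lambda)
    fix i show "continuous_on UNIV (\<lambda>c::complex. if i = s then c else 0)" by (cases "i = s") auto
  qed
  then show ?thesis unfolding axis_def by (rule borel_measurable_continuous_onI)
qed

lemma vec_eq_sum_axis: "(v :: complex^'n) = (\<Sum>s\<in>UNIV. axis s (v $ s))"
  by (simp add: vec_eq_iff axis_def)

lemma square_integrable_iff_components:
  fixes F :: "real^3 \<Rightarrow> complex^'n"
  shows "square_integrable F \<longleftrightarrow> (\<forall>s. L2 (\<lambda>x. F x $ s))"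
proof
  assume F: "square_integrable F"
  show "\<forall>s. L2 (\<lambda>x. F x $ s)"
  proof
    fix s
    have "(\<lambda>v::complex^'n. v $ s) \<in> borel_measurable borel"
      by (intro borel_measurable_continuous_onI continuous_intros)
    then have m: "(\<lambda>x. F x $ s) \<in> borel_measurable lborel"
      using F measurable_compose unfolding square_integrable_def by blast
    have "integrable lborel (\<lambda>x. (norm (F x $ s))\<^sup>2)"
    proof (rule Bochner_Integration.integrable_bound)
      show "integrable lborel (\<lambda>x. (norm (F x))\<^sup>2)" using F by (simp add: square_integrable_def)
      show "AE x in lborel. norm ((norm (F x $ s))\<^sup>2) \<le> norm ((norm (F x))\<^sup>2)"
        by (simp add: power_mono Finite_Cartesian_Product.norm_nth_le)
    qed (use m in measurable)
    with m show "L2 (\<lambda>x. F x $ s)" by (simp add: L2_def)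
  qed
next
  assume *: "\<forall>s. L2 (\<lambda>x. F x $ s)"
  have "(\<lambda>x. axis s (F x $ s) :: complex^'n) \<in> borel_measurable lborel" for s
    using * measurable_compose[OF _ measurable_axis] unfolding L2_def by blast
  then have "(\<lambda>x. \<Sum>s\<in>UNIV. axis s (F x $ s)) \<in> borel_measurable lborel"
    by (intro borel_measurable_sum)
  then have "F \<in> borel_measurable lborel" unfolding vec_eq_sum_axis[symmetric] .
  moreover have "integrable lborel (\<lambda>x. (norm (F x))\<^sup>2)"
    unfolding norm_vec_power2 using * by (intro Bochner_Integration.integrable_sum) (simp add: L2_def)
  ultimately show "square_integrable F" by (simp add: square_integrable_def)
qed

lemma square_integrable_component: "square_integrable F \<Longrightarrow> L2 (\<lambda>x. F x $ s)"
  by (simp add: square_integrable_iff_components)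

lemma abs_l2_eq_iff:
  assumes "square_integrable F" "square_integrable G"
  shows "abs_l2 F = abs_l2 G \<longleftrightarrow> (AE x in lborel. F x = G x)"
  using Quotient_rel[OF Quotient_l2, of F G] assms by (simp add: l2_rel_def)

lemma represents_exists: "\<exists>F. represents F f"
  using Quotient_abs_rep[OF Quotient_l2, of f] Quotient_rep_reflp[OF Quotient_l2, of f]
  by (auto simp: represents_def l2_rel_def)

lemma represents_abs: "square_integrable F \<Longrightarrow> represents F (abs_l2 F)"
  by (simp add: represents_def)

lemma l2_rel_refl: "square_integrable F \<Longrightarrow> l2_rel F F"
  by (simp add: l2_rel_def)

lemma l2_inner_represents:
  assumes "represents F f" "represents G g"
  shows "l2_inner f g = (\<integral>x. (\<Sum>s\<in>UNIV. F x $ s * cnj (G x $ s)) \<partial>lborel)"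
  using assms l2_inner.abs_eq[of F G] by (auto simp: represents_def l2_rel_refl)

lemma represents_scale:
  assumes "represents F f"
  shows "represents (\<lambda>x. c *s F x) (l2_scale c f)"
  using assms l2_scale.abs_eq[of F c] by (auto simp: represents_def l2_rel_refl square_integrable_scale)

lemma l2_inner_components:
  assumes "represents F f" "represents G g"
  shows "l2_inner f g = (\<Sum>s\<in>UNIV. \<integral>x. F x $ s * cnj (G x $ s) \<partial>lborel)"
  unfolding l2_inner_represents[OF assms]
  using assms by (intro Bochner_Integration.integral_sum L2_mult_integrable L2_cnj square_integrable_component)
     (auto simp: represents_def)

lemma integrable_test_scaleR:
  fixes F :: "real^3 \<Rightarrow> complex^'n"
  assumes \<phi>: "test_function \<phi>" and F: "square_integrable F"
  shows "integrable lborel (\<lambda>x. \<phi> x *\<^sub>R F x)"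
proof (rule Bochner_Integration.integrable_bound)
  have m: "\<phi> \<in> borel_measurable lborel"
    using \<phi> smooth_measurable by (auto simp: test_function_altdef)
  show "integrable lborel (\<lambda>x. (norm (complex_of_real (\<phi> x)))\<^sup>2 + (norm (F x))\<^sup>2)"
    using F L2_test_function[OF \<phi>] by (intro Bochner_Integration.integrable_add) (auto simp: L2_def square_integrable_def)
  show "(\<lambda>x. \<phi> x *\<^sub>R F x) \<in> borel_measurable lborel"
    using F m by (intro borel_measurable_scaleR) (auto simp: square_integrable_def)
  show "AE x in lborel. norm (\<phi> x *\<^sub>R F x) \<le> norm ((norm (complex_of_real (\<phi> x)))\<^sup>2 + (norm (F x))\<^sup>2)"
    using mult_le_sum_squares[of "\<bar>\<phi> x\<bar>" "norm (F x)" for x] by simp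
qed

lemma weak_deriv_component:
  fixes F :: "real^3 \<Rightarrow> complex^'n"
  assumes "weak_deriv is F G" "square_integrable F" "square_integrable G" "test_function \<phi>"
  shows "(\<integral>x. of_real (iter_partial is \<phi> x) * F x $ s \<partial>lborel)
    = (- 1) ^ length is * (\<integral>x. of_real (\<phi> x) * G x $ s \<partial>lborel)"
proof -
  have comp: "(\<integral>x. of_real (\<psi> x) * H x $ s \<partial>lborel) = (\<integral>x. \<psi> x *\<^sub>R H x \<partial>lborel) $ s"
    if "test_function \<psi>" "square_integrable H" for \<psi> and H :: "real^3 \<Rightarrow> complex^'n"
    using integral_bounded_linear[OF bounded_linear_vec_nth integrable_test_scaleR[OF that], of s]
    by (simp add: scaleR_conv_of_real[where 'a=complex])
  have "(\<integral>x. iter_partial is \<phi> x *\<^sub>R F x \<partial>lborel) = (- 1) ^ length is *\<^sub>R (\<integral>x. \<phi> x *\<^sub>R G x \<partial>lborel)"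
    using assms by (simp add: weak_deriv_def)
  then show ?thesis
    using comp[OF test_function_iter_partial[OF assms(4)] assms(2), of "is"] comp[OF assms(4,3)]
    by (simp add: scaleR_conv_of_real[where 'a=complex])
qed

lemma weak_laplacian_component:
  fixes F :: "real^3 \<Rightarrow> complex^'n"
  assumes F: "square_integrable F" and D: "\<And>i. square_integrable (D i)" "\<And>i. weak_deriv [i, i] F (D i)"
  shows "weak_laplacian (\<lambda>x. F x $ s) (\<lambda>x. \<Sum>i\<in>UNIV. D i x $ s)"
  unfolding weak_laplacian_def
proof (intro allI impI)
  fix \<phi> assume \<phi>: "test_function \<phi>"
  have i: "integrable lborel (\<lambda>x. of_real (iter_partial [i,i] \<phi> x) * F x $ s)"
    "integrable lborel (\<lambda>x. of_real (\<phi> x) * D i x $ s)" for i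
    by (intro L2_mult_integrable L2_test_function test_function_iter_partial \<phi> square_integrable_component F D)+
  have "(\<integral>x. of_real (laplacian \<phi> x) * F x $ s \<partial>lborel)
      = (\<integral>x. (\<Sum>i\<in>UNIV. of_real (iter_partial [i,i] \<phi> x) * F x $ s) \<partial>lborel)"
    by (simp add: laplacian_def iter_partial_Cons sum_distrib_right)
  also have "\<dots> = (\<Sum>i\<in>UNIV. \<integral>x. of_real (iter_partial [i,i] \<phi> x) * F x $ s \<partial>lborel)"
    by (intro Bochner_Integration.integral_sum i)
  also have "\<dots> = (\<Sum>i\<in>UNIV. \<integral>x. of_real (\<phi> x) * D i x $ s \<partial>lborel)"
    using weak_deriv_component[OF D(2) F D(1) \<phi>, where s=s] by simp
  also have "\<dots> = (\<integral>x. (\<Sum>i\<in>UNIV. of_real (\<phi> x) * D i x $ s) \<partial>lborel)"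
    by (intro Bochner_Integration.integral_sum[symmetric] i)
  finally show "(\<integral>x. of_real (laplacian \<phi> x) * F x $ s \<partial>lborel) = (\<integral>x. of_real (\<phi> x) * (\<Sum>i\<in>UNIV. D i x $ s) \<partial>lborel)"
    by (simp add: sum_distrib_left)
qed

lemma square_integrable_axis_test:
  assumes "test_function \<phi>"
  shows "square_integrable (\<lambda>x. axis s (complex_of_real (\<phi> x)) :: complex^'n)"
  unfolding square_integrable_iff_components
proof
  fix t show "L2 (\<lambda>x. axis s (complex_of_real (\<phi> x)) $ t)"
    by (cases "t = s") (simp_all add: axis_def L2_0 L2_test_function[OF assms])
qed

lemma weak_deriv_axis_test:
  assumes \<phi>: "test_function \<phi>"
  shows "weak_deriv is (\<lambda>x. axis s (of_real (\<phi> x)) :: complex^'n) (\<lambda>x. axis s (of_real (iter_partial (rev is) \<phi> x)))"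
  unfolding weak_deriv_def
proof (intro allI impI)
  fix \<psi> assume \<psi>: "test_function \<psi>"
  have T: "bounded_linear (\<lambda>t. axis s (complex_of_real t) :: complex^'n)"
    by (intro linear_conv_bounded_linear[THEN iffD1] linearI)
       (auto simp: vec_eq_iff axis_def scaleR_conv_of_real[where 'a=complex])
  have int: "(\<integral>x. f x *\<^sub>R (axis s (complex_of_real (g x)) :: complex^'n) \<partial>lborel) = axis s (of_real (\<integral>x. f x * g x \<partial>lborel))"
    if "test_function f" "test_function g" for f g
  proof -
    have "integrable lborel (\<lambda>x. f x * g x)"
      using that by (intro test_function_integrable test_function_mult) (auto simp: test_function_altdef)
    from integral_bounded_linear[OF T this]
    have "(\<integral>x. (axis s (complex_of_real (f x * g x)) :: complex^'n) \<partial>lborel) = axis s (of_real (\<integral>x. f x * g x \<partial>lborel))" .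
    moreover have "f x *\<^sub>R (axis s (complex_of_real (g x)) :: complex^'n) = axis s (complex_of_real (f x * g x))" for x
      by (auto simp: vec_eq_iff axis_def scaleR_conv_of_real[where 'a=complex])
    ultimately show ?thesis by simp
  qed
  have "(\<integral>x. iter_partial is \<psi> x *\<^sub>R (axis s (complex_of_real (\<phi> x)) :: complex^'n) \<partial>lborel)
      = axis s (of_real ((- 1) ^ length is * (\<integral>x. \<psi> x * iter_partial (rev is) \<phi> x \<partial>lborel)))"
    unfolding int[OF test_function_iter_partial[OF \<psi>] \<phi>] integral_by_parts[OF \<psi> \<phi>] ..
  also have "\<dots> = (- 1) ^ length is *\<^sub>R axis s (of_real (\<integral>x. \<psi> x * iter_partial (rev is) \<phi> x \<partial>lborel))"
    by (auto simp: vec_eq_iff axis_def scaleR_conv_of_real[where 'a=complex])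
  finally show "(\<integral>x. iter_partial is \<psi> x *\<^sub>R (axis s (complex_of_real (\<phi> x)) :: complex^'n) \<partial>lborel)
     = (- 1) ^ length is *\<^sub>R (\<integral>x. \<psi> x *\<^sub>R axis s (of_real (iter_partial (rev is) \<phi> x)) \<partial>lborel)"
    unfolding int[OF \<psi> test_function_iter_partial[OF \<phi>]] .
qed

text \<open>Test functions in a single component that vanish at the centres are enough elements of the minimal
operator to determine the defect space.\<close>

lemma test_function_in_minimal_op:
  fixes X :: "'m \<Rightarrow> real^3"
  assumes \<phi>: "test_function \<phi>" and zero: "\<And>j. \<phi> (X j) = 0"
  shows "(abs_l2 (\<lambda>x. axis s (of_real (\<phi> x)) :: complex^'n::finite),
          abs_l2 (\<lambda>x. axis s (of_real (- laplacian \<phi> x)))) \<in> minimal_op X"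
proof -
  let ?F = "\<lambda>x. axis s (of_real (\<phi> x)) :: complex^'n"
  let ?D = "\<lambda>i x. axis s (of_real (iter_partial [i, i] \<phi> x)) :: complex^'n"
  have sum: "(\<lambda>x. - (\<Sum>i\<in>UNIV. ?D i x)) = (\<lambda>x. axis s (of_real (- laplacian \<phi> x)))"
    by (auto simp: fun_eq_iff vec_eq_iff axis_def laplacian_def iter_partial_Cons sum_negf)
  have c1: "continuous_on UNIV ?F"
    unfolding axis_def
  proof (intro continuous_on_vec_lambda)
    fix i show "continuous_on UNIV (\<lambda>x. if i = s then complex_of_real (\<phi> x) else 0)"
      by (cases "i = s") (auto intro!: continuous_intros test_function_continuous \<phi>)
  qed
  have c2: "sobolev_W22 ?F"
    unfolding sobolev_W22_def
    using weak_deriv_axis_test[OF \<phi>] square_integrable_axis_test test_function_iter_partial \<phi> by blast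
  have c3: "weak_deriv [i, i] ?F (?D i)" for i
    using weak_deriv_axis_test[OF \<phi>, of "[i, i]"] by simp
  have c4: "represents ?F (abs_l2 ?F)"
    by (intro represents_abs square_integrable_axis_test \<phi>)
  have c5: "represents (\<lambda>x. - (\<Sum>i\<in>UNIV. ?D i x)) (abs_l2 (\<lambda>x. axis s (of_real (- laplacian \<phi> x))))"
    unfolding sum using test_function_cmult[OF test_function_laplacian[OF \<phi>], of "-1"]
    by (intro represents_abs square_integrable_axis_test) simp
  have c6: "?F (X j) = 0" for j using zero by (simp add: vec_eq_iff axis_def)
  have c7: "square_integrable (?D i)" for i
    by (intro square_integrable_axis_test test_function_iter_partial \<phi>)
  show ?thesis
    unfolding minimal_op_def mem_Collect_eq prod.case
    by (intro exI[of _ ?F] exI[of _ ?D] conjI allI c1 c2 c3 c4 c5 c6 c7)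
qed

section \<open>Weak solutions off the centres\<close>

lemma laplacian_add:
  assumes "smooth f" "smooth g"
  shows "laplacian (\<lambda>x. f x + g x) x = laplacian f x + laplacian g x"
proof -
  have "partial i (\<lambda>x. f x + g x) = (\<lambda>x. partial i f x + partial i g x)" if "smooth f" "smooth g" for f g i
    using that by (intro ext partial_add smooth_differentiable)
  with assms smooth_partial show ?thesis by (simp add: laplacian_def sum.distrib)
qed

lemma laplacian_cmult:
  assumes "smooth f"
  shows "laplacian (\<lambda>x. c * f x) x = c * laplacian f x"
proof -
  have "partial i (\<lambda>x. c * f x) = (\<lambda>x. c * partial i f x)" if "smooth f" for f i
    using that by (intro ext partial_cmult smooth_differentiable)
  with assms smooth_partial show ?thesis by (simp add: laplacian_def sum_distrib_left)
qed

lemma laplacian_sum: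
  assumes "finite A" "\<And>j. j \<in> A \<Longrightarrow> smooth (f j)"
  shows "laplacian (\<lambda>x. \<Sum>j\<in>A. f j x) x = (\<Sum>j\<in>A. laplacian (f j) x)"
  using assms
proof (induction A rule: finite_induct)
  case empty
  then show ?case by (simp add: laplacian_def partial_const)
next
  case (insert a A)
  then show ?case by (simp add: laplacian_add smooth_sum)
qed

lemma weak_laplacian_test_function:
  assumes \<phi>: "test_function \<phi>"
  shows "weak_laplacian (\<lambda>x. of_real (\<phi> x)) (\<lambda>x. of_real (laplacian \<phi> x))"
  unfolding weak_laplacian_def
proof (intro allI impI)
  fix \<psi> assume \<psi>: "test_function \<psi>"
  have i: "integrable lborel (\<lambda>x. iter_partial [i,i] \<psi> x * \<phi> x)" "integrable lborel (\<lambda>x. \<psi> x * iter_partial [i,i] \<phi> x)" for i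
    using \<phi> \<psi> smooth_iter_partial by (auto intro!: test_function_integrable test_function_mult test_function_iter_partial simp: test_function_altdef)
  have "(\<integral>x. laplacian \<psi> x * \<phi> x \<partial>lborel) = (\<integral>x. (\<Sum>i\<in>UNIV. iter_partial [i,i] \<psi> x * \<phi> x) \<partial>lborel)"
    by (simp add: laplacian_def iter_partial_Cons sum_distrib_right)
  also have "\<dots> = (\<Sum>i\<in>UNIV. \<integral>x. iter_partial [i,i] \<psi> x * \<phi> x \<partial>lborel)"
    by (intro Bochner_Integration.integral_sum i)
  also have "\<dots> = (\<Sum>i\<in>UNIV. \<integral>x. \<psi> x * iter_partial [i,i] \<phi> x \<partial>lborel)"
    using integral_by_parts[OF \<psi> \<phi>, of "[i,i]" for i] by simp
  also have "\<dots> = (\<integral>x. (\<Sum>i\<in>UNIV. \<psi> x * iter_partial [i,i] \<phi> x) \<partial>lborel)"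
    by (intro Bochner_Integration.integral_sum[symmetric] i)
  also have "\<dots> = (\<integral>x. \<psi> x * laplacian \<phi> x \<partial>lborel)"
    by (simp add: laplacian_def iter_partial_Cons sum_distrib_left)
  finally have "complex_of_real (\<integral>x. laplacian \<psi> x * \<phi> x \<partial>lborel) = complex_of_real (\<integral>x. \<psi> x * laplacian \<phi> x \<partial>lborel)"
    by simp
  then show "(\<integral>x. complex_of_real (laplacian \<psi> x) * of_real (\<phi> x) \<partial>lborel) = (\<integral>x. complex_of_real (\<psi> x) * of_real (laplacian \<phi> x) \<partial>lborel)"
    by (simp only: integral_complex_of_real[symmetric] of_real_mult)
qed

lemma dual_bumps_exist:
  fixes X :: "'m::finite \<Rightarrow> real^3"
  assumes "inj X"
  shows "\<exists>b. (\<forall>j. test_function (b j)) \<and> (\<forall>j k. b j (X k) = (if j = k then 1 else 0))"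
proof -
  have "\<exists>f. test_function f \<and> (\<forall>k. f (X k) = (if j = k then 1 else 0))" for j
  proof -
    obtain d where d: "d > 0" "\<And>x. x \<in> range X \<Longrightarrow> x \<noteq> X j \<Longrightarrow> d \<le> dist (X j) x"
      using finite_set_avoid[of "range X" "X j"] by auto
    define f where "f x = 1 / bump 0 * bump ((1 / d) *\<^sub>R (x - X j))" for x
    have "test_function f"
      unfolding f_def using d(1) by (intro test_function_cmult test_function_affine test_function_bump) simp
    moreover have "f (X k) = (if j = k then 1 else 0)" for k
    proof (cases "j = k")
      case True
      then show ?thesis using bump_0 by (simp add: f_def)
    next
      case False
      then have "X k \<noteq> X j" using assms by (metis injD)
      then have "d \<le> norm (X k - X j)" using d(2)[of "X k"] by (simp add: dist_norm norm_minus_commute)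
      then have "1 \<le> norm ((1 / d) *\<^sub>R (X k - X j))" unfolding norm_scaleR using d(1) by simp
      from bump_eq_0[OF this] show ?thesis unfolding f_def using False by simp
    qed
    ultimately show ?thesis by blast
  qed
  then show ?thesis by metis
qed

lemma L2_green_point: 
  assumes "Im \<kappa> > 0"
  shows "L2 (\<lambda>x. green \<kappa> (norm (x - a)))"
  using L2_translate[OF L2_green_norm[OF assms], of "- a"] by simp

text \<open>The functional \<open>A\<close> sends \<open>\<phi>\<close> to the pairing of \<open>(-\<Delta> - k\<^sup>2) \<phi>\<close> with \<open>f\<close>. It vanishes if \<open>\<phi>\<close> vanishes
at all centres, so by linearity it depends only on the finitely many values \<open>\<phi> (X j)\<close>. By the representation
formula the fundamental solutions induce these evaluations up to a constant. A suitable combination of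
them induces the same functional as \<open>f\<close>, and the difference solves the Helmholtz equation weakly on
the whole space.\<close>

lemma weak_solution_off_points:
  fixes X :: "'m::finite \<Rightarrow> real^3"
  assumes "inj X" and f: "L2 f" and k: "Im k > 0"
    and sol: "\<And>\<phi>. test_function \<phi> \<Longrightarrow> (\<And>j. \<phi> (X j) = 0) \<Longrightarrow>
      (\<integral>x. of_real (laplacian \<phi> x) * f x \<partial>lborel) = - k\<^sup>2 * (\<integral>x. of_real (\<phi> x) * f x \<partial>lborel)"
  shows "\<exists>\<eta>. AE x in lborel. f x = (\<Sum>j\<in>UNIV. green k (norm (x - X j)) * \<eta> j)"
proof -
  obtain b where b: "\<And>j. test_function (b j)" "\<And>j l. b j (X l) = (if j = l then 1 else 0)"
    using dual_bumps_exist[OF assms(1)] by blast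
  define A where "A g \<phi> = - (\<integral>x. of_real (laplacian \<phi> x) * g x \<partial>lborel) - k\<^sup>2 * (\<integral>x. of_real (\<phi> x) * g x \<partial>lborel)"
    for g :: "real^3 \<Rightarrow> complex" and \<phi>
  have iA: "integrable lborel (\<lambda>x. of_real (laplacian \<phi> x) * g x)" "integrable lborel (\<lambda>x. of_real (\<phi> x) * g x)"
    if "test_function \<phi>" "L2 g" for \<phi> g
    using that by (auto intro!: L2_mult_integrable L2_test_function test_function_laplacian)
  have A_lin: "A f (\<lambda>x. \<phi> x + (\<Sum>j\<in>UNIV. - c j * b j x)) = A f \<phi> - (\<Sum>j\<in>UNIV. of_real (c j) * A f (b j))"
    if \<phi>: "test_function \<phi>" for \<phi> c
  proof -
    have s: "smooth \<phi>" "smooth (b j)" for j using \<phi> b(1) by (auto simp: test_function_altdef)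
    have lap: "laplacian (\<lambda>x. \<phi> x + (\<Sum>j\<in>UNIV. - c j * b j x)) x = laplacian \<phi> x + (\<Sum>j\<in>UNIV. - c j * laplacian (b j) x)" for x
    proof -
      have "laplacian (\<lambda>x. \<phi> x + (\<Sum>j\<in>UNIV. - c j * b j x)) x = laplacian \<phi> x + laplacian (\<lambda>x. \<Sum>j\<in>UNIV. - c j * b j x) x"
        by (intro laplacian_add smooth_sum smooth_mult smooth_const s)
      also have "laplacian (\<lambda>x. \<Sum>j\<in>UNIV. - c j * b j x) x = (\<Sum>j\<in>UNIV. laplacian (\<lambda>x. - c j * b j x) x)"
        by (intro laplacian_sum smooth_mult smooth_const s) simp
      also have "\<dots> = (\<Sum>j\<in>UNIV. - c j * laplacian (b j) x)"
        by (intro sum.cong refl laplacian_cmult s)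
      finally show ?thesis .
    qed
    have gen: "(\<integral>x. of_real (u x + (\<Sum>j\<in>UNIV. - c j * v j x)) * f x \<partial>lborel)
        = (\<integral>x. of_real (u x) * f x \<partial>lborel) - (\<Sum>j\<in>UNIV. of_real (c j) * (\<integral>x. of_real (v j x) * f x \<partial>lborel))"
      if i: "integrable lborel (\<lambda>x. of_real (u x) * f x)" "\<And>j. integrable lborel (\<lambda>x. of_real (v j x) * f x)"
      for u and v :: "'m \<Rightarrow> real^3 \<Rightarrow> real"
    proof -
      have "(\<integral>x. of_real (u x + (\<Sum>j\<in>UNIV. - c j * v j x)) * f x \<partial>lborel)
          = (\<integral>x. of_real (u x) * f x + (\<Sum>j\<in>UNIV. - of_real (c j) * (of_real (v j x) * f x)) \<partial>lborel)"
        by (intro Bochner_Integration.integral_cong) (simp_all add: distrib_right sum_distrib_right mult.assoc sum_negf left_diff_distrib)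
      also have "\<dots> = (\<integral>x. of_real (u x) * f x \<partial>lborel) + (\<Sum>j\<in>UNIV. \<integral>x. - of_real (c j) * (of_real (v j x) * f x) \<partial>lborel)"
        by (subst Bochner_Integration.integral_add, rule i(1), rule Bochner_Integration.integrable_sum,
            rule integrable_mult_right, rule i(2), subst Bochner_Integration.integral_sum,
            rule integrable_mult_right, rule i(2), rule refl)
      also have "\<dots> = (\<integral>x. of_real (u x) * f x \<partial>lborel) - (\<Sum>j\<in>UNIV. of_real (c j) * (\<integral>x. of_real (v j x) * f x \<partial>lborel))"
        unfolding integral_mult_right_zero by (simp add: sum_negf)
      finally show ?thesis .
    qed
    show ?thesis
      unfolding A_def lap gen[OF iA(1)[OF \<phi> f] iA(1)[OF b(1) f]] gen[OF iA(2)[OF \<phi> f] iA(2)[OF b(1) f]]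
      by (simp add: algebra_simps sum.distrib sum_distrib_left sum_subtractf sum_negf)
  qed
  have A_f: "A f \<phi> = (\<Sum>j\<in>UNIV. of_real (\<phi> (X j)) * A f (b j))" if \<phi>: "test_function \<phi>" for \<phi>
  proof -
    let ?\<psi> = "\<lambda>x. \<phi> x + (\<Sum>j\<in>UNIV. - \<phi> (X j) * b j x)"
    have "test_function ?\<psi>"
      by (intro test_function_add test_function_sum test_function_cmult \<phi> b)
    moreover have "?\<psi> (X l) = 0" for l
      by (simp add: b(2) if_distrib[of "\<lambda>t. _ * t"] sum.delta cong: if_cong)
    ultimately have "A f ?\<psi> = 0" unfolding A_def by (simp add: sol)
    with A_lin[OF \<phi>, of "\<lambda>j. \<phi> (X j)"] show ?thesis by simp
  qed
  \<comment> \<open>These charges make the combination of fundamental solutions induce the functional \<open>A f\<close>.\<close>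
  define \<eta> where "\<eta> j = A f (b j) / of_real smoothed_delta_mass" for j
  let ?Y = "\<lambda>j x. green k (norm (x - X j))"
  have A_Y: "A (?Y j) \<phi> = of_real smoothed_delta_mass * of_real (\<phi> (X j))" if \<phi>: "test_function \<phi>" for \<phi> j
  proof -
    have c: "isCont (\<lambda>x. complex_of_real (\<phi> x)) (X j)"
      using test_function_continuous[OF \<phi>, of UNIV] by (auto simp: continuous_on_eq_continuous_at intro!: continuous_intros)
    have "of_real smoothed_delta_mass * of_real (\<phi> (X j)) = (\<integral>x. ?Y j x * (- of_real (laplacian \<phi> x) - k\<^sup>2 * of_real (\<phi> x)) \<partial>lborel)"
      by (rule representation_formula[OF weak_laplacian_test_function[OF \<phi>] L2_test_function[OF \<phi>]
            L2_test_function[OF test_function_laplacian[OF \<phi>]] k c])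
    also have "\<dots> = (\<integral>x. - 1 * (of_real (laplacian \<phi> x) * ?Y j x) - k\<^sup>2 * (of_real (\<phi> x) * ?Y j x) \<partial>lborel)"
      by (intro Bochner_Integration.integral_cong) (auto simp: algebra_simps)
    also have "\<dots> = A (?Y j) \<phi>"
      unfolding A_def
      by (subst Bochner_Integration.integral_diff[OF integrable_mult_right[OF iA(1)[OF \<phi> L2_green_point[OF k]]]
            integrable_mult_right[OF iA(2)[OF \<phi> L2_green_point[OF k]]]]) simp
    finally show ?thesis ..
  qed
  define h where "h x = f x - (\<Sum>j\<in>UNIV. \<eta> j * ?Y j x)" for x
  have h: "L2 h" unfolding h_def by (intro L2_diff f L2_sum L2_cmult L2_green_point k)
  have gen: "(\<integral>x. of_real (u x) * h x \<partial>lborel)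
      = (\<integral>x. of_real (u x) * f x \<partial>lborel) - (\<Sum>j\<in>UNIV. \<eta> j * (\<integral>x. of_real (u x) * ?Y j x \<partial>lborel))"
    if i: "integrable lborel (\<lambda>x. complex_of_real (u x) * f x)" "\<And>j. integrable lborel (\<lambda>x. of_real (u x) * ?Y j x)" for u
  proof -
    have "(\<integral>x. of_real (u x) * h x \<partial>lborel)
        = (\<integral>x. of_real (u x) * f x - (\<Sum>j\<in>UNIV. \<eta> j * (of_real (u x) * ?Y j x)) \<partial>lborel)"
      by (intro Bochner_Integration.integral_cong)
         (auto simp: h_def right_diff_distrib sum_distrib_left mult.left_commute)
    also have "\<dots> = (\<integral>x. of_real (u x) * f x \<partial>lborel) - (\<Sum>j\<in>UNIV. \<integral>x. \<eta> j * (of_real (u x) * ?Y j x) \<partial>lborel)"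
      by (subst Bochner_Integration.integral_diff, rule i(1), rule Bochner_Integration.integrable_sum,
          rule integrable_mult_right, rule i(2), subst Bochner_Integration.integral_sum,
          rule integrable_mult_right, rule i(2), rule refl)
    finally show ?thesis unfolding integral_mult_right_zero .
  qed
  have A_h: "A h \<phi> = 0" if \<phi>: "test_function \<phi>" for \<phi>
  proof -
    have "A h \<phi> = A f \<phi> - (\<Sum>j\<in>UNIV. \<eta> j * A (?Y j) \<phi>)"
      unfolding A_def gen[OF iA(1)[OF \<phi> f] iA(1)[OF \<phi> L2_green_point[OF k]]]
        gen[OF iA(2)[OF \<phi> f] iA(2)[OF \<phi> L2_green_point[OF k]]]
      by (simp add: algebra_simps sum.distrib sum_distrib_left sum_subtractf sum_negf)
    also have "\<dots> = 0"
      unfolding A_f[OF \<phi>] A_Y[OF \<phi>] \<eta>_def using smoothed_delta_mass_nonzero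
      by (simp add: mult.commute)
    finally show ?thesis .
  qed
  have "weak_laplacian h (\<lambda>x. - k\<^sup>2 * h x)"
    unfolding weak_laplacian_def
  proof (intro allI impI)
    fix \<phi> assume \<phi>: "test_function \<phi>"
    have "(\<integral>x. of_real (\<phi> x) * (- k\<^sup>2 * h x) \<partial>lborel) = (\<integral>x. - k\<^sup>2 * (of_real (\<phi> x) * h x) \<partial>lborel)"
      by (intro Bochner_Integration.integral_cong) (auto simp: algebra_simps)
    also have "\<dots> = - k\<^sup>2 * (\<integral>x. of_real (\<phi> x) * h x \<partial>lborel)" by (rule integral_mult_right_zero)
    also have "\<dots> = (\<integral>x. of_real (laplacian \<phi> x) * h x \<partial>lborel)"
    proof -
      have "- k\<^sup>2 * q = p" if "- p - k\<^sup>2 * q = 0" for p q :: complex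
        using that by algebra
      from this[OF A_h[OF \<phi>, unfolded A_def]] show ?thesis .
    qed
    finally show "(\<integral>x. of_real (laplacian \<phi> x) * h x \<partial>lborel) = (\<integral>x. of_real (\<phi> x) * (- k\<^sup>2 * h x) \<partial>lborel)" ..
  qed
  from helmholtz_equation_trivial[OF this h k]
  have "AE x in lborel. f x = (\<Sum>j\<in>UNIV. ?Y j x * \<eta> j)"
    by eventually_elim (simp add: h_def mult.commute)
  then show ?thesis by blast
qed

section \<open>The defect space\<close>

text \<open>The superposition of fundamental solutions with charges \<open>\<xi>\<close>; these functions turn out to be the
values of the \<open>\<gamma>\<close>-field.\<close>

definition point_sources :: "('m::finite \<Rightarrow> real^3) \<Rightarrow> complex \<Rightarrow> complex^'n^'m \<Rightarrow> real^3 \<Rightarrow> complex^'n" where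
  "point_sources X k \<xi> x = (\<Sum>j\<in>UNIV. green k (norm (x - X j)) *s \<xi> $ j)"

lemma point_sources_component:
  "point_sources X k \<xi> x $ s = (\<Sum>j\<in>UNIV. green k (norm (x - X j)) * \<xi> $ j $ s)"
  by (simp add: point_sources_def)

lemma square_integrable_point_sources:
  assumes "Im k > 0"
  shows "square_integrable (point_sources X k \<xi> :: real^3 \<Rightarrow> complex^'n)"
  unfolding square_integrable_iff_components point_sources_component
proof
  fix s
  have "L2 (\<lambda>x. \<Sum>j\<in>UNIV. \<xi> $ j $ s * green k (norm (x - X j)))"
    by (intro L2_sum L2_cmult L2_green_point assms)
  then show "L2 (\<lambda>x. \<Sum>j\<in>UNIV. green k (norm (x - X j)) * \<xi> $ j $ s)" by (simp add: mult.commute)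
qed

lemma cnj_green: "cnj (green k s) = green (- cnj k) s"
  by (simp add: green_def exp_cnj)

text \<open>The inner product conjugates the second argument, which turns the fundamental solution for \<open>k\<close> into the one
for \<open>\<kappa> = - cnj k\<close>; it decays too, and \<open>\<kappa>\<^sup>2 = cnj (k\<^sup>2)\<close>. The representation formula then yields
values at the centres, which vanish on the domain of the minimal operator.\<close>

lemma point_sources_in_defect_space:
  fixes X :: "'m::finite \<Rightarrow> real^3" and \<xi> :: "complex^'n::finite^'m"
  assumes k: "Im k > 0"
  shows "abs_l2 (point_sources X k \<xi>) \<in> defect_space X (k\<^sup>2)"
proof -
  let ?g = "point_sources X k \<xi>"
  have rg: "represents ?g (abs_l2 ?g)"
    by (intro represents_abs square_integrable_point_sources k)
  have "l2_inner v (abs_l2 ?g) = l2_inner u (l2_scale (k\<^sup>2) (abs_l2 ?g))"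
    if uv: "(u, v) \<in> minimal_op X" for u v :: "'n l2"
  proof -
    from uv obtain F D where F: "represents F u" "continuous_on UNIV F" "\<And>j. F (X j) = 0"
      and D: "\<And>i. square_integrable (D i)" "\<And>i. weak_deriv [i, i] F (D i)"
      and v: "represents (\<lambda>x. - (\<Sum>i\<in>UNIV. D i x)) v"
      unfolding minimal_op_def by blast
    define \<kappa> where "\<kappa> = - cnj k"
    have \<kappa>: "Im \<kappa> > 0" "\<kappa>\<^sup>2 = cnj (k\<^sup>2)" using k by (simp_all add: \<kappa>_def)
    have sF: "square_integrable F" using F(1) by (simp add: represents_def)
    have comp: "(\<integral>x. (- (\<Sum>i\<in>UNIV. D i x)) $ s * cnj (?g x $ s) \<partial>lborel)
        = (\<integral>x. F x $ s * cnj ((k\<^sup>2 *s ?g x) $ s) \<partial>lborel)" for s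
    proof -
      let ?f = "\<lambda>x. F x $ s"
      let ?L = "\<lambda>x. \<Sum>i\<in>UNIV. D i x $ s"
      have L: "L2 ?L" by (intro L2_sum square_integrable_component D)
      have f: "L2 ?f" by (intro square_integrable_component sF)
      have wl: "weak_laplacian ?f ?L" by (rule weak_laplacian_component[OF sF D])
      have "isCont F a" for a using F(2) by (simp add: continuous_on_eq_continuous_at)
      then have c: "isCont ?f a" for a by (intro continuous_intros)
      have zero: "(\<integral>x. green \<kappa> (norm (x - X j)) * (- ?L x - \<kappa>\<^sup>2 * ?f x) \<partial>lborel) = 0" for j
        using representation_formula[OF wl f L \<kappa>(1) c, of "X j"] F(3) by simp
      have R: "L2 (\<lambda>x. - ?L x - \<kappa>\<^sup>2 * ?f x)" by (intro L2_diff L2_uminus L2_cmult L f)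
      have g_cnj: "cnj (?g x $ s) = (\<Sum>j\<in>UNIV. cnj (\<xi> $ j $ s) * green \<kappa> (norm (x - X j)))" for x
        by (simp add: point_sources_component cnj_green \<kappa>_def mult.commute)
      have gL: "L2 (\<lambda>x. cnj (?g x $ s))"
        by (intro L2_cnj square_integrable_component square_integrable_point_sources k)
      have "(\<integral>x. (- ?L x - \<kappa>\<^sup>2 * ?f x) * cnj (?g x $ s) \<partial>lborel)
          = (\<integral>x. (\<Sum>j\<in>UNIV. cnj (\<xi> $ j $ s) * (green \<kappa> (norm (x - X j)) * (- ?L x - \<kappa>\<^sup>2 * ?f x))) \<partial>lborel)"
        unfolding g_cnj sum_distrib_left
        by (intro Bochner_Integration.integral_cong refl sum.cong) (simp only: mult_ac)
      also have "\<dots> = (\<Sum>j\<in>UNIV. \<integral>x. cnj (\<xi> $ j $ s) * (green \<kappa> (norm (x - X j)) * (- ?L x - \<kappa>\<^sup>2 * ?f x)) \<partial>lborel)"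
        by (intro Bochner_Integration.integral_sum integrable_mult_right L2_mult_integrable L2_green_point \<kappa>(1) R)
      also have "\<dots> = 0" unfolding integral_mult_right_zero zero by simp
      finally have "(\<integral>x. - ?L x * cnj (?g x $ s) - \<kappa>\<^sup>2 * (?f x * cnj (?g x $ s)) \<partial>lborel) = 0"
        by (simp add: left_diff_distrib mult.assoc)
      moreover have "integrable lborel (\<lambda>x. - ?L x * cnj (?g x $ s))"
        by (intro L2_mult_integrable L2_uminus L gL)
      moreover have "integrable lborel (\<lambda>x. \<kappa>\<^sup>2 * (?f x * cnj (?g x $ s)))"
        by (intro integrable_mult_right L2_mult_integrable f gL)
      ultimately have "(\<integral>x. - ?L x * cnj (?g x $ s) \<partial>lborel) = (\<integral>x. \<kappa>\<^sup>2 * (?f x * cnj (?g x $ s)) \<partial>lborel)"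
        by (simp only: Bochner_Integration.integral_diff right_minus_eq)
      moreover have "(\<integral>x. \<kappa>\<^sup>2 * (?f x * cnj (?g x $ s)) \<partial>lborel) = (\<integral>x. F x $ s * cnj ((k\<^sup>2 *s ?g x) $ s) \<partial>lborel)"
        by (intro Bochner_Integration.integral_cong) (auto simp: \<kappa>(2) mult_ac)
      ultimately show ?thesis by simp
    qed
    show ?thesis
      unfolding l2_inner_components[OF v rg] l2_inner_components[OF F(1) represents_scale[OF rg]] comp ..
  qed
  then show ?thesis unfolding defect_space_def adjoint_op_def by auto
qed

text \<open>Pairing with one-component test functions that vanish at the centres shows that each component of \<open>f\<close>
is a weak solution off the centres.\<close>

lemma defect_space_point_sources:
  fixes X :: "'m::finite \<Rightarrow> real^3" and f :: "'n::finite l2"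
  assumes "inj X" and k: "Im k > 0" and f: "f \<in> defect_space X (k\<^sup>2)"
  shows "\<exists>\<xi>. f = abs_l2 (point_sources X k \<xi>)"
proof -
  have neg: "p = - q" if "- p = q" for p q :: complex using that by auto
  obtain F where F: "represents F f" using represents_exists by blast
  then have sF: "square_integrable F" by (simp add: represents_def)
  have "\<exists>\<eta>. AE x in lborel. F x $ s = (\<Sum>j\<in>UNIV. green k (norm (x - X j)) * \<eta> j)" for s
  proof (rule weak_solution_off_points[OF assms(1) square_integrable_component[OF sF] k])
    fix \<phi> assume \<phi>: "test_function \<phi>" "\<And>j. \<phi> (X j) = 0"
    let ?u = "\<lambda>x. axis s (of_real (\<phi> x)) :: complex^'n"
    let ?v = "\<lambda>x. axis s (of_real (- laplacian \<phi> x)) :: complex^'n"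
    have ru: "represents ?u (abs_l2 ?u)"
      by (intro represents_abs square_integrable_axis_test \<phi>)
    have rv: "represents ?v (abs_l2 ?v)"
      using test_function_cmult[OF test_function_laplacian[OF \<phi>(1)], of "-1"]
      by (intro represents_abs square_integrable_axis_test) simp
    have eq: "l2_inner (abs_l2 ?v) f = l2_inner (abs_l2 ?u) (l2_scale (k\<^sup>2) f)"
      using f test_function_in_minimal_op[of \<phi> X s, OF \<phi>]
      unfolding defect_space_def adjoint_op_def by blast
    have axis: "(\<Sum>t\<in>UNIV. (axis s c :: complex^'n) $ t * cnj (w $ t)) = c * cnj (w $ s)" for c and w :: "complex^'n"
      by (simp add: axis_def if_distrib[of "\<lambda>t. t * _"] cong: if_cong)
    have "(\<integral>x. of_real (- laplacian \<phi> x) * cnj (F x $ s) \<partial>lborel)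
        = (\<integral>x. of_real (\<phi> x) * cnj ((k\<^sup>2 *s F x) $ s) \<partial>lborel)"
      using eq unfolding l2_inner_represents[OF rv F] l2_inner_represents[OF ru represents_scale[OF F]] axis .
    note inner_eq = this
    have "(\<integral>x. - (of_real (laplacian \<phi> x) * F x $ s) \<partial>lborel)
        = cnj (\<integral>x. of_real (- laplacian \<phi> x) * cnj (F x $ s) \<partial>lborel)"
      unfolding Bochner_Integration.integral_cnj[symmetric] by (intro Bochner_Integration.integral_cong refl) simp
    also have "\<dots> = cnj (\<integral>x. of_real (\<phi> x) * cnj ((k\<^sup>2 *s F x) $ s) \<partial>lborel)"
      by (simp only: inner_eq)
    also have "\<dots> = (\<integral>x. k\<^sup>2 * (of_real (\<phi> x) * F x $ s) \<partial>lborel)"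
      unfolding Bochner_Integration.integral_cnj[symmetric] by (intro Bochner_Integration.integral_cong refl) simp
    finally have "(\<integral>x. - (of_real (laplacian \<phi> x) * F x $ s) \<partial>lborel) = (\<integral>x. k\<^sup>2 * (of_real (\<phi> x) * F x $ s) \<partial>lborel)" .
    then have "- (\<integral>x. of_real (laplacian \<phi> x) * F x $ s \<partial>lborel) = k\<^sup>2 * (\<integral>x. of_real (\<phi> x) * F x $ s \<partial>lborel)"
      by (simp only: integral_mult_right_zero Bochner_Integration.integral_minus)
    then show "(\<integral>x. of_real (laplacian \<phi> x) * F x $ s \<partial>lborel) = - k\<^sup>2 * (\<integral>x. of_real (\<phi> x) * F x $ s \<partial>lborel)"
      unfolding mult_minus_left by (rule neg)
  qed
  then have "\<forall>s. \<exists>\<eta>. AE x in lborel. F x $ s = (\<Sum>j\<in>UNIV. green k (norm (x - X j)) * \<eta> j)" ..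
  from choice[OF this] obtain \<eta>
    where \<eta>: "\<forall>s. AE x in lborel. F x $ s = (\<Sum>j\<in>UNIV. green k (norm (x - X j)) * \<eta> s j)" ..
  define \<xi> :: "complex^'n^'m" where "\<xi> = (\<chi> j s. \<eta> s j)"
  have "AE x in lborel. \<forall>s\<in>UNIV. F x $ s = (\<Sum>j\<in>UNIV. green k (norm (x - X j)) * \<eta> s j)"
    by (rule AE_finite_allI) (use \<eta> in auto)
  then have "AE x in lborel. F x = point_sources X k \<xi> x"
    by eventually_elim (simp add: vec_eq_iff point_sources_component \<xi>_def)
  then have "f = abs_l2 (point_sources X k \<xi>)"
    using F abs_l2_eq_iff[OF sF square_integrable_point_sources[OF k]] by (auto simp: represents_def)
  then show ?thesis by blast
qed

lemma continuous_on_point_sources: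
  "continuous_on (- range X) (point_sources X k \<xi> :: real^3 \<Rightarrow> complex^'n)"
proof -
  have "continuous_on (- range X) (\<lambda>x. green k (norm (x - X j)))" for j
    by (rule continuous_on_compose2[OF continuous_on_green[of "- {0}" k]]) (auto intro!: continuous_intros)
  then show ?thesis
    unfolding point_sources_def[abs_def] vector_scalar_mult_def
    by (intro continuous_intros continuous_on_vec_lambda)
qed

text \<open>The set of disagreement is open and of measure zero.\<close>

lemma continuous_AE_eq_imp_eq:
  fixes F G :: "'a::euclidean_space \<Rightarrow> 'b::t2_space"
  assumes S: "open S" and F: "continuous_on S F" and G: "continuous_on S G"
    and ae: "AE x in lborel. F x = G x" and x: "x \<in> S"
  shows "F x = G x"
proof (rule ccontr)
  assume ne: "F x \<noteq> G x"
  define T where "T = {y \<in> S. F y \<noteq> G y}"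
  have "continuous_on S (\<lambda>y. (F y, G y))" using F G by (intro continuous_intros)
  then have "open (S \<inter> (\<lambda>y. (F y, G y)) -` {(a, b) |a b. a \<noteq> b})"
    by (rule continuous_open_preimage[OF _ S open_diagonal_complement])
  moreover have "S \<inter> (\<lambda>y. (F y, G y)) -` {(a, b) |a b. a \<noteq> b} = T" by (auto simp: T_def)
  ultimately have T: "open T" by simp
  have "AE y in lborel. y \<notin> T" using ae by eventually_elim (simp add: T_def)
  then have "emeasure lborel T = 0" using T AE_iff_measurable[of T lborel "\<lambda>y. y \<notin> T"] by simp
  then have "negligible T" using T by (simp add: negligible_iff_emeasure0)
  with T have "T = {}" using open_not_negligible by blast
  with x ne show False by (simp add: T_def)
qed

text \<open>The chosen representative is continuous off the centres and agrees there almost everywhere with the explicit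
one.\<close>

lemma regular_rep_point_sources:
  fixes X :: "'m::finite \<Rightarrow> real^3" and \<xi> :: "complex^'n::finite^'m"
  assumes k: "Im k > 0" and x: "x \<notin> range X"
  shows "regular_rep X (abs_l2 (point_sources X k \<xi>)) x = point_sources X k \<xi> x"
proof -
  let ?g = "point_sources X k \<xi>" and ?R = "regular_rep X (abs_l2 (point_sources X k \<xi>))"
  have sg: "square_integrable ?g" by (rule square_integrable_point_sources[OF k])
  have "\<exists>F. represents F (abs_l2 ?g) \<and> continuous_on (- range X) F"
    using represents_abs[OF sg] continuous_on_point_sources by blast
  from someI_ex[OF this] have "represents ?R (abs_l2 ?g) \<and> continuous_on (- range X) ?R"
    unfolding regular_rep_def .
  moreover from this have "AE x in lborel. ?R x = ?g x"
    using abs_l2_eq_iff[of ?R ?g] sg by (auto simp: represents_def)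
  moreover have "open (- range X)" by (simp add: open_Compl finite_imp_closed)
  ultimately show ?thesis
    using continuous_AE_eq_imp_eq[of "- range X" ?R ?g x] continuous_on_point_sources x by blast
qed

section \<open>Boundary values\<close>

lemma eventually_off_points:
  fixes X :: "'m::finite \<Rightarrow> real^3"
  shows "eventually (\<lambda>x. x \<notin> range X) (at (X j))"
proof -
  have "open (- (range X - {X j}))" by (intro open_Compl finite_imp_closed) simp
  from eventually_at_in_open[OF this, of "X j"] show ?thesis
    by (auto elim!: eventually_mono)
qed

lemma tendsto_vector_scalar_mult:
  assumes "(f \<longlongrightarrow> c) G"
  shows "((\<lambda>x. f x *s (v :: complex^'n)) \<longlongrightarrow> c *s v) G"
  unfolding vector_scalar_mult_def by (intro tendsto_vec_lambda tendsto_mult assms tendsto_const)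

lemma norm_diff_tendsto_0: "((\<lambda>x. norm (x - a)) \<longlongrightarrow> 0) (at (a :: real^3))"
proof -
  have "((\<lambda>x. norm (x - a)) \<longlongrightarrow> norm (a - a)) (at a)" by (intro tendsto_intros)
  then show ?thesis by simp
qed

lemma green_other_tendsto:
  assumes "inj X" "j \<noteq> l"
  shows "((\<lambda>x. green k (norm (x - X l))) \<longlongrightarrow> green k (norm (X j - X l))) (at (X j :: real^3))"
proof -
  have "X j \<noteq> X l" using assms by (metis injD)
  moreover have "open (- {0::real})" by (simp add: open_Compl)
  ultimately have "isCont (green k) (norm (X j - X l))"
    using continuous_on_green[of "- {0}" k] by (simp add: continuous_on_eq_continuous_at)
  then show ?thesis by (rule isCont_tendsto_compose) (intro tendsto_intros)
qed

text \<open>After multiplication by the distance to \<open>X j\<close> only the source at \<open>X j\<close> survives in the limit.\<close>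

lemma xi0_point_sources:
  fixes X :: "'m::finite \<Rightarrow> real^3" and \<xi> :: "complex^'n::finite^'m"
  assumes "inj X" "Im k > 0"
  shows "xi0 X (abs_l2 (point_sources X k \<xi>)) j = (1 / (4 * of_real pi)) *s \<xi> $ j"
  unfolding xi0_def
proof (rule tendsto_Lim)
  let ?r = "\<lambda>x. norm (x - X j)"
  have "((\<lambda>x. exp (\<i> * k * of_real (?r x)) / (4 * of_real pi)) \<longlongrightarrow> exp (\<i> * k * of_real 0) / (4 * of_real pi)) (at (X j))"
    by (intro tendsto_intros norm_diff_tendsto_0) simp
  then have 1: "((\<lambda>x. (exp (\<i> * k * of_real (?r x)) / (4 * of_real pi)) *s \<xi> $ j) \<longlongrightarrow> (1 / (4 * of_real pi)) *s \<xi> $ j) (at (X j))"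
    by (intro tendsto_vector_scalar_mult) simp
  have 2: "((\<lambda>x. \<Sum>l\<in>UNIV - {j}. (of_real (?r x) * green k (norm (x - X l))) *s \<xi> $ l) \<longlongrightarrow>
      (\<Sum>l\<in>UNIV - {j}. (of_real 0 * green k (norm (X j - X l))) *s \<xi> $ l)) (at (X j))"
    by (intro tendsto_sum tendsto_vector_scalar_mult tendsto_mult tendsto_of_real norm_diff_tendsto_0 green_other_tendsto assms) auto
  have "((\<lambda>x. (exp (\<i> * k * of_real (?r x)) / (4 * of_real pi)) *s \<xi> $ j
      + (\<Sum>l\<in>UNIV - {j}. (of_real (?r x) * green k (norm (x - X l))) *s \<xi> $ l)) \<longlongrightarrow> (1 / (4 * of_real pi)) *s \<xi> $ j) (at (X j))"
    using tendsto_add[OF 1 2] by simp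
  then show "((\<lambda>x. ?r x *\<^sub>R regular_rep X (abs_l2 (point_sources X k \<xi>)) x) \<longlongrightarrow> (1 / (4 * of_real pi)) *s \<xi> $ j) (at (X j))"
  proof (rule Lim_transform_eventually)
    show "\<forall>\<^sub>F x in at (X j). (exp (\<i> * k * of_real (?r x)) / (4 * of_real pi)) *s \<xi> $ j
      + (\<Sum>l\<in>UNIV - {j}. (of_real (?r x) * green k (norm (x - X l))) *s \<xi> $ l)
      = ?r x *\<^sub>R regular_rep X (abs_l2 (point_sources X k \<xi>)) x"
      using eventually_off_points[of X j]
    proof eventually_elim
      case (elim x)
      then have r: "?r x \<noteq> 0" by auto
      have "?r x *\<^sub>R point_sources X k \<xi> x = (\<Sum>l\<in>UNIV. (of_real (?r x) * green k (norm (x - X l))) *s \<xi> $ l)"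
        by (simp add: point_sources_def vec_eq_iff sum_distrib_left scaleR_conv_of_real[where 'a=complex] mult.assoc)
      also have "\<dots> = (of_real (?r x) * green k (?r x)) *s \<xi> $ j
          + (\<Sum>l\<in>UNIV - {j}. (of_real (?r x) * green k (norm (x - X l))) *s \<xi> $ l)"
        by (subst sum.remove[of UNIV j]) auto
      also have "of_real (?r x) * green k (?r x) = exp (\<i> * k * of_real (?r x)) / (4 * of_real pi)"
        using r by (simp add: green_def)
      finally show ?case unfolding regular_rep_point_sources[OF assms(2) elim] ..
    qed
  qed
qed (simp add: trivial_limit_at)

lemma Gamma0_point_sources:
  fixes X :: "'m::finite \<Rightarrow> real^3" and \<xi> :: "complex^'n::finite^'m"
  assumes "inj X" "Im k > 0"
  shows "Gamma0 X (abs_l2 (point_sources X k \<xi>)) = \<xi>"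
  by (simp add: Gamma0_def xi0_point_sources[OF assms] vec_eq_iff scaleR_conv_of_real[where 'a=complex])

lemma exp_minus_1_over_tendsto:
  "((\<lambda>r. (exp (c * of_real r) - 1) / of_real r) \<longlongrightarrow> c) (at (0::real))" for c :: complex
proof -
  have "((\<lambda>w. exp (c * w)) has_field_derivative c) (at 0)"
    by (auto intro!: derivative_eq_intros)
  then have "((\<lambda>w. (exp (c * w) - 1) / w) \<longlongrightarrow> c) (at 0)"
    by (simp add: has_field_derivative_iff)
  moreover have "filterlim complex_of_real (at 0) (at 0)"
  proof (rule filterlim_atI)
    have "(complex_of_real \<longlongrightarrow> of_real 0) (at 0)" by (intro tendsto_intros)
    then show "(complex_of_real \<longlongrightarrow> 0) (at 0)" by simp
  qed (auto simp: eventually_at_filter)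
  ultimately show ?thesis by (rule filterlim_compose)
qed

text \<open>Subtracting the singular part from the source at \<open>X j\<close> leaves \<open>(exp (\<i> k r) - 1) / (4 \<pi> r)\<close>, which tends to
\<open>\<i> k / (4 \<pi>)\<close>; the other sources are continuous at \<open>X j\<close>.\<close>

lemma Gamma1_point_sources:
  fixes X :: "'m::finite \<Rightarrow> real^3" and \<xi> :: "complex^'n::finite^'m"
  assumes "inj X" "Im k > 0"
  shows "Gamma1 X (abs_l2 (point_sources X k \<xi>)) $ j
    = (\<i> * k / (4 * of_real pi)) *s \<xi> $ j + (\<Sum>l\<in>UNIV - {j}. green k (norm (X j - X l)) *s \<xi> $ l)"
proof -
  let ?r = "\<lambda>x. norm (x - X j)"
  let ?e = "\<lambda>r. (exp (\<i> * k * of_real r) - 1) / of_real r / (4 * of_real pi)"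
  have "filterlim ?r (at 0) (at (X j))"
    using norm_diff_tendsto_0[of "X j"] by (intro filterlim_atI) (auto simp: eventually_at_filter)
  from filterlim_compose[OF exp_minus_1_over_tendsto this]
  have "((\<lambda>x. ?e (?r x)) \<longlongrightarrow> \<i> * k / (4 * of_real pi)) (at (X j))"
    by (intro tendsto_divide tendsto_const) auto
  then have 1: "((\<lambda>x. ?e (?r x) *s \<xi> $ j) \<longlongrightarrow> (\<i> * k / (4 * of_real pi)) *s \<xi> $ j) (at (X j))"
    by (rule tendsto_vector_scalar_mult)
  have 2: "((\<lambda>x. \<Sum>l\<in>UNIV - {j}. green k (norm (x - X l)) *s \<xi> $ l) \<longlongrightarrow>
      (\<Sum>l\<in>UNIV - {j}. green k (norm (X j - X l)) *s \<xi> $ l)) (at (X j))"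
    by (intro tendsto_sum tendsto_vector_scalar_mult green_other_tendsto assms) auto
  have "Lim (at (X j)) (\<lambda>x. regular_rep X (abs_l2 (point_sources X k \<xi>)) x
      - (1 / ?r x) *\<^sub>R xi0 X (abs_l2 (point_sources X k \<xi>)) j)
    = (\<i> * k / (4 * of_real pi)) *s \<xi> $ j + (\<Sum>l\<in>UNIV - {j}. green k (norm (X j - X l)) *s \<xi> $ l)"
  proof (rule tendsto_Lim)
    from tendsto_add[OF 1 2]
    show "((\<lambda>x. regular_rep X (abs_l2 (point_sources X k \<xi>)) x
        - (1 / ?r x) *\<^sub>R xi0 X (abs_l2 (point_sources X k \<xi>)) j) \<longlongrightarrow>
        (\<i> * k / (4 * of_real pi)) *s \<xi> $ j + (\<Sum>l\<in>UNIV - {j}. green k (norm (X j - X l)) *s \<xi> $ l)) (at (X j))"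
    proof (rule Lim_transform_eventually)
      show "\<forall>\<^sub>F x in at (X j). ?e (?r x) *s \<xi> $ j + (\<Sum>l\<in>UNIV - {j}. green k (norm (x - X l)) *s \<xi> $ l)
        = regular_rep X (abs_l2 (point_sources X k \<xi>)) x
          - (1 / ?r x) *\<^sub>R xi0 X (abs_l2 (point_sources X k \<xi>)) j"
        using eventually_off_points[of X j]
      proof eventually_elim
        case (elim x)
        then have r: "?r x \<noteq> 0" by auto
        have "point_sources X k \<xi> x = green k (?r x) *s \<xi> $ j + (\<Sum>l\<in>UNIV - {j}. green k (norm (x - X l)) *s \<xi> $ l)"
          unfolding point_sources_def by (subst sum.remove[of UNIV j]) auto
        moreover have "?e (?r x) *s \<xi> $ j = green k (?r x) *s \<xi> $ j - (1 / ?r x) *\<^sub>R ((1 / (4 * of_real pi)) *s \<xi> $ j)"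
          by (simp add: vec_eq_iff green_def scaleR_conv_of_real[where 'a=complex] diff_divide_distrib left_diff_distrib)
        ultimately show ?case
          unfolding regular_rep_point_sources[OF assms(2) elim] xi0_point_sources[OF assms] by simp
      qed
    qed
  qed (simp add: trivial_limit_at)
  then show ?thesis by (simp add: Gamma1_def)
qed

theorem proposition4p2:
  fixes X :: "'m::finite \<Rightarrow> real^3" and z :: complex
  assumes "inj X" and "Im z > 0"
  shows "bij_betw (Gamma0 X) (defect_space X z :: 'n::finite l2 set) UNIV \<and>
    (weyl_function X z :: complex^'n^'m \<Rightarrow> complex^'n^'m) = direct_sum_copies (M_s X z) \<and>
    (\<forall>\<xi> :: complex^'n^'m.
       represents
         (\<lambda>x. \<Sum>j\<in>UNIV. (exp (\<i> * sqrt_up z * of_real (norm (x - X j)))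
                          / (4 * of_real pi * of_real (norm (x - X j)))) *s \<xi> $ j)
         (gamma_field X z \<xi>))"
proof -
  define k where "k = sqrt_up z"
  have k: "Im k > 0"
    using assms(2) unfolding k_def by (intro Im_sqrt_up_pos) (auto simp: complex_nonneg_Reals_iff)
  have k2: "k\<^sup>2 = z" unfolding k_def by (rule sqrt_up_power2)
  let ?N = "defect_space X z :: 'n l2 set"
  let ?g = "\<lambda>\<xi> :: complex^'n^'m. abs_l2 (point_sources X k \<xi>)"
  have N: "?g \<xi> \<in> ?N" for \<xi>
    using point_sources_in_defect_space[OF k, of X \<xi>] by (simp add: k2)
  have N_eq: "\<exists>\<xi>. f = ?g \<xi>" if "f \<in> ?N" for f
    using defect_space_point_sources[OF assms(1) k, of f] that by (simp add: k2)
  have G0: "Gamma0 X (?g \<xi>) = \<xi>" for \<xi> by (rule Gamma0_point_sources[OF assms(1) k])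
  have inj: "inj_on (Gamma0 X) ?N"
    by (rule inj_onI) (metis G0 N_eq)
  have bij: "bij_betw (Gamma0 X) ?N UNIV"
    unfolding bij_betw_def using inj N G0 by (metis UNIV_eq_I image_eqI)
  have gamma: "gamma_field X z \<xi> = ?g \<xi>" for \<xi>
    unfolding gamma_field_def by (rule the_inv_into_f_eq[OF inj G0 N])
  have weyl: "weyl_function X z \<xi> = direct_sum_copies (M_s X z) \<xi>" for \<xi> :: "complex^'n^'m"
  proof -
    have "weyl_function X z \<xi> $ j = direct_sum_copies (M_s X z) \<xi> $ j" for j
    proof -
      have G: "G_tilde k (X j - X l) = (if j = l then 0 else green k (norm (X j - X l)))" for l
        using injD[OF assms(1), of j l] by (auto simp: G_tilde_def green_def)
      have "direct_sum_copies (M_s X z) \<xi> $ j = M_s X z $ j $ j *s \<xi> $ j + (\<Sum>l\<in>UNIV - {j}. M_s X z $ j $ l *s \<xi> $ l)"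
        unfolding direct_sum_copies_def by (simp add: sum.remove[of UNIV j])
      also have "M_s X z $ j $ j = \<i> * k / (4 * of_real pi)"
        by (simp add: M_s_def k_def[symmetric] G)
      also have "(\<Sum>l\<in>UNIV - {j}. M_s X z $ j $ l *s \<xi> $ l) = (\<Sum>l\<in>UNIV - {j}. green k (norm (X j - X l)) *s \<xi> $ l)"
        by (intro sum.cong) (auto simp: M_s_def k_def[symmetric] G)
      finally show ?thesis
        using Gamma1_point_sources[OF assms(1) k, of \<xi> j] by (simp add: weyl_function_def gamma)
    qed
    then show ?thesis by (simp add: vec_eq_iff)
  qed
  have rep: "represents (\<lambda>x. \<Sum>j\<in>UNIV. (exp (\<i> * sqrt_up z * of_real (norm (x - X j)))
        / (4 * of_real pi * of_real (norm (x - X j)))) *s \<xi> $ j) (gamma_field X z \<xi>)"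
    for \<xi> :: "complex^'n^'m"
    using represents_abs[OF square_integrable_point_sources[OF k, of X \<xi>]]
    unfolding gamma point_sources_def[abs_def] green_def k_def .
  show ?thesis by (intro conjI bij ext weyl allI rep)
qed

end
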